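(* Let $p>2$. Then $f_p'$ is monotone decreasing in $\mathbb{R}_+$.
   Context: For $p>2$, $$X_p=\Big\{f\in W^{1,p}_{\mathrm{loc}}(0,\infty):\ \int_0^\infty\big(|f'|^2+\tfrac{f^2}{r^2}\big)^{p/2}\,r\,dr<\infty\Big\}$$ (real-valued functions; every $f\in X_p$ has a continuous representative on $[0,\infty)$ with $f(0)=0$), and $$I_p(f)=\int_0^\infty\Big\{\Big[(f')^2+\frac{f^2}{r^2}\Big]^{p/2}+\frac12(1-f^2)^2\Big\}\,r\,dr.$$ $f_p$ denotes the unique non-negative minimizer of $I_p$ over $X_p$; it is of class $C^\infty$ on $(0,\infty)$. Here $\mathbb{R}_+=(0,\infty)$. *)

theory Defs
  imports "HOL-Analysis.Analysis"
begin

text \<open>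
  Functions on \<open>(0,\<infinity>)\<close> are total functions \<open>real \<Rightarrow> real\<close> of which only the values on
  \<open>{0<..}\<close> matter. Elements of Lebesgue and Sobolev spaces are represented by arbitrary
  Lebesgue measurable functions, without quotienting by almost-everywhere equality.
\<close>

definition test_function :: "(real \<Rightarrow> real) \<Rightarrow> bool" where
  "test_function \<phi> \<longleftrightarrow>
     (\<forall>n x. (deriv ^^ n) \<phi> field_differentiable (at x)) \<and>
     compact (closure {x. \<phi> x \<noteq> 0}) \<and> closure {x. \<phi> x \<noteq> 0} \<subseteq> {0<..}"

definition Lp_loc :: "real \<Rightarrow> (real \<Rightarrow> real) \<Rightarrow> bool" where
  "Lp_loc p f \<longleftrightarrow>
     f \<in> borel_measurable (lebesgue_on {0<..}) \<and>
     (\<forall>K. compact K \<and> K \<subseteq> {0<..} \<longrightarrow> set_integrable lebesgue K (\<lambda>r. \<bar>f r\<bar> powr p))"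

definition has_weak_deriv :: "(real \<Rightarrow> real) \<Rightarrow> (real \<Rightarrow> real) \<Rightarrow> bool" where
  "has_weak_deriv f g \<longleftrightarrow>
     Lp_loc 1 f \<and> Lp_loc 1 g \<and>
     (\<forall>\<phi>. test_function \<phi> \<longrightarrow>
        (LINT r:{0<..}|lebesgue. f r * deriv \<phi> r) = - (LINT r:{0<..}|lebesgue. g r * \<phi> r))"

text \<open>
  A weak derivative is determined only up to a null subset of \<open>(0,\<infinity>)\<close>; the integrals below
  do not depend on the choice.
\<close>

definition weak_deriv :: "(real \<Rightarrow> real) \<Rightarrow> real \<Rightarrow> real" where
  "weak_deriv f = (SOME g. has_weak_deriv f g)"

definition W1p_loc :: "real \<Rightarrow> (real \<Rightarrow> real) set" where
  "W1p_loc p = {f. Lp_loc p f \<and> (\<exists>g. Lp_loc p g \<and> has_weak_deriv f g)}"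

definition X_space :: "real \<Rightarrow> (real \<Rightarrow> real) set" where
  "X_space p = {f \<in> W1p_loc p.
     (\<integral>\<^sup>+r\<in>{0<..}. ennreal ((\<bar>weak_deriv f r\<bar>\<^sup>2 + (f r)\<^sup>2 / r\<^sup>2) powr (p / 2) * r) \<partial>lebesgue) < \<infinity>}"

text \<open>
  On \<open>X_space p\<close> the functional may take the value \<open>\<infinity>\<close> (for example at \<open>f = 0\<close>).
\<close>

definition I_functional :: "real \<Rightarrow> (real \<Rightarrow> real) \<Rightarrow> ennreal" where
  "I_functional p f =
     (\<integral>\<^sup>+r\<in>{0<..}. ennreal
        ((((weak_deriv f r)\<^sup>2 + (f r)\<^sup>2 / r\<^sup>2) powr (p / 2) + 1 / 2 * (1 - (f r)\<^sup>2)\<^sup>2) * r) \<partial>lebesgue)"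

definition minimizer :: "real \<Rightarrow> (real \<Rightarrow> real) \<Rightarrow> bool" where
  "minimizer p f \<longleftrightarrow>
     f \<in> X_space p \<and> (\<forall>g \<in> X_space p. I_functional p f \<le> I_functional p g)"

text \<open>
  \<open>f\<close> is a non-negative minimizer, given by its representative that is continuous on
  \<open>[0,\<infinity>)\<close>. Values at negative arguments are unconstrained.
\<close>

definition nonneg_minimizer :: "real \<Rightarrow> (real \<Rightarrow> real) \<Rightarrow> bool" where
  "nonneg_minimizer p f \<longleftrightarrow>
     minimizer p f \<and> continuous_on {0..} f \<and> (\<forall>r>0. f r \<ge> 0)"

end

theory Submission
  imports Defs
begin

text \<open>
  Written in \<open>u = f\<^sup>2\<close>, the energy density is convex. Hence a positive function \<open>w\<close> that is a
  supersolution (subsolution) of the Euler-Lagrange equation on an interval, and equals the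
  minimizer \<open>f\<close> at its ends, has smaller energy there than \<open>f\<close> if \<open>f > w\<close> (\<open>f < w\<close>) inside;
  replacing \<open>f\<close> by \<open>w\<close> contradicts minimality. No regularity of \<open>f\<close> is used.

  For a line \<open>w(r) = a r + c\<close> with \<open>a \<ge> 0\<close> and \<open>c > 0\<close> the sign is that of a convex function of
  \<open>r\<close>, so \<open>w\<close> is a subsolution on an interval and a supersolution on both sides of it. If
  \<open>f\<close> dips below \<open>w\<close> between two contact points, then some point of the dip is not in that
  interval, and the slightly smaller line \<open>\<lambda> w\<close> is exceeded by \<open>f\<close> around one of the contact
  points, where it is a supersolution: on the left this excursion is bounded because
  \<open>f(0) = 0\<close>, on the right because \<open>f \<le> 1\<close>. Constants \<open>w\<close> give monotonicity, chords of \<open>f\<close>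
  give concavity (lines with \<open>c \<le> 0\<close> are subsolutions throughout), and
  log-parabolas exclude corners.
\<close>


section \<open>Smooth cutoff functions\<close>

text \<open>Why the density is convex: with \<open>u = f^2\<close> one has
  \<open>f'^2 = u'^2 / (4 u)\<close>, jointly convex in \<open>(u, u')\<close>; the increasing
  convex power \<open>p / 2 > 1\<close> preserves this, and the potential is quadratic in
  \<open>u\<close>. Its second-order term \<open>(f^2 - w^2)^2 / 2\<close> survives in the tangent
  inequality and makes every comparison strict.

  The obstacle is that \<open>f\<close> is only a continuous function with an arbitrarily chosen
  weak derivative. Differentiating the Euler-Lagrange equation would first require a regularity
  theory, so each step compares energies with an explicit \<open>w\<close> instead, and the
  classical derivative of \<open>f\<close> is itself a result: concavity yields one-sided slopes,
  and one more comparison shows that they agree. What has to be known about weak derivatives reduces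
  to one bridge, in both directions: for a continuous function they are the same as integrable
  densities of which it is the primitive.

  The Euler-Lagrange expression of a line is a gradient part minus a multiple of
  \<open>1 - w^2\<close>. The gradient part is convex because it is a sum of products of nonnegative
  decreasing convex functions of \<open>r\<close>, which needs some rewriting when
  \<open>p < 4\<close>.\<close>

definition smooth :: "(real \<Rightarrow> real) \<Rightarrow> bool" where
  "smooth f \<longleftrightarrow> (\<forall>n x. (deriv ^^ n) f field_differentiable (at x))"

text \<open>A family closed under differentiation consists of smooth functions; exhibiting one
  avoids formulas for iterated derivatives.\<close>

lemma smooth_coinduct:
  assumes "f \<in> F" and F: "\<And>f. f \<in> F \<Longrightarrow> \<exists>f'\<in>F. \<forall>x. (f has_field_derivative f' x) (at x)"
  shows "smooth f"
proof -
  have "(deriv ^^ n) f \<in> F" for n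
  proof (induction n)
    case (Suc n)
    then obtain g where g: "g \<in> F" "\<And>x. ((deriv ^^ n) f has_field_derivative g x) (at x)"
      using F by blast
    then have "deriv ((deriv ^^ n) f) = g" by (auto intro!: DERIV_imp_deriv)
    with g show ?case by simp
  qed (use assms in simp)
  then show ?thesis
    unfolding smooth_def using F field_differentiable_def by metis
qed

lemma smooth_deriv: "smooth f \<Longrightarrow> smooth (deriv f)"
  unfolding smooth_def by (metis funpow_Suc_right o_apply)

lemma smooth_DERIV:
  assumes "smooth f" shows "(f has_field_derivative deriv f x) (at x)"
proof -
  have "((deriv ^^ 0) f) field_differentiable (at x)"
    using assms unfolding smooth_def by blast
  then show ?thesis by (simp add: DERIV_deriv_iff_field_differentiable)
qed

lemma smooth_continuous_on:
  assumes "smooth f" shows "continuous_on S f"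
  using DERIV_isCont[OF smooth_DERIV[OF assms]] by (simp add: continuous_at_imp_continuous_on)

lemma smooth_diff:
  assumes "smooth f" "smooth g" shows "smooth (\<lambda>x. f x - g x)"
proof (rule smooth_coinduct[where F = "{\<lambda>x. f x - g x |f g. smooth f \<and> smooth g}"])
  fix h :: "real \<Rightarrow> real" assume "h \<in> {\<lambda>x. f x - g x |f g. smooth f \<and> smooth g}"
  then obtain f g where h: "h = (\<lambda>x. f x - g x)" "smooth f" "smooth g" by blast
  then have "(h has_field_derivative deriv f x - deriv g x) (at x)" for x
    by (auto intro!: DERIV_diff smooth_DERIV)
  then show "\<exists>h'\<in>{\<lambda>x. f x - g x |f g. smooth f \<and> smooth g}. \<forall>x. (h has_field_derivative h' x) (at x)"
    by (intro bexI[of _ "\<lambda>x. deriv f x - deriv g x"] allI CollectI exI[of _ "deriv f"] exI[of _ "deriv g"])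
       (use h in \<open>simp_all add: smooth_deriv\<close>)
qed (use assms in blast)

lemma smooth_affine:
  assumes "smooth f" shows "smooth (\<lambda>x. f (m * (x - a)))"
proof (rule smooth_coinduct[where F = "{\<lambda>x. C * g (m * (x - a)) |g C. smooth g}"])
  show "(\<lambda>x. f (m * (x - a))) \<in> {\<lambda>x. C * g (m * (x - a)) |g C. smooth g}"
    by (rule CollectI, rule exI[of _ f], rule exI[of _ 1]) (simp add: assms)
  fix h assume "h \<in> {\<lambda>x. C * g (m * (x - a)) |g C. smooth g}"
  then obtain g C where g: "smooth g" "h = (\<lambda>x. C * g (m * (x - a)))" by blast
  have "(h has_field_derivative (C * m) * deriv g (m * (x - a))) (at x)" for x
  proof -
    have *: "((\<lambda>x. m * (x - a)) has_field_derivative m) (at x)" by (auto intro!: derivative_eq_intros)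
    then show ?thesis
      unfolding g(2) using DERIV_cmult[OF DERIV_chain2[OF smooth_DERIV[OF g(1)] *], of C]
      by (simp add: mult.assoc mult.commute[of m])
  qed
  then show "\<exists>h'\<in>{\<lambda>x. C * g (m * (x - a)) |g C. smooth g}. \<forall>x. (h has_field_derivative h' x) (at x)"
    by (intro bexI[of _ "\<lambda>x. (C * m) * deriv g (m * (x - a))"] allI CollectI exI[of _ "deriv g"] exI[of _ "C * m"])
       (simp_all add: smooth_deriv[OF g(1)])
qed

text \<open>The bump \<open>exp (-1 / (x (1 - x)))\<close> with rational prefactors: a family that
  contains the bump and is closed under differentiation.\<close>

definition flat :: "real poly \<Rightarrow> nat \<Rightarrow> real \<Rightarrow> real" where
  "flat P k x = (if 0 < x \<and> x < 1 then poly P x / (x * (1 - x)) ^ k * exp (- 1 / (x * (1 - x))) else 0)"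

text \<open>The estimate \<open>(t / n)^n \<le> exp t\<close> at \<open>t = 1 / w\<close> and
  \<open>n = k + 2\<close>. The two powers beyond \<open>k\<close> leave a factor
  \<open>w^2\<close>, hence second-order vanishing at both ends of the unit interval.\<close>

lemma power_exp_bound:
  fixes w :: real assumes "0 < w"
  shows "exp (- 1 / w) / w ^ k \<le> real (k + 2) ^ (k + 2) * w\<^sup>2"
proof -
  let ?n = "k + 2"
  have "(1 / w / ?n) ^ ?n \<le> exp (1 / w / ?n) ^ ?n"
    using assms exp_ge_add_one_self[of "1 / w / ?n"] by (intro power_mono) (linarith, simp)
  also have "exp (1 / w / ?n) ^ ?n = exp (1 / w)"
    by (rule exp_divide_power_eq) simp
  finally have "1 / (real ?n ^ ?n * w ^ ?n) \<le> exp (1 / w)"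
    by (simp only: power_divide power_mult_distrib power_one divide_divide_eq_left mult.commute)
  then have "1 / exp (1 / w) \<le> real ?n ^ ?n * w ^ ?n"
    using assms by (simp add: divide_simps mult.commute del: power_Suc power_add_numeral2 add_2_eq_Suc')
  then show ?thesis
    using assms by (simp add: exp_minus inverse_eq_divide power_add power2_eq_square field_simps)
qed

lemma flat_quadratic_bound:
  obtains C where "\<And>x. \<bar>flat P k x\<bar> \<le> C * x\<^sup>2" "\<And>x. \<bar>flat P k x\<bar> \<le> C * (x - 1)\<^sup>2"
proof -
  have "compact ((poly P) ` {0..1})"
    by (intro compact_continuous_image continuous_intros) auto
  then obtain B where B: "\<And>x. x \<in> {0..1} \<Longrightarrow> \<bar>poly P x\<bar> \<le> B"
    by (metis bounded_iff compact_imp_bounded imageI real_norm_def)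
  define C where "C = B * real (k + 2) ^ (k + 2)"
  have "B \<ge> 0" using B[of 0] by (simp add: order_trans[OF abs_ge_zero])
  then have C0: "C \<ge> 0" unfolding C_def by simp
  have main: "\<bar>flat P k x\<bar> \<le> C * (x * (1 - x))\<^sup>2" if "0 < x" "x < 1" for x
  proof -
    have "\<bar>flat P k x\<bar> = \<bar>poly P x\<bar> * (exp (- 1 / (x * (1 - x))) / (x * (1 - x)) ^ k)"
      using that by (simp add: flat_def abs_mult)
    also have "\<dots> \<le> B * (real (k + 2) ^ (k + 2) * (x * (1 - x))\<^sup>2)"
      using that B[of x] \<open>B \<ge> 0\<close> by (intro mult_mono power_exp_bound) auto
    finally show ?thesis by (simp add: C_def)
  qed
  show ?thesis
  proof (rule that[of C])
    fix x
    show "\<bar>flat P k x\<bar> \<le> C * x\<^sup>2"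
    proof (cases "0 < x \<and> x < 1")
      case True
      then have "(x * (1 - x))\<^sup>2 \<le> (x * 1)\<^sup>2" by (intro power_mono mult_left_mono) auto
      then show ?thesis using main[of x] True C0 by (simp add: order_trans[OF _ mult_left_mono])
    qed (use C0 in \<open>auto simp: flat_def\<close>)
    show "\<bar>flat P k x\<bar> \<le> C * (x - 1)\<^sup>2"
    proof (cases "0 < x \<and> x < 1")
      case True
      then have "(x * (1 - x))\<^sup>2 \<le> (1 * (1 - x))\<^sup>2" by (intro power_mono mult_right_mono) auto
      then show ?thesis using main[of x] True C0
        by (simp add: order_trans[OF _ mult_left_mono] power2_commute)
    qed (use C0 in \<open>auto simp: flat_def\<close>)
  qed
qed

lemma DERIV_0_quadratic:
  fixes g :: "real \<Rightarrow> real"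
  assumes "\<And>x. \<bar>g x\<bar> \<le> C * (x - a)\<^sup>2"
  shows "(g has_field_derivative 0) (at a)"
proof -
  have ga: "g a = 0" using assms[of a] by simp
  have "((\<lambda>h. g (a + h) / h) \<longlongrightarrow> 0) (at 0)"
  proof (rule Lim_null_comparison)
    show "\<forall>\<^sub>F h in at 0. norm (g (a + h) / h) \<le> C * \<bar>h\<bar>"
      unfolding eventually_at_filter
    proof (rule always_eventually, intro allI impI)
      fix h :: real assume "h \<noteq> 0"
      then show "norm (g (a + h) / h) \<le> C * \<bar>h\<bar>"
        using assms[of "a + h"] by (simp add: abs_mult field_simps power2_eq_square)
    qed
    show "((\<lambda>h. C * \<bar>h\<bar>) \<longlongrightarrow> 0) (at 0)" by (auto intro!: tendsto_eq_intros)
  qed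
  then show ?thesis by (simp add: DERIV_def ga)
qed

text \<open>At 0 and 1 the quadratic bound forces derivative 0; inside it is the quotient rule,
  where \<open>[:0, 1, -1:]\<close> is \<open>x (1 - x)\<close>, \<open>[:1, -2:]\<close> is its
  derivative, and \<open>k + 2\<close> is the power that clears denominators.\<close>

lemma flat_DERIV:
  "(flat P k has_field_derivative
     flat (pderiv P * [:0, 1, -1:] ^ 2 - of_nat k * P * [:1, -2:] * [:0, 1, -1:] + P * [:1, -2:]) (k + 2) x) (at x)"
  (is "(_ has_field_derivative flat ?Q _ _) _")
proof -
  obtain C where C: "\<And>x. \<bar>flat P k x\<bar> \<le> C * x\<^sup>2" "\<And>x. \<bar>flat P k x\<bar> \<le> C * (x - 1)\<^sup>2"
    using flat_quadratic_bound by blast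
  consider "x = 0" | "x = 1" | "x < 0 \<or> x > 1" | "0 < x" "x < 1" by linarith
  then show ?thesis
  proof cases
    case 1 then show ?thesis using DERIV_0_quadratic[of "flat P k" C 0] C(1) by (simp add: flat_def)
  next
    case 2 then show ?thesis using DERIV_0_quadratic[of "flat P k" C 1] C(2) by (simp add: flat_def)
  next
    case 3
    then have "x \<in> - {0..1}" by auto
    have "(flat P k has_field_derivative 0) (at x)"
      by (rule has_field_derivative_transform_within_open[OF DERIV_const, where S = "- {0..1}"])
         (use \<open>x \<in> - {0..1}\<close> in \<open>auto simp: flat_def open_Compl\<close>)
    then show ?thesis using 3 by (auto simp: flat_def)
  next
    case 4
    define w where "w = x * (1 - x)"
    have w: "w > 0" using 4 by (simp add: w_def)
    have "((\<lambda>x. poly P x / (x * (1 - x)) ^ k * exp (- 1 / (x * (1 - x)))) has_field_derivative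
       ((poly (pderiv P) x * w ^ k - poly P x * (of_nat k * (1 - 2 * x) * w ^ (k - 1))) / (w ^ k * w ^ k) * exp (- 1 / w)
        + exp (- 1 / w) * ((1 - 2 * x) / w\<^sup>2) * (poly P x / w ^ k))) (at x)"
    proof -
      have 1: "((\<lambda>x. (x * (1 - x)) ^ k) has_field_derivative of_nat k * (1 - 2 * x) * w ^ (k - 1)) (at x)"
        unfolding w_def by (auto intro!: derivative_eq_intros)
      have 2: "((\<lambda>x. exp (- 1 / (x * (1 - x)))) has_field_derivative exp (- 1 / w) * ((1 - 2 * x) / w\<^sup>2)) (at x)"
        unfolding w_def using 4
        by (auto intro!: derivative_eq_intros simp: power2_eq_square minus_divide_left algebra_simps simp del: divide_minus_left)
      show ?thesis
        by (rule DERIV_cong[OF DERIV_mult'[OF DERIV_divide[OF poly_DERIV[of P x] 1] 2]])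
           (use 4 in \<open>simp_all add: w_def power2_eq_square mult_ac\<close>)
    qed
    also have "(poly (pderiv P) x * w ^ k - poly P x * (of_nat k * (1 - 2 * x) * w ^ (k - 1))) / (w ^ k * w ^ k) * exp (- 1 / w)
        + exp (- 1 / w) * ((1 - 2 * x) / w\<^sup>2) * (poly P x / w ^ k) =
        (poly (pderiv P) x * w\<^sup>2 - of_nat k * poly P x * (1 - 2 * x) * w + poly P x * (1 - 2 * x)) / w ^ (k + 2) * exp (- 1 / w)"
      using w by (cases k) (auto simp: field_simps power2_eq_square)
    also have "\<dots> = flat ?Q (k + 2) x"
      using 4 by (simp add: flat_def w_def algebra_simps)
    finally have D: "((\<lambda>x. poly P x / (x * (1 - x)) ^ k * exp (- 1 / (x * (1 - x)))) has_field_derivative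
       flat ?Q (k + 2) x) (at x)" .
    show ?thesis
      by (rule has_field_derivative_transform_within_open[OF D, where S = "{0<..<1}"])
         (use 4 in \<open>auto simp: flat_def\<close>)
  qed
qed

lemma smooth_flat: "smooth (flat P k)"
proof (rule smooth_coinduct[where F = "range (\<lambda>(P, k). flat P k)"])
  fix h assume "h \<in> range (\<lambda>(P, k). flat P k)"
  then obtain P k where "h = flat P k" by auto
  then show "\<exists>h'\<in>range (\<lambda>(P, k). flat P k). \<forall>x. (h has_field_derivative h' x) (at x)"
    using flat_DERIV[of P k] by (metis case_prod_conv rangeI)
qed (metis case_prod_conv rangeI)

lemma smooth_antiderivative:
  assumes "smooth g" and "\<And>x. (f has_field_derivative g x) (at x)"
  shows "smooth f"
proof (rule smooth_coinduct[where F = "insert f {g. smooth g}"])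
  fix h assume "h \<in> insert f {g. smooth g}"
  then consider "h = f" | "smooth h" by blast
  then show "\<exists>h'\<in>insert f {g. smooth g}. \<forall>x. (h has_field_derivative h' x) (at x)"
    by cases (use assms smooth_DERIV smooth_deriv in blast)+
qed simp

text \<open>The normalised primitive of a bump. Its rescaled derivatives will serve as a nonnegative
  approximate identity, and differences of its translates as test functions.\<close>

lemma smooth_step:
  obtains S where "smooth S" "\<And>x. x \<le> 0 \<Longrightarrow> S x = 0" "\<And>x. x \<ge> 1 \<Longrightarrow> S x = 1" "\<And>x. deriv S x \<ge> 0"
proof -
  let ?b = "flat 1 0"
  have b0: "?b x \<ge> 0" for x by (simp add: flat_def)
  have "isCont ?b x" for x
    using smooth_DERIV[OF smooth_flat] DERIV_isCont by blast
  then obtain F where F: "\<And>x. (F has_field_derivative ?b x) (at x)"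
    using einterval_antiderivative[of "-\<infinity>" "\<infinity>" ?b]
    by (auto simp: has_real_derivative_iff_has_vector_derivative)
  have mono: "F x \<le> F y" if "x \<le> y" for x y
    using F b0 by (intro DERIV_nonneg_imp_nondecreasing[OF that]) blast
  have "F (1/4) < F (3/4)"
    by (rule DERIV_pos_imp_increasing) (use F in \<open>force simp: flat_def\<close>)+
  with mono[of 0 "1/4"] mono[of "3/4" 1] have F01: "F 0 < F 1" by simp
  have const: "F x = F y" if "x \<le> y" "\<And>z. x < z \<Longrightarrow> z < y \<Longrightarrow> ?b z = 0" for x y
  proof (rule ccontr)
    assume "F x \<noteq> F y"
    then have "x < y" using that(1) by (cases "x = y") auto
    then obtain z where "x < z" "z < y" "F y - F x = (y - x) * ?b z"
      using MVT2[of x y F ?b] F by auto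
    with that \<open>F x \<noteq> F y\<close> show False by simp
  qed
  define S where "S x = (F x - F 0) / (F 1 - F 0)" for x
  have D: "(S has_field_derivative ?b x / (F 1 - F 0)) (at x)" for x
    unfolding S_def by (rule derivative_eq_intros F refl | use F01 in simp)+
  have "smooth S"
  proof (rule smooth_antiderivative[OF _ D])
    have *: "?b x / (F 1 - F 0) = flat [:1 / (F 1 - F 0):] 0 x" for x by (simp add: flat_def)
    show "smooth (\<lambda>x. ?b x / (F 1 - F 0))" unfolding * by (rule smooth_flat)
  qed
  moreover have "S x = 0" if "x \<le> 0" for x
    using const[of x 0] that by (simp add: S_def flat_def)
  moreover have "S x = 1" if "x \<ge> 1" for x
    using const[of 1 x] that F01 by (simp add: S_def flat_def)
  moreover have "deriv S x \<ge> 0" for x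
    using DERIV_imp_deriv[OF D, of x] b0 F01 by simp
  ultimately show ?thesis using that by blast
qed

section \<open>Primitives of integrable functions\<close>

text \<open>Absolute continuity in integrated form: \<open>g\<close> matters only up to null sets,
  and \<open>F\<close> is not asked to be differentiable at any point.\<close>

definition L1_prim :: "real \<Rightarrow> real \<Rightarrow> (real \<Rightarrow> real) \<Rightarrow> (real \<Rightarrow> real) \<Rightarrow> bool" where
  "L1_prim a b F g \<longleftrightarrow> g absolutely_integrable_on {a..b} \<and> (\<forall>x\<in>{a..b}. integral {a..x} g = F x - F a)"

lemma absolutely_integrable_imp_integrable_sub:
  fixes g :: "real \<Rightarrow> real"
  assumes "g absolutely_integrable_on {a..b}" "a \<le> c" "d \<le> b"
  shows "g integrable_on {c..d}"
proof -
  have "g absolutely_integrable_on {c..d}"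
    using assms by (intro absolutely_integrable_on_subinterval[OF assms(1)]) auto
  then show ?thesis by (rule set_lebesgue_integral_eq_integral(1))
qed

lemma L1_prim_integrable:
  assumes "L1_prim a b F g" "a \<le> c" "d \<le> b"
  shows "g integrable_on {c..d}"
  using assms(1) absolutely_integrable_imp_integrable_sub[OF _ assms(2,3), of g]
  by (simp add: L1_prim_def)

lemma L1_prim_continuous:
  assumes "L1_prim a b F g" shows "continuous_on {a..b} F"
proof -
  have "continuous_on {a..b} (\<lambda>x. F a + integral {a..x} g)"
    by (intro continuous_on_add continuous_on_const indefinite_integral_continuous_1
        L1_prim_integrable[OF assms]) auto
  then show ?thesis
    by (rule continuous_on_eq) (use assms in \<open>simp add: L1_prim_def\<close>)
qed

lemma L1_prim_diff:
  assumes "L1_prim a b F g" "a \<le> x" "x \<le> y" "y \<le> b"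
  shows "integral {x..y} g = F y - F x"
proof -
  have "integral {a..x} g + integral {x..y} g = integral {a..y} g"
    using assms by (intro Henstock_Kurzweil_Integration.integral_combine L1_prim_integrable[OF assms(1)]) auto
  moreover have "integral {a..x} g = F x - F a" "integral {a..y} g = F y - F a"
    using assms unfolding L1_prim_def by auto
  ultimately show ?thesis by simp
qed

lemma L1_primI:
  assumes "g absolutely_integrable_on {a..b}"
    and "\<And>x. a \<le> x \<Longrightarrow> x \<le> b \<Longrightarrow> integral {a..x} g = F x - F a"
  shows "L1_prim a b F g"
  unfolding L1_prim_def by (intro conjI ballI assms) simp_all

lemma L1_prim_subinterval:
  assumes "L1_prim a b F g" "a \<le> c" "d \<le> b"
  shows "L1_prim c d F g"
proof (rule L1_primI)
  show "g absolutely_integrable_on {c..d}"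
    using assms unfolding L1_prim_def by (auto intro: absolutely_integrable_on_subinterval)
  show "integral {c..x} g = F x - F c" if "c \<le> x" "x \<le> d" for x
    using that assms(2,3) by (intro L1_prim_diff[OF assms(1)]) auto
qed

lemma L1_prim_join:
  assumes "L1_prim a b F g" "L1_prim b c F g" "a \<le> b" "b \<le> c"
  shows "L1_prim a c F g"
proof (rule L1_primI)
  have "g absolutely_integrable_on {a..b} \<union> {b..c}"
    using assms unfolding L1_prim_def by (intro set_integrable_Un) auto
  then show int: "g absolutely_integrable_on {a..c}"
    using assms by (simp add: ivl_disj_un_two_touch)
  fix x assume x: "a \<le> x" "x \<le> c"
  show "integral {a..x} g = F x - F a"
  proof (cases "x \<le> b")
    case True then show ?thesis using assms x by (intro L1_prim_diff[OF assms(1)]) auto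
  next
    case False
    have "g integrable_on {a..x}"
      using int x by (auto intro: absolutely_integrable_imp_integrable_sub)
    then have "integral {a..b} g + integral {b..x} g = integral {a..x} g"
      using assms False by (intro Henstock_Kurzweil_Integration.integral_combine) auto
    then show ?thesis
      using L1_prim_diff[OF assms(1), of a b] L1_prim_diff[OF assms(2), of b x] assms x False by auto
  qed
qed

text \<open>The density may change at both end points, as is needed when pieces with different
  derivatives are glued.\<close>

lemma L1_prim_cong:
  assumes "L1_prim a b F g" "\<And>x. a \<le> x \<Longrightarrow> x \<le> b \<Longrightarrow> F' x = F x"
    and "\<And>x. a < x \<Longrightarrow> x < b \<Longrightarrow> g' x = g x"
  shows "L1_prim a b F' g'"
proof (rule L1_primI)
  have *: "x \<in> {a..b} - {a,b} \<Longrightarrow> g' x = g x" for x using assms(3) by auto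
  show "g' absolutely_integrable_on {a..b}"
    using assms(1) unfolding L1_prim_def
    by (elim conjE absolutely_integrable_spike[of _ _ "{a,b}"]) (use * in auto)
  fix x assume x: "a \<le> x" "x \<le> b"
  have "integral {a..x} g' = integral {a..x} g"
    by (rule integral_spike[of "{a,b}"]) (use x assms(3) in auto)
  then show "integral {a..x} g' = F' x - F' a"
    using L1_prim_diff[OF assms(1), of a x] x assms(2) by simp
qed

lemma L1_prim_C1:
  assumes "\<And>x. a \<le> x \<Longrightarrow> x \<le> b \<Longrightarrow> (F has_field_derivative g x) (at x within {a..b})"
    and "continuous_on {a..b} g"
  shows "L1_prim a b F g"
proof (rule L1_primI)
  show "g absolutely_integrable_on {a..b}"
    using assms(2) by (rule absolutely_integrable_continuous_real)
  fix x assume x: "a \<le> x" "x \<le> b"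
  have "(g has_integral (F x - F a)) {a..x}"
  proof (rule fundamental_theorem_of_calculus)
    fix y assume "y \<in> {a..x}"
    then have "(F has_field_derivative g y) (at y within {a..b})" using assms(1)[of y] x by auto
    then show "(F has_vector_derivative g y) (at y within {a..x})"
      unfolding has_real_derivative_iff_has_vector_derivative
      by (rule has_vector_derivative_within_subset) (use x in auto)
  qed (use x in simp)
  then show "integral {a..x} g = F x - F a" by (rule integral_unique)
qed

lemma absolutely_integrable_continuous_mult:
  fixes F g :: "real \<Rightarrow> real"
  assumes "continuous_on {a..b} F" "g absolutely_integrable_on {a..b}"
  shows "(\<lambda>x. F x * g x) absolutely_integrable_on {a..b}"
proof (rule absolutely_integrable_bounded_measurable_product_real)
  show "F \<in> borel_measurable (lebesgue_on {a..b})"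
    using assms(1) by (rule continuous_imp_measurable_on_sets_lebesgue) simp
  show "bounded (F ` {a..b})"
    using assms(1) by (intro compact_imp_bounded compact_continuous_image) auto
qed (use assms in auto)

text \<open>The defect of the product rule is additive in the interval and, locally,
  small compared with \<open>\<integral> (\<bar>f\<bar> + \<bar>g\<bar>)\<close>.\<close>

lemma L1_prim_mult:
  assumes F: "L1_prim a b F f" and G: "L1_prim a b G g"
  shows "L1_prim a b (\<lambda>x. F x * G x) (\<lambda>x. F x * g x + G x * f x)"
proof (rule L1_primI)
  let ?h = "\<lambda>x. F x * g x + G x * f x"
  have af: "f absolutely_integrable_on {a..b}" and ag: "g absolutely_integrable_on {a..b}"
    using F G by (auto simp: L1_prim_def)
  note cF = L1_prim_continuous[OF F] and cG = L1_prim_continuous[OF G]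
  show ah: "?h absolutely_integrable_on {a..b}"
    by (intro set_integral_add absolutely_integrable_continuous_mult cF cG af ag)
  define m where "m x = \<bar>f x\<bar> + \<bar>g x\<bar>" for x
  have am: "m absolutely_integrable_on {a..b}"
    unfolding m_def by (intro set_integral_add set_integrable_abs af ag)
  have sub: "h integrable_on {x..y}" if "h absolutely_integrable_on {a..b}" "a \<le> x" "y \<le> b"
    for h :: "real \<Rightarrow> real" and x y
    using absolutely_integrable_imp_integrable_sub[OF that] .
  have comb: "integral {x..y} h + integral {y..z} h = integral {x..z} h"
    if "h absolutely_integrable_on {a..b}" "a \<le> x" "x \<le> y" "y \<le> z" "z \<le> b" for h :: "real \<Rightarrow> real" and x y z
    using that by (intro Henstock_Kurzweil_Integration.integral_combine sub) auto
  fix t assume t: "a \<le> t" "t \<le> b"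
  define D where "D x y = F y * G y - F x * G x - integral {x..y} ?h" for x y
  have "\<bar>D a t\<bar> \<le> e * integral {a..t} m" if e: "e > 0" for e
  proof -
    \<comment> \<open>\<open>Bolzano\<close> acts as a covering argument: a bound that adds up over
      adjacent intervals and holds on all short intervals around each point holds on the whole
      interval.\<close>
    define P where "P x y \<longleftrightarrow> (a \<le> x \<longrightarrow> y \<le> t \<longrightarrow> \<bar>D x y\<bar> \<le> e * integral {x..y} m)" for x y
    have "P a t"
    proof (rule Bolzano[of a t P, OF t(1)])
      fix x y z assume trans: "P x y" "P y z" "x \<le> y" "y \<le> z"
      show "P x z"
        unfolding P_def
      proof (intro impI)
        assume "a \<le> x" "z \<le> t"
        then have "\<bar>D x y\<bar> \<le> e * integral {x..y} m" "\<bar>D y z\<bar> \<le> e * integral {y..z} m"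
          using trans t by (auto simp: P_def)
        moreover have "D x z = D x y + D y z"
          unfolding D_def using comb[OF ah, of x y z] trans \<open>a \<le> x\<close> \<open>z \<le> t\<close> t by simp
        moreover have "integral {x..z} m = integral {x..y} m + integral {y..z} m"
          using comb[OF am, of x y z] trans \<open>a \<le> x\<close> \<open>z \<le> t\<close> t by simp
        ultimately show "\<bar>D x z\<bar> \<le> e * integral {x..z} m"
          by (simp add: distrib_left)
      qed
    next
      fix x assume "a \<le> x" "x \<le> t"
      then have x: "x \<in> {a..b}" using t by simp
      obtain d1 where d1: "d1 > 0" "\<And>y. y \<in> {a..b} \<Longrightarrow> \<bar>y - x\<bar> < d1 \<Longrightarrow> \<bar>F y - F x\<bar> < e / 2"
        using cF x half_gt_zero[OF e] unfolding continuous_on_iff dist_real_def by metis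
      obtain d2 where d2: "d2 > 0" "\<And>y. y \<in> {a..b} \<Longrightarrow> \<bar>y - x\<bar> < d2 \<Longrightarrow> \<bar>G y - G x\<bar> < e / 2"
        using cG x half_gt_zero[OF e] unfolding continuous_on_iff dist_real_def by metis
      show "\<exists>d>0. \<forall>u v. u \<le> x \<and> x \<le> v \<and> v - u < d \<longrightarrow> P u v"
        unfolding P_def
      proof (intro exI[of _ "min d1 d2"] conjI allI impI)
        fix u v assume uv: "u \<le> x \<and> x \<le> v \<and> v - u < min d1 d2" "a \<le> u" "v \<le> t"
        have uv': "u \<le> v" "v \<le> b" using uv t by auto
        have near: "\<bar>F v - F y\<bar> \<le> e" "\<bar>G u - G y\<bar> \<le> e" if "y \<in> {u..v}" for y
        proof -
          have "y \<in> {a..b}" "u \<in> {a..b}" "v \<in> {a..b}" "\<bar>y - x\<bar> < d1" "\<bar>v - x\<bar> < d1" "\<bar>y - x\<bar> < d2" "\<bar>u - x\<bar> < d2"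
            using that uv uv' by auto
          then show "\<bar>F v - F y\<bar> \<le> e" "\<bar>G u - G y\<bar> \<le> e"
            using d1(2)[of v] d1(2)[of y] d2(2)[of u] d2(2)[of y] by linarith+
        qed
        \<comment> \<open>Freezing \<open>F\<close> at the right end and \<open>G\<close> at the
          left end makes the product formula exact, so that only the oscillations of
          \<open>F\<close> and \<open>G\<close> on the short interval enter the defect.\<close>
        have "F v * G v - F u * G u = F v * integral {u..v} g + G u * integral {u..v} f"
        proof -
          have "integral {u..v} f = F v - F u" "integral {u..v} g = G v - G u"
            using uv uv' by (auto intro: L1_prim_diff[OF F] L1_prim_diff[OF G])
          then show ?thesis by (simp only:) (simp add: algebra_simps)
        qed
        also have "\<dots> = integral {u..v} (\<lambda>y. F v * g y + G u * f y)"
          using sub[OF af, of u v] sub[OF ag, of u v] uv uv'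
          by (subst integral_add) (auto intro: integrable_on_mult_right)
        finally have "D u v = integral {u..v} (\<lambda>y. F v * g y + G u * f y) - integral {u..v} ?h"
          by (simp add: D_def)
        also have "\<dots> = integral {u..v} (\<lambda>y. (F v * g y + G u * f y) - ?h y)"
          using sub[OF af, of u v] sub[OF ag, of u v] sub[OF ah, of u v] uv uv'
          by (subst Henstock_Kurzweil_Integration.integral_diff)
             (auto intro!: integrable_on_mult_right Henstock_Kurzweil_Integration.integrable_add)
        finally have Deq: "D u v = integral {u..v} (\<lambda>y. (F v * g y + G u * f y) - ?h y)" .
        have "norm (D u v) \<le> integral {u..v} (\<lambda>y. e * m y)"
          unfolding Deq
        proof (rule integral_norm_bound_integral)
          show "(\<lambda>y. (F v * g y + G u * f y) - ?h y) integrable_on {u..v}"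
            using sub[OF af, of u v] sub[OF ag, of u v] sub[OF ah, of u v] uv uv'
            by (auto intro!: integrable_on_mult_right Henstock_Kurzweil_Integration.integrable_add Henstock_Kurzweil_Integration.integrable_diff)
          show "(\<lambda>y. e * m y) integrable_on {u..v}"
            using sub[OF am, of u v] uv uv' by (auto intro: integrable_on_mult_right)
          fix y assume y: "y \<in> {u..v}"
          have "(F v * g y + G u * f y) - ?h y = (F v - F y) * g y + (G u - G y) * f y"
            by (simp add: algebra_simps)
          also have "norm \<dots> \<le> e * \<bar>g y\<bar> + e * \<bar>f y\<bar>"
            unfolding real_norm_def
            by (rule order_trans[OF abs_triangle_ineq])
               (auto simp: abs_mult intro!: add_mono mult_right_mono near[OF y])
          finally show "norm ((F v * g y + G u * f y) - ?h y) \<le> e * m y"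
            by (simp add: m_def algebra_simps)
        qed
        then show "\<bar>D u v\<bar> \<le> e * integral {u..v} m" by simp
      qed (use d1 d2 in simp)
    qed
    then show ?thesis by (simp add: P_def)
  qed
  then have "((\<lambda>e. \<bar>D a t\<bar>) \<longlongrightarrow> \<bar>D a t\<bar>) (at_right 0)" "\<forall>\<^sub>F e in at_right 0. \<bar>D a t\<bar> \<le> e * integral {a..t} m"
    by (auto simp: eventually_at_right_less eventually_at_filter)
  moreover have "((\<lambda>e. e * integral {a..t} m) \<longlongrightarrow> 0) (at_right 0)"
    by (auto intro!: tendsto_eq_intros)
  ultimately have "\<bar>D a t\<bar> \<le> 0"
    by (intro tendsto_le[OF _ _ _]) auto
  then show "integral {a..t} ?h = F t * G t - F a * G a" by (simp add: D_def)
qed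

text \<open>The integrals of \<open>k\<close> over all half-lines, cut off at \<open>[a, b]\<close>,
  vanish. Half-lines determine finite Borel measures, so the integrals over all Borel sets vanish
  too. The passage to a Borel version \<open>K'\<close> makes this uniqueness theorem
  applicable.\<close>

lemma L1_prim_0_AE:
  assumes "L1_prim a b (\<lambda>x. 0) k"
  shows "AE x in lebesgue. a \<le> x \<and> x \<le> b \<longrightarrow> k x = 0"
proof (cases "a \<le> b")
  case False then show ?thesis by (auto intro!: AE_I2)
next
  case ab: True
  define K where "K x = indicator {a..b} x * k x" for x
  have K: "integrable lebesgue K"
    using assms unfolding L1_prim_def set_integrable_def K_def[abs_def] by simp
  then have "K \<in> borel_measurable (completion lborel)" by auto
  then obtain K' where K'[measurable]: "K' \<in> borel_measurable lborel" and KK': "AE x in lborel. K x = K' x"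
    using completion_ex_borel_measurable_real by blast
  have KK'2: "AE x in lebesgue. K x = K' x" using KK' by (rule AE_completion)
  have intK': "integrable lborel K'"
  proof -
    have "integrable lebesgue K'"
      using K KK'2 by (subst integrable_cong_AE[of _ _ K]) (auto simp: measurable_completion)
    then show ?thesis by (simp add: integrable_completion)
  qed
  have half: "(LINT x:{t<..}|lborel. K' x) = 0" for t
  proof -
    \<comment> \<open>This clamps \<open>t\<close> to \<open>[a, b]\<close>: cutting
      \<open>K\<close> off at \<open>t\<close> agrees with \<open>k\<close> on
      \<open>[s, b]\<close>, except possibly at the points \<open>t\<close> and
      \<open>b\<close>.\<close>
    define s where "s = max a (min b t)"
    have s: "a \<le> s" "s \<le> b" using ab by (auto simp: s_def)
    have "(LINT x:{t<..}|lborel. K' x) = (LINT x:{t<..}|lebesgue. K' x)"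
      unfolding set_lebesgue_integral_def by (rule integral_completion[symmetric]) simp
    also have "\<dots> = (LINT x:{t<..}|lebesgue. K x)"
      unfolding set_lebesgue_integral_def
    proof (rule integral_cong_AE)
      have t: "{t<..} \<in> sets lebesgue" by simp
      show "(\<lambda>x. indicat_real {t<..} x *\<^sub>R K x) \<in> borel_measurable lebesgue"
        by (rule borel_measurable_integrable[OF integrable_mult_indicator[OF t K]])
      show "(\<lambda>x. indicat_real {t<..} x *\<^sub>R K' x) \<in> borel_measurable lebesgue"
        by (intro measurable_completion) simp
    qed (use KK'2 in auto)
    also have "\<dots> = (LINT x:{s..b}|lebesgue. k x)"
      unfolding set_lebesgue_integral_def
    proof (rule integral_cong_AE)
      have "AE x in lebesgue. x \<noteq> t \<and> x \<noteq> b"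
        using AE_completion[OF AE_lborel_singleton[of t]] AE_completion[OF AE_lborel_singleton[of b]] by (rule AE_conjI)
      then show "AE x in lebesgue. indicat_real {t<..} x *\<^sub>R K x = indicat_real {s..b} x *\<^sub>R k x"
        by eventually_elim (auto simp: K_def s_def indicator_def)
      have "{s..b} \<subseteq> {a..b}" using s by auto
      then have "set_integrable lebesgue {s..b} k"
        using assms unfolding L1_prim_def by (auto intro: absolutely_integrable_on_subinterval)
      then show "(\<lambda>x. indicat_real {s..b} x *\<^sub>R k x) \<in> borel_measurable lebesgue"
        unfolding set_integrable_def by auto
      have t: "{t<..} \<in> sets lebesgue" by simp
      show "(\<lambda>x. indicat_real {t<..} x *\<^sub>R K x) \<in> borel_measurable lebesgue"
        by (rule borel_measurable_integrable[OF integrable_mult_indicator[OF t K]])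
    qed
    also have "\<dots> = integral {s..b} k"
      using s assms unfolding L1_prim_def
      by (intro set_lebesgue_integral_eq_integral(2)) (auto intro: absolutely_integrable_on_subinterval)
    also have "\<dots> = 0"
      using L1_prim_diff[OF assms, of s b] s by simp
    finally show ?thesis .
  qed
  have "AE x in lborel. K' x = 0"
  proof (rule density_unique_real[of lborel K' "\<lambda>x. 0", OF intK'])
    \<comment> \<open>The positive and the negative part of \<open>K'\<close> as densities;
      agreement on half-lines will give equality of the measures.\<close>
    define P where "P = density lborel (\<lambda>x. ennreal (max 0 (K' x)))"
    define N where "N = density lborel (\<lambda>x. ennreal (max 0 (- K' x)))"
    have ip: "integrable lborel (\<lambda>x. max 0 (K' x))" "integrable lborel (\<lambda>x. max 0 (- K' x))"
      using intK' by (auto intro!: Bochner_Integration.integrable_max)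
    have em: "emeasure P A = ennreal (LINT x:A|lborel. max 0 (K' x))"
             "emeasure N A = ennreal (LINT x:A|lborel. max 0 (- K' x))" if [measurable]: "A \<in> sets borel" for A
    proof -
      have *: "emeasure (density lborel (\<lambda>x. ennreal (h x))) A = ennreal (LINT x:A|lborel. h x)"
        if "integrable lborel h" "\<And>x. h x \<ge> 0" for h :: "real \<Rightarrow> real"
      proof -
        have "emeasure (density lborel (\<lambda>x. ennreal (h x))) A = (\<integral>\<^sup>+x. ennreal (indicator A x *\<^sub>R h x) \<partial>lborel)"
          using that by (subst emeasure_density) (auto intro!: nn_integral_cong simp: indicator_def)
        also have "\<dots> = ennreal (LINT x:A|lborel. h x)"
          unfolding set_lebesgue_integral_def
          using that by (intro nn_integral_eq_integral integrable_mult_indicator[of A lborel h]) auto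
        finally show ?thesis .
      qed
      show "emeasure P A = ennreal (LINT x:A|lborel. max 0 (K' x))"
             "emeasure N A = ennreal (LINT x:A|lborel. max 0 (- K' x))"
        unfolding P_def N_def using ip by (auto intro!: *)
    qed
    have dif: "(LINT x:A|lborel. K' x) = (LINT x:A|lborel. max 0 (K' x)) - (LINT x:A|lborel. max 0 (- K' x))"
      if "A \<in> sets borel" for A
    proof -
      have "(LINT x:A|lborel. K' x) = (LINT x:A|lborel. max 0 (K' x) - max 0 (- K' x))"
        by (intro set_lebesgue_integral_cong) (use that in \<open>auto simp: max_def\<close>)
      also have "\<dots> = (LINT x:A|lborel. max 0 (K' x)) - (LINT x:A|lborel. max 0 (- K' x))"
        unfolding set_lebesgue_integral_def scaleR_diff_right
        using ip that by (intro Bochner_Integration.integral_diff)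
          (auto intro!: integrable_mult_indicator simp del: real_scaleR_def)
      finally show ?thesis .
    qed
    have "P = N"
    proof (rule measure_eqI_lessThan)
      show "emeasure P {x<..} = emeasure N {x<..}" for x
        using half[of x] dif[of "{x<..}"] by (simp add: em)
    qed (auto simp: P_def N_def em[unfolded P_def])
    fix A :: "real set" assume "A \<in> sets lborel"
    then have A: "A \<in> sets borel" by simp
    have nn: "(LINT x:A|lborel. max 0 (h x)) \<ge> (0::real)" for h
      unfolding set_lebesgue_integral_def by (rule Bochner_Integration.integral_nonneg) auto
    have "(LINT x:A|lborel. K' x) = 0"
      using em[OF A] dif[OF A] \<open>P = N\<close> nn by simp
    then show "(LINT x:A|lborel. K' x) = (LINT x:A|lborel. 0)" by simp
  qed simp
  then have "AE x in lebesgue. K' x = 0" by (rule AE_completion)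
  with KK'2 show ?thesis
    by eventually_elim (auto simp: K_def indicator_def split: if_splits)
qed

section \<open>Weak derivatives of continuous functions\<close>

lemma compact_pos_subset_interval:
  fixes K :: "real set"
  assumes "compact K" "K \<subseteq> {0<..}"
  obtains a b where "0 < a" "a < b" "K \<subseteq> {a..b}"
proof (cases "K = {}")
  case True then show ?thesis using that[of 1 2] by simp
next
  case False
  obtain a where a: "a \<in> K" "\<And>x. x \<in> K \<Longrightarrow> a \<le> x"
    using compact_attains_inf[OF assms(1) False] by blast
  obtain b where b: "b \<in> K" "\<And>x. x \<in> K \<Longrightarrow> x \<le> b"
    using compact_attains_sup[OF assms(1) False] by blast
  have "0 < a" "a < b + 1" using a assms(2) b(2)[of a] by auto
  moreover have "K \<subseteq> {a..b + 1}" using a b by force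
  ultimately show ?thesis using that by blast
qed

lemma measurable_lebesgue_on_subset:
  assumes "f \<in> borel_measurable (lebesgue_on B)" "A \<subseteq> B"
  shows "f \<in> borel_measurable (lebesgue_on A)"
  using assms by (rule measurable_restrict_mono)

lemma Lp_locI:
  assumes "f \<in> borel_measurable (lebesgue_on {0<..})"
    and "\<And>a b. 0 < a \<Longrightarrow> a < b \<Longrightarrow> (\<lambda>r. \<bar>f r\<bar> powr p) absolutely_integrable_on {a..b}"
  shows "Lp_loc p f"
  unfolding Lp_loc_def
proof (intro conjI allI impI assms(1))
  fix K :: "real set" assume K: "compact K \<and> K \<subseteq> {0<..}"
  then obtain a b where ab: "0 < a" "a < b" "K \<subseteq> {a..b}"
    using compact_pos_subset_interval by blast
  have "K \<in> sets lebesgue" using K by (simp add: borel_compact)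
  then show "(\<lambda>r. \<bar>f r\<bar> powr p) absolutely_integrable_on K"
    using set_integrable_subset[OF assms(2)[OF ab(1,2)] _ ab(3)] by blast
qed

lemma Lp_loc_absolutely_integrable:
  assumes "Lp_loc 1 f" "0 < a"
  shows "f absolutely_integrable_on {a..b}"
proof -
  have "{a..b} \<subseteq> {0<..}" using assms(2) by auto
  then have "(\<lambda>r. \<bar>f r\<bar> powr 1) absolutely_integrable_on {a..b}"
    using assms(1) by (simp add: Lp_loc_def)
  then have "(\<lambda>r. \<bar>f r\<bar>) absolutely_integrable_on {a..b}" by simp
  then have "(\<lambda>r. \<bar>f r\<bar>) integrable_on {a..b}" by (rule set_lebesgue_integral_eq_integral(1))
  moreover have "f \<in> borel_measurable (lebesgue_on {a..b})"
    using assms(1) \<open>{a..b} \<subseteq> {0<..}\<close> unfolding Lp_loc_def by (blast intro: measurable_lebesgue_on_subset)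
  ultimately show ?thesis
    by (subst absolutely_integrable_measurable_real') auto
qed

lemma set_integral_pos_eq_integral:
  fixes h :: "real \<Rightarrow> real"
  assumes "0 < A" "\<And>x. x \<notin> {A..B} \<Longrightarrow> h x = 0" "h absolutely_integrable_on {A..B}"
  shows "(LINT r:{0<..}|lebesgue. h r) = integral {A..B} h"
proof -
  have "(LINT r:{0<..}|lebesgue. h r) = (LINT r:{A..B}|lebesgue. h r)"
    unfolding set_lebesgue_integral_def using assms(1,2)
    by (intro Bochner_Integration.integral_cong) (auto simp: indicator_def)
  also have "\<dots> = integral {A..B} h"
    using assms(3) by (rule set_lebesgue_integral_eq_integral(2))
  finally show ?thesis .
qed

lemma step_deriv_0:
  assumes "\<And>x. x \<le> 0 \<Longrightarrow> S x = (0::real)" "\<And>x. x \<ge> 1 \<Longrightarrow> S x = 1" "y < 0 \<or> y > 1"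
  shows "deriv S y = 0"
proof (rule DERIV_imp_deriv)
  from assms(3) show "(S has_field_derivative 0) (at y)"
  proof
    assume y: "y < 0"
    show ?thesis
      by (rule has_field_derivative_transform_within_open[OF DERIV_const, where S = "{..<0}"])
         (use y assms(1) in auto)
  next
    assume y: "y > 1"
    show ?thesis
      by (rule has_field_derivative_transform_within_open[OF DERIV_const, where S = "{1<..}"])
         (use y assms(2) in auto)
  qed
qed

lemma smooth_affine_DERIV:
  assumes "smooth S"
  shows "((\<lambda>x. S (m * (x - t))) has_real_derivative m * deriv S (m * (x - t))) (at x)"
proof -
  have "((\<lambda>x. m * (x - t)) has_real_derivative m) (at x)" by (auto intro!: derivative_eq_intros)
  from DERIV_chain2[OF smooth_DERIV[OF assms] this] show ?thesis by (simp only: mult.commute)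
qed

text \<open>The kernel has integral 1 and lives on \<open>[c, c + 1 / m]\<close>. Being one-sided,
  it allows \<open>c = A\<close> but needs room to the right of \<open>c\<close>.\<close>

lemma mollify_limit:
  assumes S: "smooth S" "\<And>x. x \<le> 0 \<Longrightarrow> S x = 0" "\<And>x. x \<ge> 1 \<Longrightarrow> S x = 1" "\<And>x. deriv S x \<ge> 0"
    and f: "continuous_on {A..B} f" and c: "A \<le> c" "c < B"
  shows "(\<lambda>n. integral {A..B} (\<lambda>x. f x * (real (Suc n) * deriv S (real (Suc n) * (x - c))))) \<longlonglongrightarrow> f c"
proof (rule LIMSEQ_I)
  fix e :: real assume "e > 0"
  then obtain d where d: "d > 0" "\<And>x. x \<in> {A..B} \<Longrightarrow> \<bar>x - c\<bar> < d \<Longrightarrow> \<bar>f x - f c\<bar> < e / 2"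
    using f c unfolding continuous_on_iff dist_real_def
    by (metis atLeastAtMost_iff half_gt_zero less_eq_real_def)
  obtain N where N: "1 / real (Suc N) < min d (B - c)"
    using d c by (metis diff_gt_0_iff_gt min_less_iff_conj nat_approx_posE)
  show "\<exists>N. \<forall>n\<ge>N. norm (integral {A..B} (\<lambda>x. f x * (real (Suc n) * deriv S (real (Suc n) * (x - c)))) - f c) < e"
  proof (intro exI[of _ N] allI impI)
    fix n assume n: "n \<ge> N"
    define m where "m = real (Suc n)"
    have m: "m > 0" "1 / m \<le> 1 / real (Suc N)"
      using n by (auto simp: m_def intro!: divide_left_mono)
    then have m1: "1 / m < d" "1 / m < B - c" using N by auto
    let ?k = "\<lambda>x. m * deriv S (m * (x - c))"
    have ck: "continuous_on {A..B} ?k"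
      by (intro continuous_intros continuous_on_compose2[OF smooth_continuous_on[OF smooth_deriv[OF S(1)], of UNIV]]) auto
    have "(?k has_integral (S (m * (B - c)) - S (m * (A - c)))) {A..B}"
    proof (rule fundamental_theorem_of_calculus)
      fix x
      have "((\<lambda>x. S (m * (x - c))) has_real_derivative ?k x) (at x)"
        by (rule smooth_affine_DERIV[OF S(1)])
      then show "((\<lambda>x. S (m * (x - c))) has_vector_derivative ?k x) (at x within {A..B})"
        unfolding has_real_derivative_iff_has_vector_derivative by (rule has_vector_derivative_at_within)
    qed (use c in simp)
    moreover have "S (m * (B - c)) = 1" using m m1 by (intro S(3)) (auto simp: field_simps)
    moreover have "S (m * (A - c)) = 0" using m c by (intro S(2)) (auto simp: mult_le_0_iff)
    ultimately have k1: "(?k has_integral 1) {A..B}" by simp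
    have "norm (integral {A..B} (\<lambda>x. (f x - f c) * ?k x)) \<le> integral {A..B} (\<lambda>x. e / 2 * ?k x)"
    proof (rule integral_norm_bound_integral)
      show "(\<lambda>x. (f x - f c) * ?k x) integrable_on {A..B}"
        by (intro integrable_continuous_real continuous_on_mult ck continuous_on_diff f continuous_on_const)
      show "(\<lambda>x. e / 2 * ?k x) integrable_on {A..B}"
        by (intro integrable_continuous_real continuous_on_mult ck continuous_on_const)
      fix x assume x: "x \<in> {A..B}"
      show "norm ((f x - f c) * ?k x) \<le> e / 2 * ?k x"
      proof (cases "0 \<le> m * (x - c) \<and> m * (x - c) \<le> 1")
        case True
        then have "x - c \<ge> 0" "x - c \<le> 1 / m" using m by (auto simp: field_simps zero_le_mult_iff)
        then have "\<bar>f x - f c\<bar> < e / 2" using m1 by (intro d(2)[OF x]) auto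
        then show ?thesis using S(4)[of "m * (x - c)"] m
          by (simp add: abs_mult mult_right_mono del: times_divide_eq_left)
      next
        case False
        then have "deriv S (m * (x - c)) = 0" by (intro step_deriv_0 S) auto
        then show ?thesis by simp
      qed
    qed
    also have "\<dots> = e / 2" using integral_unique[OF has_integral_mult_right[OF k1, of "e / 2"]] by (simp only: mult_1_right)
    finally have b: "norm (integral {A..B} (\<lambda>x. (f x - f c) * ?k x)) \<le> e / 2" .
    have i1: "(\<lambda>x. f x * ?k x) integrable_on {A..B}"
      by (intro integrable_continuous_real continuous_on_mult ck f)
    have "integral {A..B} (\<lambda>x. (f x - f c) * ?k x) = integral {A..B} (\<lambda>x. f x * ?k x - f c * ?k x)"
      by (simp add: left_diff_distrib)
    also have "\<dots> = integral {A..B} (\<lambda>x. f x * ?k x) - f c"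
    proof -
      note k = has_integral_mult_right[OF k1, of "f c"]
      have "integral {A..B} (\<lambda>x. f x * ?k x - f c * ?k x) = integral {A..B} (\<lambda>x. f x * ?k x) - integral {A..B} (\<lambda>x. f c * ?k x)"
        using i1 has_integral_integrable[OF k] by (rule Henstock_Kurzweil_Integration.integral_diff)
      then show ?thesis by (simp only: integral_unique[OF k] mult_1_right)
    qed
    finally show "norm (integral {A..B} (\<lambda>x. f x * (real (Suc n) * deriv S (real (Suc n) * (x - c)))) - f c) < e"
      using b \<open>e > 0\<close> by (simp add: m_def)
  qed
qed

text \<open>Test functions rising from 0 to 1 just after \<open>a\<close> and falling back just
  after \<open>b\<close> converge to the indicator of \<open>(a, b]\<close>, while their derivatives
  converge to point masses at \<open>a\<close> and \<open>b\<close> of opposite sign.\<close>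

lemma has_weak_deriv_imp_integral:
  assumes w: "has_weak_deriv f g" and cf: "continuous_on {0<..} f" and ab: "0 < a" "a < b"
  shows "integral {a..b} g = f b - f a"
proof -
  obtain S where S: "smooth S" "\<And>x. x \<le> 0 \<Longrightarrow> S x = 0" "\<And>x. x \<ge> 1 \<Longrightarrow> S x = 1" "\<And>x. deriv S x \<ge> 0"
    using smooth_step by blast
  let ?m = "\<lambda>n. real (Suc n)"
  \<comment> \<open>The falling ramp occupies \<open>[b, b + 1 / m]\<close> with
    \<open>m \<ge> 1\<close>, so this interval contains all supports and stays inside the open
    half-line.\<close>
  let ?J = "{a..b + 1}"
  define \<phi> where "\<phi> n x = S (?m n * (x - a)) - S (?m n * (x - b))" for n x
  have sm: "smooth (\<phi> n)" for n
    unfolding \<phi>_def[abs_def] by (intro smooth_diff smooth_affine S)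
  have out: "\<phi> n x = 0" if "x \<notin> ?J" for n x
  proof -
    consider "x < a" | "x > b + 1" using \<open>x \<notin> ?J\<close> by fastforce
    then show ?thesis
    proof cases
      case 1
      then have "?m n * (x - a) \<le> 0" "?m n * (x - b) \<le> 0" using ab by (auto simp: mult_le_0_iff)
      then show ?thesis by (simp add: \<phi>_def S(2) del: of_nat_Suc)
    next
      case 2
      then have "1 * 1 \<le> ?m n * (x - a)" "1 * 1 \<le> ?m n * (x - b)"
        using ab by (intro mult_mono; simp)+
      then show ?thesis by (simp add: \<phi>_def S(3) del: of_nat_Suc)
    qed
  qed
  have d\<phi>: "deriv (\<phi> n) x = ?m n * deriv S (?m n * (x - a)) - ?m n * deriv S (?m n * (x - b))" for n x
  proof (rule DERIV_imp_deriv)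
    show "(\<phi> n has_field_derivative ?m n * deriv S (?m n * (x - a)) - ?m n * deriv S (?m n * (x - b))) (at x)"
      unfolding \<phi>_def[abs_def] by (rule DERIV_diff[OF smooth_affine_DERIV[OF S(1)] smooth_affine_DERIV[OF S(1)]])
  qed
  have sub: "closure {x. \<phi> n x \<noteq> 0} \<subseteq> ?J" for n
  proof (rule closure_minimal)
    show "{x. \<phi> n x \<noteq> 0} \<subseteq> ?J" using out[of _ n] by blast
  qed simp
  have test: "test_function (\<phi> n)" for n
    unfolding test_function_def
  proof (intro conjI)
    show "\<forall>k x. (deriv ^^ k) (\<phi> n) field_differentiable at x"
      using sm by (simp add: smooth_def)
    have "bounded (closure {x. \<phi> n x \<noteq> 0})"
      using sub[of n] bounded_closed_interval bounded_subset by blast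
    then show "compact (closure {x. \<phi> n x \<noteq> 0})" by (simp add: compact_eq_bounded_closed)
    show "closure {x. \<phi> n x \<noteq> 0} \<subseteq> {0<..}" using sub[of n] ab by force
  qed
  have cfJ: "continuous_on ?J f" by (rule continuous_on_subset[OF cf]) (use ab in auto)
  have ag: "g absolutely_integrable_on ?J"
    using w ab by (simp add: has_weak_deriv_def Lp_loc_absolutely_integrable)
  have ck: "continuous_on ?J (\<lambda>x. ?m n * deriv S (?m n * (x - t)))" for n t
    by (intro continuous_intros continuous_on_compose2[OF smooth_continuous_on[OF smooth_deriv[OF S(1)], of UNIV]]) auto
  have eq: "integral ?J (\<lambda>x. f x * (?m n * deriv S (?m n * (x - a)))) - integral ?J (\<lambda>x. f x * (?m n * deriv S (?m n * (x - b))))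
     = - integral ?J (\<lambda>x. g x * \<phi> n x)" for n
  proof -
    have "(LINT r:{0<..}|lebesgue. f r * deriv (\<phi> n) r) = integral ?J (\<lambda>r. f r * deriv (\<phi> n) r)"
    proof (rule set_integral_pos_eq_integral)
      fix x assume x: "x \<notin> ?J"
      have "(\<phi> n has_field_derivative 0) (at x)"
        by (rule has_field_derivative_transform_within_open[OF DERIV_const, where S = "- ?J"])
           (use x out in \<open>auto simp: open_Compl\<close>)
      then show "f x * deriv (\<phi> n) x = 0" by (simp add: DERIV_imp_deriv)
    next
      show "(\<lambda>r. f r * deriv (\<phi> n) r) absolutely_integrable_on ?J"
        by (intro absolutely_integrable_continuous_real continuous_on_mult cfJ smooth_continuous_on smooth_deriv sm)
    qed (use ab in simp)
    also have "\<dots> = integral ?J (\<lambda>x. f x * (?m n * deriv S (?m n * (x - a))) - f x * (?m n * deriv S (?m n * (x - b))))"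
      by (simp only: d\<phi> right_diff_distrib)
    also have "\<dots> = integral ?J (\<lambda>x. f x * (?m n * deriv S (?m n * (x - a)))) - integral ?J (\<lambda>x. f x * (?m n * deriv S (?m n * (x - b))))"
      by (intro Henstock_Kurzweil_Integration.integral_diff integrable_continuous_real continuous_on_mult cfJ ck)
    finally have 1: "(LINT r:{0<..}|lebesgue. f r * deriv (\<phi> n) r) = \<dots>" .
    have "(LINT r:{0<..}|lebesgue. g r * \<phi> n r) = integral ?J (\<lambda>r. g r * \<phi> n r)"
    proof (rule set_integral_pos_eq_integral)
      have "(\<lambda>r. \<phi> n r * g r) absolutely_integrable_on ?J"
        by (intro absolutely_integrable_continuous_mult smooth_continuous_on sm ag)
      then show "(\<lambda>r. g r * \<phi> n r) absolutely_integrable_on ?J" by (simp only: mult.commute)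
    qed (use ab out in auto)
    moreover have "(LINT r:{0<..}|lebesgue. f r * deriv (\<phi> n) r) = - (LINT r:{0<..}|lebesgue. g r * \<phi> n r)"
      using w test[of n] by (simp add: has_weak_deriv_def)
    ultimately show ?thesis using 1 by linarith
  qed
  have lim1: "(\<lambda>n. - integral ?J (\<lambda>x. g x * \<phi> n x)) \<longlonglongrightarrow> f a - f b"
    unfolding eq[symmetric] using ab
    by (intro tendsto_diff mollify_limit[OF S cfJ]) auto
  have "(\<lambda>n. integral ?J (\<lambda>x. g x * \<phi> n x)) \<longlonglongrightarrow> integral ?J (\<lambda>x. if x \<in> {a<..b} then g x else 0)"
  proof (rule dominated_convergence(2)[where h = "\<lambda>x. \<bar>g x\<bar>"])
    show "(\<lambda>x. g x * \<phi> n x) integrable_on ?J" for n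
    proof -
      have "(\<lambda>r. \<phi> n r * g r) absolutely_integrable_on ?J"
        by (intro absolutely_integrable_continuous_mult smooth_continuous_on sm ag)
      then have "(\<lambda>r. \<phi> n r * g r) integrable_on ?J" by (rule set_lebesgue_integral_eq_integral(1))
      then show ?thesis by (simp only: mult.commute)
    qed
    show "(\<lambda>x. \<bar>g x\<bar>) integrable_on ?J"
      by (rule set_lebesgue_integral_eq_integral(1)[OF set_integrable_abs[OF ag]])
    have S01: "0 \<le> S y" "S y \<le> 1" for y
    proof -
      have mono: "S u \<le> S v" if "u \<le> v" for u v
        using that by (rule DERIV_nonneg_imp_nondecreasing) (use smooth_DERIV[OF S(1)] S(4) in blast)
      show "0 \<le> S y" using mono[of "min 0 y" y] S(2)[of "min 0 y"] by simp
      show "S y \<le> 1" using mono[of y "max 1 y"] S(3)[of "max 1 y"] by simp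
    qed
    show "norm (g x * \<phi> n x) \<le> \<bar>g x\<bar>" for n x
    proof -
      have "\<bar>\<phi> n x\<bar> \<le> 1"
        using S01[of "?m n * (x - a)"] S01[of "?m n * (x - b)"] by (auto simp: \<phi>_def abs_le_iff simp del: of_nat_Suc)
      then show ?thesis by (simp add: abs_mult mult_left_le)
    qed
    fix x assume "x \<in> ?J"
    have Slim: "(\<lambda>n. S (?m n * (x - t))) \<longlonglongrightarrow> (if x > t then 1 else 0)" for t
    proof (cases "x > t")
      case True
      obtain N where N: "1 / real (Suc N) < x - t" using True by (metis diff_gt_0_iff_gt nat_approx_posE)
      have "S (?m n * (x - t)) = 1" if "n \<ge> N" for n
      proof (rule S(3))
        have "1 \<le> real (Suc N) * (x - t)" using N by (simp add: field_simps del: of_nat_Suc)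
        also have "\<dots> \<le> ?m n * (x - t)" using that True by (intro mult_right_mono) auto
        finally show "1 \<le> ?m n * (x - t)" .
      qed
      then have "\<forall>\<^sub>F n in sequentially. S (?m n * (x - t)) = 1"
        unfolding eventually_sequentially by blast
      then show ?thesis using True by (simp add: tendsto_eventually)
    next
      case False
      then have "?m n * (x - t) \<le> 0" for n by (simp add: mult_le_0_iff)
      then show ?thesis using False by (simp add: S(2) del: of_nat_Suc)
    qed
    have "(\<lambda>n. g x * \<phi> n x) \<longlonglongrightarrow> g x * ((if x > a then 1 else 0) - (if x > b then 1 else 0))"
      unfolding \<phi>_def by (intro tendsto_intros Slim)
    also have "g x * ((if x > a then 1 else 0) - (if x > b then 1 else 0)) = (if x \<in> {a<..b} then g x else 0)"
      using ab by auto
    finally show "(\<lambda>n. g x * \<phi> n x) \<longlonglongrightarrow> (if x \<in> {a<..b} then g x else 0)" .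
  qed
  also have "integral ?J (\<lambda>x. if x \<in> {a<..b} then g x else 0) = integral ?J (\<lambda>x. if x \<in> {a..b} then g x else 0)"
    by (rule integral_spike[of "{a}"]) auto
  also have "\<dots> = integral {a..b} g"
    using integral_restrict_Int[of ?J "{a..b}" g] by (simp add: Int_absorb1)
  finally have "(\<lambda>n. - integral ?J (\<lambda>x. g x * \<phi> n x)) \<longlonglongrightarrow> - integral {a..b} g"
    by (rule tendsto_minus)
  from LIMSEQ_unique[OF this lim1] show ?thesis by simp
qed

lemma has_weak_deriv_imp_L1_prim:
  assumes "has_weak_deriv f g" "continuous_on {0<..} f" "0 < a"
  shows "L1_prim a b f g"
proof (rule L1_primI)
  have "Lp_loc 1 g" using assms(1) unfolding has_weak_deriv_def by blast
  then show "g absolutely_integrable_on {a..b}"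
    using assms(3) by (rule Lp_loc_absolutely_integrable)
  show "integral {a..x} g = f x - f a" if "a \<le> x" for x
    using has_weak_deriv_imp_integral[OF assms, of x] that by (cases "a = x") auto
qed

text \<open>Integration by parts through \<open>L1_prim_mult\<close>; it makes explicit competitors
  admissible.\<close>

lemma L1_prim_imp_has_weak_deriv:
  assumes ch: "continuous_on {0<..} h" and mk: "k \<in> borel_measurable (lebesgue_on {0<..})"
    and prim: "\<And>a b. 0 < a \<Longrightarrow> a < b \<Longrightarrow> L1_prim a b h k"
  shows "has_weak_deriv h k"
  unfolding has_weak_deriv_def
proof (intro conjI allI impI)
  have ch': "continuous_on {a..b} h" if "0 < a" for a b :: real
    by (rule continuous_on_subset[OF ch]) (use that in auto)
  show "Lp_loc 1 h"
  proof (rule Lp_locI)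
    show "h \<in> borel_measurable (lebesgue_on {0<..})"
      using ch by (rule continuous_imp_measurable_on_sets_lebesgue) simp
    show "(\<lambda>r. \<bar>h r\<bar> powr 1) absolutely_integrable_on {a..b}" if "0 < a" for a b
    proof -
      have "(\<lambda>r. \<bar>h r\<bar>) absolutely_integrable_on {a..b}"
        by (intro absolutely_integrable_continuous_real continuous_on_rabs ch' that)
      then show ?thesis by simp
    qed
  qed
  show "Lp_loc 1 k"
  proof (rule Lp_locI[OF mk])
    fix a b :: real assume "0 < a" "a < b"
    then have "k absolutely_integrable_on {a..b}" using prim[of a b] unfolding L1_prim_def by blast
    then have "(\<lambda>r. \<bar>k r\<bar>) absolutely_integrable_on {a..b}" by (rule set_integrable_abs)
    then show "(\<lambda>r. \<bar>k r\<bar> powr 1) absolutely_integrable_on {a..b}" by simp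
  qed
  fix \<phi> assume t: "test_function \<phi>"
  then have sm: "smooth \<phi>" by (simp add: smooth_def test_function_def)
  obtain a0 b0 where ab0: "0 < a0" "a0 < b0" "closure {x. \<phi> x \<noteq> 0} \<subseteq> {a0..b0}"
    using t compact_pos_subset_interval unfolding test_function_def by blast
  define a b where "a = a0 / 2" and "b = b0 + 1"
  have ab: "0 < a" "a < b" using ab0 by (auto simp: a_def b_def)
  have out0: "\<phi> x = 0" if "x \<notin> {a0..b0}" for x
    using ab0(3) closure_subset[of "{x. \<phi> x \<noteq> 0}"] that by blast
  have out: "\<phi> x = 0" "deriv \<phi> x = 0" if "x \<notin> {a..b}" for x
  proof -
    have x: "x \<notin> {a0..b0}" using that ab0 by (auto simp: a_def b_def)
    then show "\<phi> x = 0" by (rule out0)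
    have "(\<phi> has_field_derivative 0) (at x)"
      by (rule has_field_derivative_transform_within_open[OF DERIV_const, where S = "- {a0..b0}"])
         (use x out0 in \<open>auto simp: open_Compl\<close>)
    then show "deriv \<phi> x = 0" by (rule DERIV_imp_deriv)
  qed
  have c\<phi>: "continuous_on {a..b} \<phi>" "continuous_on {a..b} (deriv \<phi>)"
    by (rule smooth_continuous_on[OF sm], rule smooth_continuous_on[OF smooth_deriv[OF sm]])
  have p\<phi>: "L1_prim a b \<phi> (deriv \<phi>)"
    by (rule L1_prim_C1[OF has_field_derivative_at_within[OF smooth_DERIV[OF sm]] c\<phi>(2)])
  have ak: "k absolutely_integrable_on {a..b}" using prim[OF ab] unfolding L1_prim_def by blast
  have i1: "(\<lambda>x. h x * deriv \<phi> x) absolutely_integrable_on {a..b}"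
    by (intro absolutely_integrable_continuous_real continuous_on_mult ch' ab c\<phi>)
  have "(\<lambda>x. \<phi> x * k x) absolutely_integrable_on {a..b}"
    by (intro absolutely_integrable_continuous_mult c\<phi> ak)
  then have i2: "(\<lambda>x. k x * \<phi> x) absolutely_integrable_on {a..b}" by (simp only: mult.commute)
  have "integral {a..b} (\<lambda>x. h x * deriv \<phi> x + \<phi> x * k x) = h b * \<phi> b - h a * \<phi> a"
    using ab by (intro L1_prim_diff[OF L1_prim_mult[OF prim[OF ab] p\<phi>]]) auto
  also have "\<dots> = 0"
    using ab0 by (simp add: out0 a_def b_def)
  finally have "integral {a..b} (\<lambda>x. h x * deriv \<phi> x + k x * \<phi> x) = 0"
    by (simp only: mult.commute[of "\<phi> _"])
  then have "integral {a..b} (\<lambda>x. h x * deriv \<phi> x) + integral {a..b} (\<lambda>x. k x * \<phi> x) = 0"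
    by (subst (asm) Henstock_Kurzweil_Integration.integral_add)
       (use set_lebesgue_integral_eq_integral(1)[OF i1] set_lebesgue_integral_eq_integral(1)[OF i2] in auto)
  moreover have "(LINT r:{0<..}|lebesgue. h r * deriv \<phi> r) = integral {a..b} (\<lambda>x. h x * deriv \<phi> x)"
    by (rule set_integral_pos_eq_integral[OF ab(1) _ i1]) (simp add: out)
  moreover have "(LINT r:{0<..}|lebesgue. k r * \<phi> r) = integral {a..b} (\<lambda>x. k x * \<phi> x)"
    by (rule set_integral_pos_eq_integral[OF ab(1) _ i2]) (simp add: out)
  ultimately show "(LINT r:{0<..}|lebesgue. h r * deriv \<phi> r) = - (LINT r:{0<..}|lebesgue. k r * \<phi> r)"
    by linarith
qed

text \<open>The difference of the two densities has primitive 0 on each interval of a countable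
  exhaustion of the half-line.\<close>

lemma L1_prim_unique_AE:
  assumes "\<And>a b. 0 < a \<Longrightarrow> a < b \<Longrightarrow> L1_prim a b F g" "\<And>a b. 0 < a \<Longrightarrow> a < b \<Longrightarrow> L1_prim a b F k"
  shows "AE x in lebesgue. x > 0 \<longrightarrow> g x = k x"
proof -
  have "AE x in lebesgue. \<forall>n. 1 / real (n + 2) \<le> x \<and> x \<le> real (n + 2) \<longrightarrow> g x - k x = 0"
  proof (subst AE_all_countable, intro allI)
    fix n :: nat
    \<comment> \<open>The shift by 2 keeps the interval nondegenerate already for
      \<open>n = 0\<close>.\<close>
    let ?a = "1 / real (n + 2)" and ?b = "real (n + 2)"
    have "?a \<le> 1 / 2" by (intro divide_left_mono) auto
    moreover have "?b \<ge> 2" by simp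
    moreover have "0 < ?a" by simp
    ultimately have ab: "0 < ?a" "?a < ?b" by linarith+
    note p = assms(1)[OF ab] assms(2)[OF ab]
    have "L1_prim ?a ?b (\<lambda>x. 0) (\<lambda>x. g x - k x)"
    proof (rule L1_primI)
      show "(\<lambda>x. g x - k x) absolutely_integrable_on {?a..?b}"
        using p by (intro set_integral_diff) (auto simp: L1_prim_def)
      fix x assume x: "?a \<le> x" "x \<le> ?b"
      have "integral {?a..x} (\<lambda>x. g x - k x) = integral {?a..x} g - integral {?a..x} k"
        using x by (intro Henstock_Kurzweil_Integration.integral_diff L1_prim_integrable[OF p(1)] L1_prim_integrable[OF p(2)]) auto
      then show "integral {?a..x} (\<lambda>x. g x - k x) = 0 - 0"
        using L1_prim_diff[OF p(1), of ?a x] L1_prim_diff[OF p(2), of ?a x] x by simp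
    qed
    then show "AE x in lebesgue. ?a \<le> x \<and> x \<le> ?b \<longrightarrow> g x - k x = 0"
      by (rule L1_prim_0_AE)
  qed
  then show ?thesis
  proof eventually_elim
    case (elim x)
    show ?case
    proof
      assume x: "x > 0"
      obtain n1 where n1: "1 / real (Suc n1) < x" using x nat_approx_posE by metis
      obtain n2 where n2: "x < real n2" using reals_Archimedean2 by blast
      have "1 / real (max n1 n2 + 2) \<le> 1 / real (Suc n1)" by (intro divide_left_mono) auto
      then have "1 / real (max n1 n2 + 2) \<le> x \<and> x \<le> real (max n1 n2 + 2)"
        using n1 n2 by auto
      with elim show "g x = k x" by (metis eq_iff_diff_eq_0)
    qed
  qed
qed

section \<open>Convexity of the energy in the squared function\<close>

text \<open>Division by \<open>w powr s\<close> reduces this to Bernoulli's inequality for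
  \<open>t = u / w\<close>, which is convexity of \<open>exp\<close> between \<open>0\<close> and
  \<open>s * ln t\<close> with weights \<open>1 - 1/s\<close> and \<open>1/s\<close>. The logarithm
  is why \<open>u = 0\<close> is treated apart.\<close>

lemma powr_tangent_le:
  fixes s :: real
  assumes "s \<ge> 1" "u \<ge> 0" "w > 0"
  shows "w powr s + s * w powr (s - 1) * (u - w) \<le> u powr s"
proof (cases "u = 0")
  case True
  have "w powr s = w * w powr (s - 1)" using assms by (simp add: powr_diff)
  moreover have "w * w powr (s - 1) \<le> s * (w * w powr (s - 1))"
    using assms by (intro mult_right_mono[of 1 s, simplified]) auto
  ultimately show ?thesis using True by (simp add: algebra_simps)
next
  case False
  define t where "t = u / w"
  have t: "t > 0" using False assms by (simp add: t_def)
  have "exp ((1 - 1 / s) *\<^sub>R 0 + (1 / s) *\<^sub>R (s * ln t)) \<le> (1 - 1 / s) * exp 0 + (1 / s) * exp (s * ln t)"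
    using assms by (intro convex_onD[OF exp_convex]) auto
  then have "s * t \<le> s * ((1 - 1 / s) + (1 / s) * t powr s)"
    using assms t by (intro mult_left_mono) (auto simp: powr_def)
  also have "\<dots> = s - 1 + t powr s" using assms by (simp add: field_simps)
  finally have "1 + s * (t - 1) \<le> t powr s" by (simp add: algebra_simps)
  then have "w powr s * (1 + s * (t - 1)) \<le> w powr s * t powr s"
    by (intro mult_left_mono) auto
  also have "w powr s * t powr s = u powr s"
    using assms False t by (simp add: t_def powr_mult[symmetric])
  also have "w powr s * (1 + s * (t - 1)) = w powr s + s * w powr (s - 1) * (u - w)"
    using assms by (simp add: t_def powr_diff field_simps)
  finally show ?thesis .
qed

definition dens :: "real \<Rightarrow> real \<Rightarrow> real \<Rightarrow> real \<Rightarrow> real" where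
  "dens p r x y = ((y\<^sup>2 + x\<^sup>2 / r\<^sup>2) powr (p / 2) + 1 / 2 * (1 - x\<^sup>2)\<^sup>2) * r"

text \<open>This is \<open>w'^2 + w^2 / r^2\<close> for \<open>w' = z w\<close>. The logarithmic
  derivative \<open>z\<close> is used because it does not change when \<open>w\<close> is multiplied
  by a constant.\<close>

definition gradsq :: "real \<Rightarrow> real \<Rightarrow> real \<Rightarrow> real" where
  "gradsq r w z = w\<^sup>2 * (z\<^sup>2 + 1 / r\<^sup>2)"

text \<open>As a function of \<open>u = x\<^sup>2\<close> and \<open>u' = 2 x y\<close> the density is convex; this is its
  tangent inequality at \<open>w\<^sup>2\<close>, where \<open>z\<close> stands for \<open>w' / w\<close>.\<close>

lemma dens_tangent_le:
  fixes p r w z x y :: real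
  assumes "p > 2" "r > 0" "w > 0"
  defines "V \<equiv> p / 2 * gradsq r w z powr (p / 2 - 1)"
  shows "dens p r w (z * w) + V * r * z * (2 * x * y - 2 * w * (z * w))
      + (V * r * (1 / r\<^sup>2 - z\<^sup>2) - (1 - w\<^sup>2) * r) * (x\<^sup>2 - w\<^sup>2) + (x\<^sup>2 - w\<^sup>2)\<^sup>2 / 2 * r
    \<le> dens p r x y"
proof -
  define U where "U = y\<^sup>2 + x\<^sup>2 / r\<^sup>2"
  define W where "W = gradsq r w z"
  have W: "W = (z * w)\<^sup>2 + w\<^sup>2 / r\<^sup>2" by (simp add: W_def gradsq_def algebra_simps power_mult_distrib)
  have Wpos: "W > 0" unfolding W using assms by (intro add_nonneg_pos) auto
  have "V \<ge> 0" using assms by (simp add: V_def)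
  \<comment> \<open>Picone's identity: what is lost by linearising in \<open>(x^2, 2 x y)\<close> is
    a perfect square.\<close>
  have "U - W - (z * (2 * x * y - 2 * w * (z * w)) + (1 / r\<^sup>2 - z\<^sup>2) * (x\<^sup>2 - w\<^sup>2)) = (y - z * x)\<^sup>2"
    unfolding U_def W by (simp add: power2_eq_square algebra_simps)
  then have "z * (2 * x * y - 2 * w * (z * w)) + (1 / r\<^sup>2 - z\<^sup>2) * (x\<^sup>2 - w\<^sup>2) \<le> U - W"
    using zero_le_power2[of "y - z * x"] by linarith
  then have "V * (z * (2 * x * y - 2 * w * (z * w)) + (1 / r\<^sup>2 - z\<^sup>2) * (x\<^sup>2 - w\<^sup>2)) \<le> V * (U - W)"
    using \<open>V \<ge> 0\<close> by (rule mult_left_mono)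
  also have "W powr (p / 2) + V * (U - W) \<le> U powr (p / 2)"
    using powr_tangent_le[of "p / 2" U W] assms Wpos unfolding V_def W_def[symmetric] by (simp add: U_def)
  then have "V * (U - W) \<le> U powr (p / 2) - W powr (p / 2)" by simp
  finally have 1: "r * (V * (z * (2 * x * y - 2 * w * (z * w)) + (1 / r\<^sup>2 - z\<^sup>2) * (x\<^sup>2 - w\<^sup>2)))
     \<le> r * (U powr (p / 2) - W powr (p / 2))"
    using assms by (intro mult_left_mono) auto
  \<comment> \<open>The potential is quadratic in \<open>x^2\<close>, so its expansion is exact; the
    last term is the strict gain.\<close>
  have 2: "1 / 2 * (1 - x\<^sup>2)\<^sup>2 = 1 / 2 * (1 - w\<^sup>2)\<^sup>2 - (1 - w\<^sup>2) * (x\<^sup>2 - w\<^sup>2) + (x\<^sup>2 - w\<^sup>2)\<^sup>2 / 2"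
    by (simp add: power2_eq_square field_simps)
  have "dens p r x y - dens p r w (z * w) = r * (U powr (p / 2) - W powr (p / 2))
      + r * (1 / 2 * (1 - x\<^sup>2)\<^sup>2 - 1 / 2 * (1 - w\<^sup>2)\<^sup>2)"
    unfolding dens_def U_def[symmetric] W[symmetric] by (simp add: algebra_simps)
  also have "\<dots> \<ge> r * (V * (z * (2 * x * y - 2 * w * (z * w)) + (1 / r\<^sup>2 - z\<^sup>2) * (x\<^sup>2 - w\<^sup>2)))
      + r * (- (1 - w\<^sup>2) * (x\<^sup>2 - w\<^sup>2) + (x\<^sup>2 - w\<^sup>2)\<^sup>2 / 2)"
    using 1 unfolding 2 by (intro add_mono) (simp, simp add: algebra_simps)
  finally show ?thesis by (simp add: algebra_simps)
qed

text \<open>The sign of \<open>elop\<close> tells whether \<open>w\<close>, with \<open>w' = z w\<close> and \<open>z' = z1\<close>, is a super- or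
  a subsolution of the Euler-Lagrange equation (written for \<open>w\<^sup>2\<close>).\<close>

definition elop :: "real \<Rightarrow> real \<Rightarrow> real \<Rightarrow> real \<Rightarrow> real \<Rightarrow> real" where
  "elop p r w z z1 = p / 2 * (gradsq r w z powr (p / 2 - 1) * (1 / r - r * z\<^sup>2 - z - r * z1)
      - (p / 2 - 1) * gradsq r w z powr (p / 2 - 2)
        * (2 * w\<^sup>2 * (z ^ 3 + z / r\<^sup>2 + z * z1 - 1 / r ^ 3)) * (r * z)) - (1 - w\<^sup>2) * r"

lemma L1_prim_minus:
  assumes "L1_prim a b F f" "L1_prim a b G g"
  shows "L1_prim a b (\<lambda>x. F x - G x) (\<lambda>x. f x - g x)"
proof (rule L1_primI)
  show "(\<lambda>x. f x - g x) absolutely_integrable_on {a..b}"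
    using assms unfolding L1_prim_def by (intro set_integral_diff) auto
  fix x assume "a \<le> x" "x \<le> b"
  have "integral {a..x} (\<lambda>x. f x - g x) = integral {a..x} f - integral {a..x} g"
    using \<open>x \<le> b\<close>
    by (intro Henstock_Kurzweil_Integration.integral_diff L1_prim_integrable[OF assms(1)] L1_prim_integrable[OF assms(2)]) auto
  also have "\<dots> = (F x - F a) - (G x - G a)"
    using L1_prim_diff[OF assms(1), of a x] L1_prim_diff[OF assms(2), of a x] \<open>a \<le> x\<close> \<open>x \<le> b\<close> by simp
  finally show "integral {a..x} (\<lambda>x. f x - g x) = F x - G x - (F a - G a)" by simp
qed

text \<open>The integrated tangent inequality, with its derivative term integrated by parts. The
  boundary term at \<open>s\<close> vanishes and the one at \<open>d\<close> has a sign; what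
  remains of first order is \<open>elop\<close> times \<open>f^2 - w^2\<close>, nonnegative by
  \<open>N\<close>. The condition at \<open>d\<close> is an inequality so that \<open>d\<close> may
  lie inside an excursion.\<close>

lemma picone_lower_bound:
  assumes p: "p > 2" and ds: "0 < d" "d \<le> s" and f: "L1_prim d s f g"
    and w: "\<And>r. d \<le> r \<Longrightarrow> r \<le> s \<Longrightarrow> w r > 0"
    and dw: "\<And>r. d \<le> r \<Longrightarrow> r \<le> s \<Longrightarrow> (w has_real_derivative z r * w r) (at r)"
    and dz: "\<And>r. d \<le> r \<Longrightarrow> r \<le> s \<Longrightarrow> (z has_real_derivative z1 r) (at r)"
    and cz1: "continuous_on {d..s} z1"
    and E: "(\<lambda>r. dens p r (f r) (g r)) integrable_on {d..s}"
    and left: "0 \<le> z d * ((w d)\<^sup>2 - (f d)\<^sup>2)" and right: "f s = w s"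
    and N: "\<And>r. d \<le> r \<Longrightarrow> r \<le> s \<Longrightarrow> 0 \<le> elop p r (w r) (z r) (z1 r) * ((f r)\<^sup>2 - (w r)\<^sup>2)"
  shows "integral {d..s} (\<lambda>r. dens p r (w r) (z r * w r)) + integral {d..s} (\<lambda>r. ((f r)\<^sup>2 - (w r)\<^sup>2)\<^sup>2 / 2 * r)
    \<le> integral {d..s} (\<lambda>r. dens p r (f r) (g r))"
proof -
  define W where "W r = gradsq r (w r) (z r)" for r
  define W' where "W' r = 2 * (w r)\<^sup>2 * (z r ^ 3 + z r / r\<^sup>2 + z r * z1 r - 1 / r ^ 3)" for r
  \<comment> \<open>The flux: the coefficient of the derivative of \<open>f^2 - w^2\<close> in the
    tangent inequality. \<open>W'\<close> and \<open>A'\<close> are the derivatives of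
    \<open>W\<close> and \<open>A\<close> when \<open>w' = z w\<close> and
    \<open>z' = z1\<close>.\<close>
  define A where "A r = p / 2 * (W r powr (p / 2 - 1) * (r * z r))" for r
  define A' where "A' r = p / 2 * ((p / 2 - 1) * W r powr (p / 2 - 2) * W' r * (r * z r)
      + W r powr (p / 2 - 1) * (z r + r * z1 r))" for r
  have Wpos: "W r > 0" if "d \<le> r" "r \<le> s" for r
    unfolding W_def gradsq_def using w[OF that] ds that by (intro mult_pos_pos add_nonneg_pos) auto
  have dW: "(W has_real_derivative W' r) (at r)" if r: "d \<le> r" "r \<le> s" for r
  proof -
    have "(W has_real_derivative 2 * (w r * (z r * w r)) * ((z r)\<^sup>2 + 1 / r\<^sup>2) + (2 * (z r * z1 r) - 2 / r ^ 3) * (w r)\<^sup>2) (at r)"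
      unfolding W_def[abs_def] gradsq_def using r ds
      by (auto intro!: derivative_eq_intros dw dz simp: power2_eq_square power3_eq_cube field_simps)
    then show ?thesis
      by (rule DERIV_cong) (use r ds in \<open>simp add: W'_def power2_eq_square power3_eq_cube field_simps\<close>)
  qed
  have dA: "(A has_real_derivative A' r) (at r)" if r: "d \<le> r" "r \<le> s" for r
  proof -
    have "((\<lambda>r. W r powr (p / 2 - 1)) has_real_derivative (p / 2 - 1) * W r powr (p / 2 - 1 - 1) * W' r) (at r)"
      by (rule DERIV_chain2[OF has_real_derivative_powr[OF Wpos[OF r]] dW[OF r]])
    moreover have "((\<lambda>r. r * z r) has_real_derivative z r + r * z1 r) (at r)"
      using DERIV_mult[OF DERIV_ident dz[OF r]] by (simp add: algebra_simps)
    ultimately have "((\<lambda>r. p / 2 * (W r powr (p / 2 - 1) * (r * z r))) has_real_derivative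
      p / 2 * ((p / 2 - 1) * W r powr (p / 2 - 1 - 1) * W' r * (r * z r) + (z r + r * z1 r) * W r powr (p / 2 - 1))) (at r)"
      by (intro DERIV_cmult DERIV_mult)
    then show ?thesis
      unfolding A_def[abs_def]
      by (rule DERIV_cong) (simp add: A'_def mult.commute)
  qed
  have cw: "continuous_on {d..s} w" and cz: "continuous_on {d..s} z" and cW: "continuous_on {d..s} W"
    using DERIV_isCont dw dz dW by (meson atLeastAtMost_iff continuous_at_imp_continuous_on)+
  have cW': "continuous_on {d..s} W'"
    unfolding W'_def[abs_def] using ds by (auto intro!: continuous_intros cw cz cz1)
  have cWp: "continuous_on {d..s} (\<lambda>r. W r powr a)" for a
    by (rule continuous_on_powr'[OF cW continuous_on_const]) (use Wpos in force)
  have cA': "continuous_on {d..s} A'"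
    unfolding A'_def[abs_def] by (intro continuous_intros cWp cW' cz cz1)
  have pA: "L1_prim d s A A'"
    by (rule L1_prim_C1[OF has_field_derivative_at_within[OF dA] cA'])
  have pw: "L1_prim d s w (\<lambda>r. z r * w r)"
    by (rule L1_prim_C1[OF has_field_derivative_at_within[OF dw]]) (auto intro!: continuous_intros cw cz)
  define H where "H r = A r * ((f r * g r + f r * g r) - (w r * (z r * w r) + w r * (z r * w r))) + (f r * f r - w r * w r) * A' r" for r
  have pH: "L1_prim d s (\<lambda>r. A r * (f r * f r - w r * w r)) H"
    unfolding H_def[abs_def] by (intro L1_prim_mult[OF pA] L1_prim_minus L1_prim_mult f pw)
  have "integral {d..s} H = A s * (f s * f s - w s * w s) - A d * (f d * f d - w d * w d)"
    using ds by (intro L1_prim_diff[OF pH]) auto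
  also have "\<dots> = p / 2 * W d powr (p / 2 - 1) * d * (z d * ((w d)\<^sup>2 - (f d)\<^sup>2))"
    using right by (simp add: A_def power2_eq_square field_simps)
  also have "\<dots> \<ge> 0" using p ds by (intro mult_nonneg_nonneg[OF _ left]) auto
  finally have Hnn: "integral {d..s} H \<ge> 0" .
  have pt: "dens p r (w r) (z r * w r) + H r + ((f r)\<^sup>2 - (w r)\<^sup>2)\<^sup>2 / 2 * r \<le> dens p r (f r) (g r)"
    if r: "d \<le> r" "r \<le> s" for r
  proof -
    have r0: "r > 0" using r ds by simp
    define V where "V = p / 2 * W r powr (p / 2 - 1)"
    have Aeq: "A r = V * r * z r" by (simp add: A_def V_def)
    \<comment> \<open>This is the origin of \<open>elop\<close>: the zeroth-order coefficient of the
      tangent inequality minus the derivative of the flux.\<close>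
    have "elop p r (w r) (z r) (z1 r) = V * r * (1 / r\<^sup>2 - (z r)\<^sup>2) - (1 - (w r)\<^sup>2) * r - A' r"
      unfolding elop_def A'_def W'_def V_def W_def using r0
      by (simp add: power2_eq_square field_simps)
    then have *: "A' r * ((f r)\<^sup>2 - (w r)\<^sup>2) \<le> (V * r * (1 / r\<^sup>2 - (z r)\<^sup>2) - (1 - (w r)\<^sup>2) * r) * ((f r)\<^sup>2 - (w r)\<^sup>2)"
      using N[OF r] by (simp add: left_diff_distrib)
    have "H r = V * r * z r * (2 * f r * g r - 2 * w r * (z r * w r)) + A' r * ((f r)\<^sup>2 - (w r)\<^sup>2)"
      unfolding H_def Aeq by (simp add: power2_eq_square algebra_simps)
    with * dens_tangent_le[OF p r0 w[OF r], of "z r" "f r" "g r", folded W_def, folded V_def]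
    show ?thesis by linarith
  qed
  have cE: "continuous_on {d..s} (\<lambda>r. dens p r (w r) (z r * w r))"
    unfolding dens_def using ds p
    by (intro continuous_intros cw cz continuous_on_powr') (auto intro!: add_nonneg_nonneg)
  have cf: "continuous_on {d..s} f" using f by (rule L1_prim_continuous)
  have i1: "(\<lambda>r. dens p r (w r) (z r * w r)) integrable_on {d..s}"
    using cE by (rule integrable_continuous_real)
  have i2: "H integrable_on {d..s}" using pH by (rule L1_prim_integrable) auto
  have i3: "(\<lambda>r. ((f r)\<^sup>2 - (w r)\<^sup>2)\<^sup>2 / 2 * r) integrable_on {d..s}"
    by (intro integrable_continuous_real continuous_intros cf cw) auto
  have i12: "(\<lambda>r. dens p r (w r) (z r * w r) + H r) integrable_on {d..s}"
    by (rule Henstock_Kurzweil_Integration.integrable_add[OF i1 i2])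
  have "integral {d..s} (\<lambda>r. dens p r (w r) (z r * w r)) + integral {d..s} H + integral {d..s} (\<lambda>r. ((f r)\<^sup>2 - (w r)\<^sup>2)\<^sup>2 / 2 * r)
     = integral {d..s} (\<lambda>r. dens p r (w r) (z r * w r) + H r + ((f r)\<^sup>2 - (w r)\<^sup>2)\<^sup>2 / 2 * r)"
    by (simp only: Henstock_Kurzweil_Integration.integral_add[OF i1 i2] Henstock_Kurzweil_Integration.integral_add[OF i12 i3])
  also have "\<dots> \<le> integral {d..s} (\<lambda>r. dens p r (f r) (g r))"
    by (rule integral_le[OF Henstock_Kurzweil_Integration.integrable_add[OF i12 i3] E]) (use pt in auto)
  finally show ?thesis using Hnn by linarith
qed

section \<open>Affine functions as sub- and supersolutions\<close>

text \<open>The product of the two chord bounds is the chord of the product minus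
  \<open>t (1 - t) (f x - f y) (g x - g y)\<close>, and the subtracted term is nonnegative because
  both factors decrease.\<close>

lemma convex_on_mult_antimono:
  fixes f g :: "real \<Rightarrow> real"
  assumes f: "convex_on S f" "antimono_on S f" "\<And>x. x \<in> S \<Longrightarrow> f x \<ge> 0"
    and g: "convex_on S g" "antimono_on S g" "\<And>x. x \<in> S \<Longrightarrow> g x \<ge> 0"
  shows "convex_on S (\<lambda>x. f x * g x)"
proof (rule convex_on_linorderI)
  show S: "convex S" using f(1) by (rule convex_on_imp_convex)
  fix t x y :: real assume t: "0 < t" "t < 1" and xy: "x \<in> S" "y \<in> S" "x < y"
  let ?m = "(1 - t) *\<^sub>R x + t *\<^sub>R y"
  have m: "?m \<in> S" using S t xy by (intro convexD_alt) auto
  have "f ?m * g ?m \<le> ((1 - t) * f x + t * f y) * ((1 - t) * g x + t * g y)"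
    using f g t xy m convex_onD[OF f(1), of t x y] convex_onD[OF g(1), of t x y]
    by (intro mult_mono) auto
  also have "\<dots> = (1 - t) * (f x * g x) + t * (f y * g y) - t * (1 - t) * ((f x - f y) * (g x - g y))"
    by algebra
  also have "\<dots> \<le> (1 - t) * (f x * g x) + t * (f y * g y)"
  proof -
    have "f y \<le> f x" "g y \<le> g x" using f(2) g(2) xy by (auto simp: monotone_on_def)
    then have "0 \<le> t * (1 - t) * ((f x - f y) * (g x - g y))"
      using t by (intro mult_nonneg_nonneg) auto
    then show ?thesis by simp
  qed
  finally show "f ?m * g ?m \<le> (1 - t) * (f x * g x) + t * (f y * g y)" .
qed

lemma antimono_on_mult:
  fixes f g :: "real \<Rightarrow> real"
  assumes "antimono_on S f" "antimono_on S g" "\<And>x. x \<in> S \<Longrightarrow> f x \<ge> 0" "\<And>x. x \<in> S \<Longrightarrow> g x \<ge> 0"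
  shows "antimono_on S (\<lambda>x. f x * g x)"
  using assms unfolding monotone_on_def by (auto intro!: mult_mono)

lemma convex_on_eqI:
  assumes "convex_on S f" "\<And>x. x \<in> S \<Longrightarrow> g x = f x"
  shows "convex_on S g"
proof (rule convex_onI)
  show S: "convex S" using assms(1) by (rule convex_on_imp_convex)
  fix t :: real and x y :: 'a assume t: "0 < t" "t < 1" and xy: "x \<in> S" "y \<in> S"
  have "(1 - t) *\<^sub>R x + t *\<^sub>R y \<in> S" using S t xy by (intro convexD_alt) auto
  then show "g ((1 - t) *\<^sub>R x + t *\<^sub>R y) \<le> (1 - t) * g x + t * g y"
    using convex_onD[OF assms(1), of t x y] t xy assms(2) by simp
qed

lemma convex_on_exp_mult:
  fixes g :: "real \<Rightarrow> real"
  assumes g: "convex_on S g" and q: "q \<ge> 0"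
  shows "convex_on S (\<lambda>x. exp (q * g x))"
proof (rule convex_onI)
  show "convex S" using g by (rule convex_on_imp_convex)
  fix t x y :: real assume t: "0 < t" "t < 1" and xy: "x \<in> S" "y \<in> S"
  have "q * g ((1 - t) *\<^sub>R x + t *\<^sub>R y) \<le> q * ((1 - t) * g x + t * g y)"
    using convex_onD[OF g, of t x y] t xy q by (intro mult_left_mono) auto
  then have "exp (q * g ((1 - t) *\<^sub>R x + t *\<^sub>R y)) \<le> exp ((1 - t) *\<^sub>R (q * g x) + t *\<^sub>R (q * g y))"
    by (simp add: algebra_simps)
  also have "\<dots> \<le> (1 - t) * exp (q * g x) + t * exp (q * g y)"
    using t by (intro convex_onD[OF exp_convex]) auto
  finally show "exp (q * g ((1 - t) *\<^sub>R x + t *\<^sub>R y)) \<le> (1 - t) * exp (q * g x) + t * exp (q * g y)" .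
qed

section \<open>The Euler-Lagrange expression of a line\<close>

definition line_gradsq :: "real \<Rightarrow> real \<Rightarrow> real \<Rightarrow> real" where
  "line_gradsq a c r = a\<^sup>2 + (a * r + c)\<^sup>2 / r\<^sup>2"

text \<open>The gradient part of \<open>elop\<close> for the line, divided by the positive factor
  \<open>p r / 2\<close>. Both summands carry the factor \<open>c\<close>, so the sign of
  \<open>c\<close> decides their sign when \<open>a \<ge> 0\<close> and the line is
  positive.\<close>

definition line_K :: "real \<Rightarrow> real \<Rightarrow> real \<Rightarrow> real \<Rightarrow> real" where
  "line_K p a c r = c * line_gradsq a c r powr (p / 2 - 1) / (r\<^sup>2 * (a * r + c))
     + (p - 2) * a * c * line_gradsq a c r powr (p / 2 - 2) / r ^ 3"

definition line_elop :: "real \<Rightarrow> real \<Rightarrow> real \<Rightarrow> real \<Rightarrow> real" where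
  "line_elop p a c r = line_K p a c r - 2 / p * (1 - (a * r + c)\<^sup>2)"

text \<open>For a line, \<open>w'' = 0\<close> becomes \<open>z' = - z^2\<close>, which cancels the
  cubic term in the derivative of \<open>gradsq\<close>.\<close>

lemma elop_line:
  assumes "p > 2" "r > 0" "a * r + c > 0"
  shows "elop p r (a * r + c) (a / (a * r + c)) (- (a / (a * r + c))\<^sup>2) = p / 2 * r * line_elop p a c r"
proof -
  define l where "l = a * r + c"
  have l: "l > 0" using assms by (simp add: l_def)
  have c: "c = l - a * r" by (simp add: l_def)
  have G: "gradsq r l (a / l) = line_gradsq a c r"
  proof -
    have "line_gradsq a c r = a\<^sup>2 + l\<^sup>2 / r\<^sup>2" by (simp add: line_gradsq_def l_def)
    also have "\<dots> = gradsq r l (a / l)" using l assms by (simp add: gradsq_def field_simps)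
    finally show ?thesis ..
  qed
  have 1: "1 / r - r * (a / l)\<^sup>2 - a / l - r * (- (a / l)\<^sup>2) = c / (r * l)"
    using l assms by (simp add: c field_simps power2_eq_square)
  have 2: "2 * l\<^sup>2 * ((a / l) ^ 3 + a / l / r\<^sup>2 + a / l * (- (a / l)\<^sup>2) - 1 / r ^ 3) * (r * (a / l)) = - (2 * c * a / r\<^sup>2)"
    using l assms by (simp add: c field_simps power2_eq_square power3_eq_cube)
  have "elop p r l (a / l) (- (a / l)\<^sup>2) = p / 2 * (gradsq r l (a / l) powr (p / 2 - 1)
       * (1 / r - r * (a / l)\<^sup>2 - a / l - r * (- (a / l)\<^sup>2))
     - (p / 2 - 1) * gradsq r l (a / l) powr (p / 2 - 2)
       * (2 * l\<^sup>2 * ((a / l) ^ 3 + a / l / r\<^sup>2 + a / l * (- (a / l)\<^sup>2) - 1 / r ^ 3) * (r * (a / l)))) - (1 - l\<^sup>2) * r"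
    by (simp only: elop_def mult.assoc)
  also have "\<dots> = p / 2 * (line_gradsq a c r powr (p / 2 - 1) * (c / (r * l))
     + (p / 2 - 1) * line_gradsq a c r powr (p / 2 - 2) * (2 * c * a / r\<^sup>2)) - (1 - l\<^sup>2) * r"
    unfolding G 1 2 by simp
  also have "\<dots> = p / 2 * r * line_elop p a c r"
    unfolding line_elop_def line_K_def l_def[symmetric] using l assms
    by (simp add: field_simps power2_eq_square power3_eq_cube)
  finally show ?thesis by (simp add: l_def)
qed

context
  fixes a c :: real assumes ac: "a \<ge> 0" "c > 0"
begin

lemma line_pos: "r > 0 \<Longrightarrow> a * r + c > 0"
  using ac by (simp add: add_nonneg_pos)

lemma line_gradsq_pos: "r > 0 \<Longrightarrow> line_gradsq a c r > 0"
  using line_pos[of r] by (auto simp: line_gradsq_def intro!: add_nonneg_pos)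

lemma line_factors:
  "convex_on {0<..} (\<lambda>r. 1 / r)" "antimono_on {0<..} (\<lambda>r::real. 1 / r)"
  "convex_on {0<..} (\<lambda>r. 1 / (a * r + c))" "antimono_on {0<..} (\<lambda>r. 1 / (a * r + c))"
  "convex_on {0<..} (\<lambda>r. 1 / ((a * r)\<^sup>2 + (a * r + c)\<^sup>2))" "antimono_on {0<..} (\<lambda>r. 1 / ((a * r)\<^sup>2 + (a * r + c)\<^sup>2))"
proof -
  show "convex_on {0<..} (\<lambda>r::real. 1 / r)"
    by (rule f''_ge0_imp_convex[where f' = "\<lambda>r. - 1 / r\<^sup>2" and f'' = "\<lambda>r. 2 / r ^ 3"])
       (auto intro!: derivative_eq_intros simp: power2_eq_square power3_eq_cube divide_simps)
  show "convex_on {0<..} (\<lambda>r. 1 / (a * r + c))"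
  proof (rule f''_ge0_imp_convex[where f' = "\<lambda>r. - a / (a * r + c)\<^sup>2" and f'' = "\<lambda>r. 2 * a\<^sup>2 / (a * r + c) ^ 3"])
    fix r :: real assume "r \<in> {0<..}"
    then have l: "a * r + c > 0" by (simp add: line_pos)
    show "((\<lambda>r. 1 / (a * r + c)) has_real_derivative - a / (a * r + c)\<^sup>2) (at r)"
      using l by (auto intro!: derivative_eq_intros simp: power2_eq_square)
    show "((\<lambda>r. - a / (a * r + c)\<^sup>2) has_real_derivative 2 * a\<^sup>2 / (a * r + c) ^ 3) (at r)"
      using l by (auto intro!: derivative_eq_intros simp: power2_eq_square power3_eq_cube divide_simps)
    show "2 * a\<^sup>2 / (a * r + c) ^ 3 \<ge> 0" using l by simp
  qed simp
  show "convex_on {0<..} (\<lambda>r. 1 / ((a * r)\<^sup>2 + (a * r + c)\<^sup>2))"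
  proof -
    define Q where "Q r = (a * r)\<^sup>2 + (a * r + c)\<^sup>2" for r
    define Q' where "Q' r = 2 * a\<^sup>2 * r + 2 * a * (a * r + c)" for r
    have "convex_on {0<..} (\<lambda>r. 1 / Q r)"
    proof (rule f''_ge0_imp_convex[where f' = "\<lambda>r. - Q' r / (Q r)\<^sup>2" and f'' = "\<lambda>r. (2 * (Q' r)\<^sup>2 - 4 * a\<^sup>2 * Q r) / (Q r) ^ 3"])
      fix r :: real assume r: "r \<in> {0<..}"
      then have l: "a * r + c > 0" by (simp add: line_pos)
      then have Q: "Q r > 0" unfolding Q_def by (intro add_nonneg_pos) auto
      have dQ: "(Q has_real_derivative Q' r) (at r)"
        unfolding Q_def[abs_def] Q'_def by (auto intro!: derivative_eq_intros simp: power2_eq_square algebra_simps)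
      have dQ': "(Q' has_real_derivative 4 * a\<^sup>2) (at r)"
        unfolding Q'_def[abs_def] by (auto intro!: derivative_eq_intros simp: power2_eq_square algebra_simps)
      show "((\<lambda>r. 1 / Q r) has_real_derivative - Q' r / (Q r)\<^sup>2) (at r)"
        using Q by (auto intro!: derivative_eq_intros dQ simp: power2_eq_square)
      show "((\<lambda>r. - Q' r / (Q r)\<^sup>2) has_real_derivative (2 * (Q' r)\<^sup>2 - 4 * a\<^sup>2 * Q r) / (Q r) ^ 3) (at r)"
        using Q by (auto intro!: derivative_eq_intros dQ dQ' simp: power2_eq_square power3_eq_cube field_simps)
      \<comment> \<open>The numerator of the second derivative of \<open>1 / Q\<close> expands into
        terms that are nonnegative for \<open>a \<ge> 0\<close> and \<open>c, r > 0\<close>.\<close>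
      have "2 * (Q' r)\<^sup>2 - 4 * a\<^sup>2 * Q r = 24 * a ^ 4 * r\<^sup>2 + 24 * a ^ 3 * c * r + 4 * a\<^sup>2 * c\<^sup>2"
        unfolding Q_def Q'_def by algebra
      also have "\<dots> \<ge> 0" using ac r by simp
      finally show "(2 * (Q' r)\<^sup>2 - 4 * a\<^sup>2 * Q r) / (Q r) ^ 3 \<ge> 0" using Q by simp
    qed simp
    then show ?thesis by (simp add: Q_def)
  qed
  show "antimono_on {0<..} (\<lambda>r::real. 1 / r)"
    by (auto simp: monotone_on_def frac_le)
  show "antimono_on {0<..} (\<lambda>r. 1 / (a * r + c))"
    by (auto simp: monotone_on_def ac line_pos intro!: frac_le mult_left_mono)
  show "antimono_on {0<..} (\<lambda>r. 1 / ((a * r)\<^sup>2 + (a * r + c)\<^sup>2))"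
  proof (rule monotone_onI)
    fix r s :: real assume "r \<in> {0<..}" "s \<in> {0<..}" "r \<le> s"
    then have rs: "0 < r" "r \<le> s" by auto
    have "a * r \<le> a * s" "0 \<le> a * r" using rs ac by (auto intro: mult_left_mono)
    then have "(a * r)\<^sup>2 \<le> (a * s)\<^sup>2" "(a * r + c)\<^sup>2 \<le> (a * s + c)\<^sup>2"
      using ac by (auto intro!: power_mono)
    moreover have "0 < (a * r)\<^sup>2 + (a * r + c)\<^sup>2"
      using line_pos[OF rs(1)] by (intro add_nonneg_pos) auto
    ultimately show "1 / ((a * s)\<^sup>2 + (a * s + c)\<^sup>2) \<le> 1 / ((a * r)\<^sup>2 + (a * r + c)\<^sup>2)"
      by (intro frac_le) auto
  qed
qed

text \<open>Convexity alone would not pass to powers below 1, which occur as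
  \<open>p / 2 - 1\<close> when \<open>p < 4\<close>. Here the logarithm is convex, so every
  nonnegative power is convex.\<close>

lemma line_gradsq_powr:
  assumes "q \<ge> 0"
  shows "convex_on {0<..} (\<lambda>r. line_gradsq a c r powr q)" "antimono_on {0<..} (\<lambda>r. line_gradsq a c r powr q)"
proof -
  define W where "W r = 2 * a\<^sup>2 + 2 * a * c / r + c\<^sup>2 / r\<^sup>2" for r
  have W: "line_gradsq a c r = W r" if "r > 0" for r
    using that by (simp add: W_def line_gradsq_def power2_eq_square field_simps)
  define W1 where "W1 r = - 2 * a * c / r\<^sup>2 - 2 * c\<^sup>2 / r ^ 3" for r
  define W2 where "W2 r = 4 * a * c / r ^ 3 + 6 * c\<^sup>2 / r ^ 4" for r
  have "convex_on {0<..} (\<lambda>r. ln (W r))"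
  proof (rule f''_ge0_imp_convex[where f' = "\<lambda>r. W1 r / W r" and f'' = "\<lambda>r. (W2 r * W r - (W1 r)\<^sup>2) / (W r)\<^sup>2"])
    fix r :: real assume "r \<in> {0<..}"
    then have r: "r > 0" by simp
    have Wr: "W r > 0" using line_gradsq_pos[OF r] W[OF r] by simp
    have dW: "(W has_real_derivative W1 r) (at r)"
      unfolding W_def[abs_def] W1_def using r
      by (auto intro!: derivative_eq_intros simp: power2_eq_square power3_eq_cube field_simps)
    have dW1: "(W1 has_real_derivative W2 r) (at r)"
      unfolding W1_def[abs_def] W2_def using r
      by (auto intro!: derivative_eq_intros simp: power2_eq_square power3_eq_cube power4_eq_xxxx field_simps)
    show "((\<lambda>r. ln (W r)) has_real_derivative W1 r / W r) (at r)"
      using Wr by (auto intro!: derivative_eq_intros dW)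
    show "((\<lambda>r. W1 r / W r) has_real_derivative (W2 r * W r - (W1 r)\<^sup>2) / (W r)\<^sup>2) (at r)"
      using Wr by (auto intro!: derivative_eq_intros dW dW1 simp: power2_eq_square)
    \<comment> \<open>In \<open>t = 1 / r\<close> the numerator of the second derivative of the
      logarithm is a polynomial with nonnegative coefficients.\<close>
    define t where "t = 1 / r"
    have t: "t > 0" using r by (simp add: t_def)
    have "W r = 2 * a\<^sup>2 + 2 * a * c * t + c\<^sup>2 * t\<^sup>2" "W1 r = - 2 * a * c * t\<^sup>2 - 2 * c\<^sup>2 * t ^ 3"
      "W2 r = 4 * a * c * t ^ 3 + 6 * c\<^sup>2 * t ^ 4"
      by (simp_all add: W_def W1_def W2_def t_def power_divide)
    then have "W2 r * W r - (W1 r)\<^sup>2 = 8 * a ^ 3 * c * t ^ 3 + 16 * a\<^sup>2 * c\<^sup>2 * t ^ 4 + 8 * a * c ^ 3 * t ^ 5 + 2 * c ^ 4 * t ^ 6"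
      by algebra
    also have "\<dots> \<ge> 0" using ac t by simp
    finally show "(W2 r * W r - (W1 r)\<^sup>2) / (W r)\<^sup>2 \<ge> 0" by simp
  qed simp
  then have "convex_on {0<..} (\<lambda>r. exp (q * ln (W r)))" using assms by (rule convex_on_exp_mult)
  moreover have "line_gradsq a c r powr q = exp (q * ln (W r))" if "r > 0" for r
    using line_gradsq_pos[OF that] W[OF that] by (simp add: powr_def)
  ultimately show "convex_on {0<..} (\<lambda>r. line_gradsq a c r powr q)"
    by (auto intro: convex_on_eqI)
  show "antimono_on {0<..} (\<lambda>r. line_gradsq a c r powr q)"
  proof (rule monotone_onI)
    fix r s :: real assume "r \<in> {0<..}" "s \<in> {0<..}" "r \<le> s"
    then have rs: "0 < r" "r \<le> s" by auto
    have "W s \<le> W r" unfolding W_def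
      using rs ac by (intro add_mono divide_left_mono power_mono mult_pos_pos) auto
    then have "line_gradsq a c s \<le> line_gradsq a c r" using rs W by simp
    then show "line_gradsq a c s powr q \<le> line_gradsq a c r powr q"
      using line_gradsq_pos[of s] rs assms by (intro powr_mono2) auto
  qed
qed

text \<open>The exponent \<open>p / 2 - 2\<close> may be negative. Writing that power as
  \<open>V / line_gradsq\<close> and absorbing powers of \<open>r\<close> turns both summands into
  products of nonnegative, decreasing, convex factors.\<close>

lemma line_K_convex_antimono:
  assumes "p > 2"
  shows "convex_on {0<..} (line_K p a c)" "antimono_on {0<..} (line_K p a c)"
proof -
  define V where "V r = line_gradsq a c r powr (p / 2 - 1)" for r
  let ?i = "\<lambda>r::real. 1 / r" and ?l = "\<lambda>r. 1 / (a * r + c)" and ?Q = "\<lambda>r. 1 / ((a * r)\<^sup>2 + (a * r + c)\<^sup>2)"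
  define F where "F r = c * (V r * (?i r * (?i r * ?l r))) + (p - 2) * a * c * (V r * (?i r * ?Q r))" for r
  have eq: "line_K p a c r = F r" if r: "r > 0" for r
  proof -
    note W = line_gradsq_pos[OF r]
    have 1: "line_gradsq a c r powr (p / 2 - 2) = V r / line_gradsq a c r"
      using W powr_diff[of "line_gradsq a c r" "p / 2 - 1" 1] by (simp add: V_def)
    have 2: "line_gradsq a c r = ((a * r)\<^sup>2 + (a * r + c)\<^sup>2) / r\<^sup>2"
      using r by (simp add: line_gradsq_def field_simps)
    have "V r / line_gradsq a c r / r ^ 3 = V r * (?i r * ?Q r)"
      unfolding 2 using r by (simp add: power2_eq_square power3_eq_cube)
    then have "line_gradsq a c r powr (p / 2 - 2) / r ^ 3 = V r * (?i r * ?Q r)"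
      by (simp only: 1)
    moreover have "line_gradsq a c r powr (p / 2 - 1) / (r\<^sup>2 * (a * r + c)) = V r * (?i r * (?i r * ?l r))"
      by (simp add: V_def power2_eq_square)
    ultimately show ?thesis unfolding line_K_def F_def times_divide_eq_right[symmetric] by simp
  qed
  have V: "convex_on {0<..} V" "antimono_on {0<..} V"
    using line_gradsq_powr[of "p / 2 - 1"] assms by (simp_all add: V_def[abs_def])
  have V0: "V r \<ge> 0" for r by (simp add: V_def)
  have l0: "r > 0 \<Longrightarrow> ?l r \<ge> 0" for r using line_pos[of r] by simp
  have F1: "convex_on {0<..} (\<lambda>r. V r * (?i r * (?i r * ?l r)))" "antimono_on {0<..} (\<lambda>r. V r * (?i r * (?i r * ?l r)))"
    by (intro convex_on_mult_antimono antimono_on_mult V line_factors; auto simp: V0 l0 line_pos less_imp_le)+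
  have F2: "convex_on {0<..} (\<lambda>r. V r * (?i r * ?Q r))" "antimono_on {0<..} (\<lambda>r. V r * (?i r * ?Q r))"
    by (intro convex_on_mult_antimono antimono_on_mult V line_factors; auto simp: V0)+
  have "convex_on {0<..} F"
    unfolding F_def[abs_def] using ac assms by (intro convex_on_add convex_on_cmul F1 F2) auto
  then show "convex_on {0<..} (line_K p a c)"
    by (rule convex_on_eqI) (simp add: eq)
  have "F s \<le> F r" if "0 < r" "r \<le> s" for r s
    unfolding F_def using that ac assms F1(2) F2(2)
    by (intro add_mono mult_left_mono) (auto simp: monotone_on_def simp del: times_divide_eq_right)
  then show "antimono_on {0<..} (line_K p a c)"
    using eq by (auto simp: monotone_on_def)
qed

lemma line_elop_convex:
  assumes "p > 2"
  shows "convex_on {0<..} (line_elop p a c)"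
proof -
  have "convex_on {0<..} (\<lambda>r. (a * r + c)\<^sup>2 - 1)"
    by (rule f''_ge0_imp_convex[where f' = "\<lambda>r. 2 * a * (a * r + c)" and f'' = "\<lambda>r. 2 * a * a"])
       (use ac in \<open>auto intro!: derivative_eq_intros simp: algebra_simps\<close>)
  then have "convex_on {0<..} (\<lambda>r. 2 / p * ((a * r + c)\<^sup>2 - 1))"
    using assms by (intro convex_on_cmul) auto
  from convex_on_add[OF line_K_convex_antimono(1)[OF assms] this]
  show ?thesis by (simp add: line_elop_def[abs_def] algebra_simps)
qed

text \<open>Convexity makes the sublevel set of \<open>line_elop\<close> an interval.\<close>

lemma line_elop_pos_half:
  assumes "p > 2" "x > 0" "line_elop p a c x > 0"
  shows "(\<forall>r. 0 < r \<and> r \<le> x \<longrightarrow> line_elop p a c r > 0) \<or> (a > 0 \<and> (\<forall>r\<ge>x. line_elop p a c r > 0))"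
proof (cases "a = 0")
  \<comment> \<open>The right alternative requires a positive slope, because there the line must
    later reach height 1. A constant therefore has to fall into the left one, which works because
    \<open>line_K\<close> decreases.\<close>
  case True
  have "line_elop p a c r > 0" if "0 < r" "r \<le> x" for r
  proof -
    have "line_K p a c x \<le> line_K p a c r"
      using line_K_convex_antimono(2)[OF assms(1)] that by (auto simp: monotone_on_def)
    then show ?thesis using assms(3) True by (simp add: line_elop_def)
  qed
  then show ?thesis by blast
next
  case False
  show ?thesis
  proof (rule ccontr)
    assume "\<not> ?thesis"
    then obtain r s where rs: "0 < r" "r \<le> x" "line_elop p a c r \<le> 0" "x \<le> s" "line_elop p a c s \<le> 0"
      using False ac by (force simp: not_less)
    have "line_elop p a c x \<le> max (line_elop p a c r) (line_elop p a c s)"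
      by (rule convex_on_le_max[OF convex_on_subset[OF line_elop_convex[OF assms(1)]]])
         (use rs in auto)
    with rs assms show False by simp
  qed
qed

end

text \<open>Both terms of \<open>line_K\<close> carry the factor \<open>c \<le> 0\<close>, and a
  line below height 1 makes the potential term favourable.\<close>

lemma line_elop_nonpos:
  assumes "p > 2" "r > 0" "a \<ge> 0" "c \<le> 0" "0 < a * r + c" "a * r + c \<le> 1"
  shows "line_elop p a c r \<le> 0"
proof -
  have "c * line_gradsq a c r powr (p / 2 - 1) / (r\<^sup>2 * (a * r + c)) \<le> 0"
    using assms by (intro divide_nonpos_pos mult_nonpos_nonneg mult_pos_pos) auto
  moreover have "(p - 2) * a * c * line_gradsq a c r powr (p / 2 - 2) / r ^ 3 \<le> 0"
    using assms by (intro divide_nonpos_pos mult_nonpos_nonneg mult_nonneg_nonpos) auto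
  moreover have "2 / p * (1 - (a * r + c)\<^sup>2) \<ge> 0"
    using assms by (intro mult_nonneg_nonneg) (auto simp: power_le_one)
  ultimately show ?thesis unfolding line_elop_def line_K_def by linarith
qed

section \<open>Finite energy\<close>

abbreviation half_line :: "real measure" where
  "half_line \<equiv> lebesgue_on {0<..}"

lemma I_functional_eq:
  "I_functional p h = (\<integral>\<^sup>+r. ennreal (dens p r (h r) (weak_deriv h r)) \<partial>half_line)"
  unfolding I_functional_def dens_def by (subst nn_integral_restrict_space) auto

lemma dens_nonneg: "r > 0 \<Longrightarrow> 0 \<le> dens p r x y"
  unfolding dens_def by (intro mult_nonneg_nonneg add_nonneg_nonneg) auto

lemma continuous_half_line_measurable:
  "continuous_on {0<..} h \<Longrightarrow> h \<in> borel_measurable half_line"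
  by (rule continuous_imp_measurable_on_sets_lebesgue) auto

lemma dens_measurable:
  assumes [measurable]: "h \<in> borel_measurable half_line" "k \<in> borel_measurable half_line"
  shows "(\<lambda>r. dens p r (h r) (k r)) \<in> borel_measurable half_line"
proof -
  have [measurable]: "(\<lambda>r. r) \<in> borel_measurable half_line"
    by (intro continuous_half_line_measurable continuous_on_id)
  show ?thesis unfolding dens_def by measurable
qed

lemma continuous_on_pos_prim:
  assumes "\<And>a b. 0 < a \<Longrightarrow> a < b \<Longrightarrow> L1_prim a b h k"
  shows "continuous_on {0<..} h"
proof (rule continuous_at_imp_continuous_on, intro ballI)
  fix x :: real assume "x \<in> {0<..}"
  then have "continuous_on {x / 2..x + 1} h" "x \<in> interior {x / 2..x + 1}"
    using assms[of "x / 2" "x + 1"] by (auto intro: L1_prim_continuous simp: interior_atLeastAtMost_real)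
  then show "isCont h x" by (rule continuous_on_interior)
qed

lemma has_weak_deriv_weak_deriv:
  assumes "has_weak_deriv h k" shows "has_weak_deriv h (weak_deriv h)"
  using someI[of "has_weak_deriv h" k] assms by (simp add: weak_deriv_def)

text \<open>Removes the arbitrary choice in \<open>weak_deriv\<close>: energies can be computed with
  any explicit density.\<close>

lemma weak_deriv_AE:
  assumes prim: "\<And>a b. 0 < a \<Longrightarrow> a < b \<Longrightarrow> L1_prim a b h k" and mk: "k \<in> borel_measurable half_line"
  shows "AE r in half_line. weak_deriv h r = k r"
proof -
  have ch: "continuous_on {0<..} h" using prim by (rule continuous_on_pos_prim)
  have "has_weak_deriv h k" using ch mk prim by (rule L1_prim_imp_has_weak_deriv)
  then have w: "has_weak_deriv h (weak_deriv h)" by (rule has_weak_deriv_weak_deriv)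
  have "AE r in lebesgue. r > 0 \<longrightarrow> weak_deriv h r = k r"
    using has_weak_deriv_imp_L1_prim[OF w ch] prim by (rule L1_prim_unique_AE)
  then show ?thesis by (simp add: AE_restrict_space_iff)
qed

lemma nn_integral_half_line_eq_integral:
  assumes "0 < a" "\<And>r. a \<le> r \<Longrightarrow> r \<le> b \<Longrightarrow> D r \<ge> 0" "D integrable_on {a..b}"
  shows "(\<integral>\<^sup>+r. ennreal (D r) * indicator {a..b} r \<partial>half_line) = ennreal (integral {a..b} D)"
proof -
  have "(\<integral>\<^sup>+r. ennreal (D r) * indicator {a..b} r \<partial>half_line)
      = (\<integral>\<^sup>+r. ennreal (D r) * indicator {a..b} r * indicator {0<..} r \<partial>lebesgue)"
    by (rule nn_integral_restrict_space) auto
  also have "\<dots> = (\<integral>\<^sup>+r. ennreal (D r) * indicator {a..b} r \<partial>lebesgue)"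
    by (intro nn_integral_cong) (use assms(1) in \<open>auto simp: indicator_def\<close>)
  also have "\<dots> = (\<integral>\<^sup>+r. ennreal (D r) * indicator {a..b} r \<partial>lborel)"
    by (rule nn_integral_completion)
  also have "\<dots> = ennreal (integral {a..b} D)"
    by (rule nn_integral_has_integral_lebesgue') (use assms integrable_integral in auto)
  finally show ?thesis .
qed

text \<open>The admissibility test for competitors: a measurable density on all compact intervals
  and finite energy suffice, because the energy controls the local \<open>p\<close>-norm of the
  derivative.\<close>

lemma X_spaceI:
  assumes p: "p > 2" and prim: "\<And>a b. 0 < a \<Longrightarrow> a < b \<Longrightarrow> L1_prim a b h k"
    and mk: "k \<in> borel_measurable half_line"
    and fin: "(\<integral>\<^sup>+r. ennreal (dens p r (h r) (k r)) \<partial>half_line) < \<infinity>"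
  shows "h \<in> X_space p" "I_functional p h = (\<integral>\<^sup>+r. ennreal (dens p r (h r) (k r)) \<partial>half_line)"
proof -
  have ch: "continuous_on {0<..} h" using prim by (rule continuous_on_pos_prim)
  have w: "has_weak_deriv h k" using ch mk prim by (rule L1_prim_imp_has_weak_deriv)
  have AE: "AE r in half_line. weak_deriv h r = k r" using prim mk by (rule weak_deriv_AE)
  show I: "I_functional p h = (\<integral>\<^sup>+r. ennreal (dens p r (h r) (k r)) \<partial>half_line)"
    unfolding I_functional_eq using AE by (intro nn_integral_cong_AE) auto
  have Lh: "Lp_loc p h"
  proof (rule Lp_locI[OF continuous_half_line_measurable[OF ch]])
    fix a b :: real assume "0 < a" "a < b"
    then have "continuous_on {a..b} h" by (intro continuous_on_subset[OF ch]) auto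
    then show "(\<lambda>r. \<bar>h r\<bar> powr p) absolutely_integrable_on {a..b}"
      using p by (intro absolutely_integrable_continuous_real continuous_on_powr' continuous_intros) auto
  qed
  have Lk: "Lp_loc p k"
  proof (rule Lp_locI[OF mk])
    fix a b :: real assume ab: "0 < a" "a < b"
    have sub: "{a..b} \<subseteq> {0<..}" using ab by auto
    have mk': "k \<in> borel_measurable (lebesgue_on {a..b})" using mk sub by (rule measurable_lebesgue_on_subset)
    then have m: "(\<lambda>r. \<bar>k r\<bar> powr p) \<in> borel_measurable (lebesgue_on {a..b})" by measurable
    have "(\<integral>\<^sup>+r. ennreal (\<bar>k r\<bar> powr p) \<partial>lebesgue_on {a..b}) = (\<integral>\<^sup>+r. ennreal (\<bar>k r\<bar> powr p) * indicator {a..b} r \<partial>half_line)"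
      by (subst (1 2) nn_integral_restrict_space)
         (use sub in \<open>auto intro!: nn_integral_cong simp: indicator_def\<close>)
    \<comment> \<open>The weight \<open>r\<close> is at least \<open>a\<close> on
      \<open>[a, b]\<close>, which costs the factor \<open>1 / a\<close>.\<close>
    also have "\<dots> \<le> (\<integral>\<^sup>+r. ennreal (1 / a) * ennreal (dens p r (h r) (k r)) \<partial>half_line)"
    proof (rule nn_integral_mono)
      fix r assume "r \<in> space half_line"
      then have r: "r > 0" by simp
      show "ennreal (\<bar>k r\<bar> powr p) * indicator {a..b} r \<le> ennreal (1 / a) * ennreal (dens p r (h r) (k r))"
      proof (cases "r \<in> {a..b}")
        case True
        have "\<bar>k r\<bar> powr p = ((k r)\<^sup>2) powr (p / 2)"
        proof -
          have "(k r)\<^sup>2 = \<bar>k r\<bar> powr 2" by (cases "k r = 0") auto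
          then show ?thesis by (simp only: powr_powr) simp
        qed
        also have "\<dots> \<le> ((k r)\<^sup>2 + (h r)\<^sup>2 / r\<^sup>2) powr (p / 2)"
          using p by (intro powr_mono2) auto
        also have "\<dots> \<le> ((k r)\<^sup>2 + (h r)\<^sup>2 / r\<^sup>2) powr (p / 2) + 1 / 2 * (1 - (h r)\<^sup>2)\<^sup>2" by simp
        finally have "\<bar>k r\<bar> powr p * a \<le> dens p r (h r) (k r)"
          unfolding dens_def using True ab by (intro mult_mono add_nonneg_nonneg) auto
        then have "\<bar>k r\<bar> powr p \<le> 1 / a * dens p r (h r) (k r)" using ab by (simp add: field_simps)
        then show ?thesis using True ab by (simp add: ennreal_mult'[symmetric] dens_nonneg r ennreal_leI)
      qed simp
    qed
    also have "\<dots> = ennreal (1 / a) * (\<integral>\<^sup>+r. ennreal (dens p r (h r) (k r)) \<partial>half_line)"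
      using dens_measurable[OF continuous_half_line_measurable[OF ch] mk, of p] by (intro nn_integral_cmult) measurable
    also have "\<dots> < \<infinity>" using fin by (simp add: ennreal_mult_less_top)
    finally have "integrable (lebesgue_on {a..b}) (\<lambda>r. \<bar>k r\<bar> powr p)"
      using m by (intro integrableI_bounded) auto
    then show "(\<lambda>r. \<bar>k r\<bar> powr p) absolutely_integrable_on {a..b}"
      using m by (subst absolutely_integrable_measurable_real) auto
  qed
  have "(\<integral>\<^sup>+r\<in>{0<..}. ennreal ((\<bar>weak_deriv h r\<bar>\<^sup>2 + (h r)\<^sup>2 / r\<^sup>2) powr (p / 2) * r) \<partial>lebesgue)
     = (\<integral>\<^sup>+r. ennreal ((\<bar>weak_deriv h r\<bar>\<^sup>2 + (h r)\<^sup>2 / r\<^sup>2) powr (p / 2) * r) \<partial>half_line)"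
    by (rule nn_integral_restrict_space[symmetric]) auto
  also have "\<dots> \<le> (\<integral>\<^sup>+r. ennreal (dens p r (h r) (weak_deriv h r)) \<partial>half_line)"
    by (intro nn_integral_mono ennreal_leI) (auto simp: dens_def intro!: mult_right_mono)
  also have "\<dots> < \<infinity>" using fin I by (simp add: I_functional_eq)
  finally show "h \<in> X_space p"
    unfolding X_space_def W1p_loc_def using Lh Lk w by blast
qed

text \<open>Membership in \<open>X_space\<close> does not bound the potential, so finiteness of the
  minimum needs a witness. For \<open>min r 1\<close> the potential vanishes beyond 1, and the
  remaining density \<open>r powr (1 - p)\<close> is integrable at infinity since
  \<open>p > 2\<close>.\<close>

lemma exists_finite_energy:
  assumes p: "p > 2"
  obtains h where "h \<in> X_space p" "I_functional p h < \<infinity>"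
proof -
  define h where "h r = min r 1" for r :: real
  define k where "k r = (if r < 1 then 1 else 0 :: real)" for r :: real
  have prim: "L1_prim a b h k" if "0 < a" "a < b" for a b
  proof -
    define A where "A = min a (1 / 2)"
    define B where "B = max b 2"
    have 1: "L1_prim A 1 (\<lambda>r. r) (\<lambda>r. 1)" by (rule L1_prim_C1) auto
    have 2: "L1_prim 1 B (\<lambda>r. 1) (\<lambda>r. 0)" by (rule L1_prim_C1) auto
    have "L1_prim A 1 h k" by (rule L1_prim_cong[OF 1]) (auto simp: h_def k_def)
    moreover have "L1_prim 1 B h k" by (rule L1_prim_cong[OF 2]) (auto simp: h_def k_def)
    ultimately have "L1_prim A B h k" by (rule L1_prim_join) (auto simp: A_def B_def)
    then show ?thesis by (rule L1_prim_subinterval) (auto simp: A_def B_def)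
  qed
  have mk: "k \<in> borel_measurable half_line"
  proof -
    have "k \<in> borel_measurable borel" unfolding k_def[abs_def] by measurable
    then have "k \<in> borel_measurable lebesgue" by (intro measurable_completion) simp
    then show ?thesis by (rule measurable_restrict_space1)
  qed
  \<comment> \<open>On \<open>(0, 1)\<close> the witness has \<open>h'^2 + h^2 / r^2 = 2\<close>,
    the potential is at most \<open>1/2\<close>, and the weight is at most 1.\<close>
  define C where "C = 2 powr (p / 2) + 1 / 2"
  have "(\<integral>\<^sup>+r. ennreal (dens p r (h r) (k r)) \<partial>half_line) \<le>
     (\<integral>\<^sup>+r. ennreal C * indicator {0..1} r + ennreal (r powr (1 - p)) * indicator {1..} r \<partial>half_line)"
  proof (rule nn_integral_mono)
    fix r assume "r \<in> space half_line"
    then have r: "r > 0" by simp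
    show "ennreal (dens p r (h r) (k r)) \<le> ennreal C * indicator {0..1} r + ennreal (r powr (1 - p)) * indicator {1..} r"
    proof (cases "r < 1")
      case True
      have "(1 - r\<^sup>2)\<^sup>2 \<le> 1" using r True by (intro power_le_one) (auto simp: power_le_one)
      then have "dens p r (h r) (k r) \<le> C * 1"
        unfolding dens_def C_def using r True by (intro mult_mono add_mono) (auto simp: h_def k_def)
      then show ?thesis using True r by (simp add: ennreal_leI)
    next
      case False
      have "dens p r (h r) (k r) = (1 / r\<^sup>2) powr (p / 2) * r"
        using False by (simp add: dens_def h_def k_def)
      also have "(1 / r\<^sup>2) powr (p / 2) = (r powr - 2) powr (p / 2)"
        using r by (simp add: powr_minus_divide flip: powr_numeral)
      also have "\<dots> * r = r powr (1 - p)"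
        using r powr_add[of r "-p" 1] by (simp add: powr_powr)
      finally show ?thesis using False r
        by (auto simp: indicator_def intro!: order_trans[OF _ add_increasing[of _ "ennreal (r powr (1-p))"]])
    qed
  qed
  also have "\<dots> \<le> (\<integral>\<^sup>+r. ennreal C * indicator {0..1} r + ennreal (r powr (1 - p)) * indicator {1..} r \<partial>lebesgue)"
    by (subst nn_integral_restrict_space) (auto intro!: nn_integral_mono simp: indicator_def)
  also have "\<dots> = (\<integral>\<^sup>+r. ennreal C * indicator {0..1} r + ennreal (r powr (1 - p)) * indicator {1..} r \<partial>lborel)"
    by (rule nn_integral_completion)
  also have "\<dots> = (\<integral>\<^sup>+(r::real). ennreal C * indicator {0..1} r \<partial>lborel) + (\<integral>\<^sup>+r. ennreal (r powr (1 - p)) * indicator {1..} r \<partial>lborel)"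
    by (subst nn_integral_add) auto
  also have "(\<integral>\<^sup>+r. ennreal (r powr (1 - p)) * indicator {1..} r \<partial>lborel) = ennreal (- (1 powr (1 - p + 1)) / (1 - p + 1))"
    using p by (intro nn_integral_has_integral_lebesgue' has_integral_powr_to_inf) auto
  also have "(\<integral>\<^sup>+(r::real). ennreal C * indicator {0..1} r \<partial>lborel) = ennreal C"
    by (subst nn_integral_cmult_indicator) auto
  also have "ennreal C + ennreal (- (1 powr (1 - p + 1)) / (1 - p + 1)) < \<infinity>" by simp
  finally have "(\<integral>\<^sup>+r. ennreal (dens p r (h r) (k r)) \<partial>half_line) < \<infinity>" .
  from X_spaceI[OF p prim mk this] this that show ?thesis by simp
qed

section \<open>Comparison with competitors\<close>

text \<open>Isolates the excursion around \<open>x\<close> on which a competitor will replace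
  \<open>f\<close>.\<close>

lemma positive_component:
  fixes h :: "real \<Rightarrow> real"
  assumes c: "continuous_on {a..b} h" and x: "a \<le> x" "x \<le> b" and h: "h a \<le> 0" "h b \<le> 0" "h x > 0"
  obtains \<rho> \<sigma> where "a \<le> \<rho>" "\<rho> < x" "x < \<sigma>" "\<sigma> \<le> b" "h \<rho> = 0" "h \<sigma> = 0"
    "\<And>r. \<rho> < r \<Longrightarrow> r < \<sigma> \<Longrightarrow> h r > 0"
proof -
  have cmp: "compact {r \<in> {u..v}. h r \<le> 0}" if "a \<le> u" "v \<le> b" for u v
  proof -
    have cu: "continuous_on {u..v} h" by (rule continuous_on_subset[OF c]) (use that in auto)
    have "closed {r \<in> {u..v}. h r \<le> 0}"
      by (intro continuous_on_closed_Collect_le cu continuous_on_const) simp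
    moreover have "bounded {r \<in> {u..v}. h r \<le> 0}"
      by (rule bounded_subset[OF bounded_closed_interval[of u v]]) auto
    ultimately show ?thesis by (simp add: compact_eq_bounded_closed)
  qed
  define L where "L = {r \<in> {a..x}. h r \<le> 0}"
  define R where "R = {r \<in> {x..b}. h r \<le> 0}"
  have "compact L" "compact R" using cmp[of a x] cmp[of x b] x by (auto simp: L_def R_def)
  moreover have "L \<noteq> {}" "R \<noteq> {}" using h x by (auto simp: L_def R_def)
  ultimately obtain \<rho> \<sigma> where \<rho>: "\<rho> \<in> L" "\<And>r. r \<in> L \<Longrightarrow> r \<le> \<rho>" and \<sigma>: "\<sigma> \<in> R" "\<And>r. r \<in> R \<Longrightarrow> \<sigma> \<le> r"
    using compact_attains_sup[of L] compact_attains_inf[of R] by metis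
  have 1: "a \<le> \<rho>" "\<rho> \<le> x" "h \<rho> \<le> 0" "x \<le> \<sigma>" "\<sigma> \<le> b" "h \<sigma> \<le> 0"
    using \<rho>(1) \<sigma>(1) by (auto simp: L_def R_def)
  then have 2: "\<rho> < x" "x < \<sigma>" using h(3) by (auto simp: less_le)
  \<comment> \<open>The last nonpositive point before \<open>x\<close> must be a zero: the
    intermediate value theorem gives a zero between it and \<open>x\<close>, which cannot come
    later. The same holds on the right.\<close>
  have "continuous_on {\<rho>..x} h" "continuous_on {x..\<sigma>} h"
    using 1 by (auto intro: continuous_on_subset[OF c])
  then obtain r s where r: "\<rho> \<le> r" "r \<le> x" "h r = 0" and s: "x \<le> s" "s \<le> \<sigma>" "h s = 0"
    using IVT'[of h \<rho> 0 x] IVT2'[of h \<sigma> 0 x] 1 h(3) by force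
  have "r \<in> L" "s \<in> R" using r s 1 by (simp_all add: L_def R_def)
  then have "r \<le> \<rho>" "\<sigma> \<le> s" by (simp_all add: \<rho>(2) \<sigma>(2))
  then have 3: "h \<rho> = 0" "h \<sigma> = 0" using r s by auto
  have "h r > 0" if "\<rho> < r" "r < \<sigma>" for r
  proof (rule ccontr)
    assume "\<not> h r > 0"
    then have "r \<in> L \<or> r \<in> R" using that 1 by (auto simp: L_def R_def)
    then show False using \<rho>(2)[of r] \<sigma>(2)[of r] that by auto
  qed
  then show ?thesis using that 1 2 3 by blast
qed

lemma continuous_on_dens:
  assumes "0 < a" "p > 2" "continuous_on {a..b} w" "continuous_on {a..b} k"
  shows "continuous_on {a..b} (\<lambda>r. dens p r (w r) (k r))"
  unfolding dens_def using assms
  by (intro continuous_intros assms continuous_on_powr') (auto intro!: add_nonneg_nonneg)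

section \<open>Finite energy of the minimizer, its value at the origin, and gluing of
  competitors\<close>

locale nonneg_minimizer_profile =
  fixes p :: real and f :: "real \<Rightarrow> real"
  assumes p: "p > 2" and nmin: "nonneg_minimizer p f"
begin

lemma f_cont: "continuous_on {0..} f" and f_nonneg: "r > 0 \<Longrightarrow> f r \<ge> 0"
  using nmin by (auto simp: nonneg_minimizer_def)

lemma f_cont_pos: "0 \<le> a \<Longrightarrow> continuous_on {a..b} f"
  by (rule continuous_on_subset[OF f_cont]) auto

lemma f_weak_deriv: "has_weak_deriv f (weak_deriv f)"
proof -
  obtain g where "has_weak_deriv f g"
    using nmin unfolding nonneg_minimizer_def minimizer_def X_space_def W1p_loc_def by auto
  then show ?thesis by (rule has_weak_deriv_weak_deriv)
qed

lemma f_prim: "0 < a \<Longrightarrow> L1_prim a b f (weak_deriv f)"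
  by (rule has_weak_deriv_imp_L1_prim[OF f_weak_deriv]) (auto intro: continuous_on_subset[OF f_cont])

lemma f_deriv_measurable: "weak_deriv f \<in> borel_measurable half_line"
  using f_weak_deriv by (simp add: has_weak_deriv_def Lp_loc_def)

lemma f_measurable: "f \<in> borel_measurable half_line"
  by (intro continuous_half_line_measurable continuous_on_subset[OF f_cont]) auto

abbreviation f_dens :: "real \<Rightarrow> real" where
  "f_dens r \<equiv> dens p r (f r) (weak_deriv f r)"

lemma f_dens_measurable: "f_dens \<in> borel_measurable half_line"
  by (intro dens_measurable f_measurable f_deriv_measurable)

lemma f_energy_finite: "(\<integral>\<^sup>+r. ennreal (f_dens r) \<partial>half_line) < \<infinity>"
proof -
  obtain h where "h \<in> X_space p" "I_functional p h < \<infinity>"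
    using exists_finite_energy[OF p] by blast
  moreover from this(1) have "I_functional p f \<le> I_functional p h"
    using nmin unfolding nonneg_minimizer_def minimizer_def by blast
  ultimately have "I_functional p f < \<infinity>" by (simp add: order_le_less_trans)
  then show ?thesis by (simp add: I_functional_eq)
qed

lemma f_dens_integrable:
  assumes "0 < a" shows "f_dens integrable_on {a..b}"
proof -
  have "(\<integral>\<^sup>+r. ennreal (norm (f_dens r)) \<partial>half_line) = (\<integral>\<^sup>+r. ennreal (f_dens r) \<partial>half_line)"
    by (intro nn_integral_cong) (simp add: dens_nonneg)
  then have "integrable half_line f_dens"
    using f_energy_finite by (intro integrableI_bounded f_dens_measurable) simp
  then have "f_dens absolutely_integrable_on {0<..}"
    by (simp add: integrable_restrict_space set_integrable_def)
  then have "f_dens absolutely_integrable_on {a..b}"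
    by (rule absolutely_integrable_on_subinterval) (use assms in auto)
  then show ?thesis by (rule set_lebesgue_integral_eq_integral(1))
qed

lemma f_energy_bound:
  obtains T where "\<And>a b. 0 < a \<Longrightarrow> integral {a..b} f_dens \<le> T"
proof -
  define T where "T = enn2real (\<integral>\<^sup>+r. ennreal (f_dens r) \<partial>half_line)"
  have "integral {a..b} f_dens \<le> T" if a: "0 < a" for a b
  proof -
    have "ennreal (integral {a..b} f_dens) = (\<integral>\<^sup>+r. ennreal (f_dens r) * indicator {a..b} r \<partial>half_line)"
      using a by (intro nn_integral_half_line_eq_integral[symmetric] f_dens_integrable dens_nonneg) auto
    also have "\<dots> \<le> (\<integral>\<^sup>+r. ennreal (f_dens r) \<partial>half_line)"
      by (intro nn_integral_mono) (auto simp: indicator_def)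
    also have "\<dots> = ennreal T"
      using f_energy_finite by (simp add: T_def)
    finally show ?thesis by (simp add: T_def ennreal_le_iff)
  qed
  then show ?thesis using that by blast
qed

text \<open>Since the weight \<open>r\<close> is not integrable at infinity, \<open>f^2\<close>
  cannot stay away from 1 there. This is the only information about \<open>f\<close> at infinity
  that is used to find contact points.\<close>

lemma f_energy_unbounded:
  assumes "R > 0" "\<kappa> > 0" "\<And>r. r \<ge> R \<Longrightarrow> \<kappa> \<le> (1 - (f r)\<^sup>2)\<^sup>2"
  shows False
proof -
  obtain T where T: "\<And>a b. 0 < a \<Longrightarrow> integral {a..b} f_dens \<le> T" using f_energy_bound by blast
  \<comment> \<open>A lower bound for the density on \<open>[R, \<infinity>)\<close>;
    \<open>B\<close> is then so large that the bound integrates to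
    \<open>\<bar>T\<bar> + 1\<close>.\<close>
  define m where "m = 1 / 2 * \<kappa> * R"
  have m: "m > 0" using assms by (simp add: m_def)
  define B where "B = R + (\<bar>T\<bar> + 1) / m"
  have B: "B \<ge> R" using m by (simp add: B_def)
  have "integral {R..B} (\<lambda>r. m) \<le> integral {R..B} f_dens"
  proof (rule integral_le)
    fix r assume r: "r \<in> {R..B}"
    then have "1 / 2 * \<kappa> * R \<le> (((weak_deriv f r)\<^sup>2 + (f r)\<^sup>2 / r\<^sup>2) powr (p / 2) + 1 / 2 * (1 - (f r)\<^sup>2)\<^sup>2) * r"
      using assms(3)[of r] assms(1,2) by (intro mult_mono) (auto intro: add_increasing)
    then show "m \<le> f_dens r" by (simp add: m_def dens_def)
  qed (use f_dens_integrable assms in auto)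
  also have "\<dots> \<le> T" using T assms by simp
  also have "integral {R..B} (\<lambda>r. m) = \<bar>T\<bar> + 1" using B m by (simp add: B_def)
  finally show False by simp
qed

text \<open>Otherwise \<open>f^2 / r^2\<close> alone makes the density at least
  \<open>\<kappa> / r\<close> near the origin, and its integral diverges.\<close>

lemma f_0: "f 0 = 0"
proof (rule ccontr)
  assume "f 0 \<noteq> 0"
  define m where "m = \<bar>f 0\<bar> / 2"
  have m: "m > 0" using \<open>f 0 \<noteq> 0\<close> by (simp add: m_def)
  then obtain d where d: "d > 0" "\<And>r. r \<ge> 0 \<Longrightarrow> \<bar>r\<bar> < d \<Longrightarrow> \<bar>f r - f 0\<bar> < m"
    using f_cont[unfolded continuous_on_iff dist_real_def, rule_format, of 0 m] by auto
  define D where "D = min (d / 2) 1"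
  have D: "0 < D" "D < d" "D \<le> 1" using d by (auto simp: D_def)
  define \<kappa> where "\<kappa> = m powr p"
  have \<kappa>: "\<kappa> > 0" using m by (simp add: \<kappa>_def)
  have low: "\<kappa> / r \<le> f_dens r" if r: "0 < r" "r \<le> D" for r
  proof -
    have "\<bar>f r - f 0\<bar> < \<bar>f 0\<bar> / 2" using d(2)[of r] r D by (simp add: m_def)
    then have "\<bar>f r\<bar> \<ge> m" unfolding m_def by linarith
    then have "m\<^sup>2 \<le> (f r)\<^sup>2" using m by (metis abs_of_pos abs_le_square_iff)
    then have "m\<^sup>2 / r\<^sup>2 \<le> (weak_deriv f r)\<^sup>2 + (f r)\<^sup>2 / r\<^sup>2"
      using r by (intro add_increasing divide_right_mono) auto
    then have "(m\<^sup>2 / r\<^sup>2) powr (p / 2) \<le> ((weak_deriv f r)\<^sup>2 + (f r)\<^sup>2 / r\<^sup>2) powr (p / 2)"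
      using p by (intro powr_mono2) auto
    also have "(m\<^sup>2 / r\<^sup>2) powr (p / 2) = ((m / r) powr 2) powr (p / 2)"
      using m r by (simp add: power_divide)
    also have "\<dots> = \<kappa> / r powr p" using m r by (simp only: powr_powr) (simp add: powr_divide \<kappa>_def)
    finally have "\<kappa> / r powr p \<le> ((weak_deriv f r)\<^sup>2 + (f r)\<^sup>2 / r\<^sup>2) powr (p / 2) + 1 / 2 * (1 - (f r)\<^sup>2)\<^sup>2"
      by (rule order_trans) simp
    then have "\<kappa> / r powr p * r \<le> f_dens r" unfolding dens_def using r by (intro mult_right_mono) auto
    \<comment> \<open>The true growth \<open>r powr (1 - p)\<close> is weakened to
      \<open>1 / r\<close>, using \<open>r \<le> 1\<close> and \<open>p > 2\<close>; its primitive
      is the logarithm for all \<open>p\<close>.\<close>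
    moreover have "r powr p \<le> r powr 2" using r D p by (intro powr_mono') auto
    then have "\<kappa> / r powr 2 \<le> \<kappa> / r powr p" using r \<kappa> by (intro divide_left_mono) auto
    then have "\<kappa> / r powr 2 * r \<le> \<kappa> / r powr p * r" using r by (intro mult_right_mono) auto
    moreover have "\<kappa> / r powr 2 * r = \<kappa> / r" using r by (simp add: power2_eq_square)
    ultimately show ?thesis by linarith
  qed
  obtain T where T: "\<And>a b. 0 < a \<Longrightarrow> integral {a..b} f_dens \<le> T" using f_energy_bound by blast
  \<comment> \<open>Chosen so that \<open>\<kappa> / r\<close> integrates over \<open>[e, D]\<close>
    to exactly \<open>\<bar>T\<bar> + 1\<close>.\<close>
  define e where "e = D * exp (- (\<bar>T\<bar> + 1) / \<kappa>)"
  have e: "0 < e" "e \<le> D" using D \<kappa> by (auto simp: e_def mult_le_cancel_left1 divide_le_0_iff)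
  have "((\<lambda>r. \<kappa> / r) has_integral (\<kappa> * ln D - \<kappa> * ln e)) {e..D}"
  proof (rule fundamental_theorem_of_calculus[OF e(2)])
    fix x assume "x \<in> {e..D}"
    then have "x > 0" using e by simp
    then have "((\<lambda>r. \<kappa> * ln r) has_real_derivative \<kappa> / x) (at x)"
      by (auto intro!: derivative_eq_intros)
    then show "((\<lambda>r. \<kappa> * ln r) has_vector_derivative \<kappa> / x) (at x within {e..D})"
      unfolding has_real_derivative_iff_has_vector_derivative by (rule has_vector_derivative_at_within)
  qed
  then have "\<kappa> * ln D - \<kappa> * ln e \<le> integral {e..D} f_dens"
    by (rule has_integral_le[OF _ integrable_integral[OF f_dens_integrable[OF e(1)]]])
       (use low e in auto)
  also have "\<dots> \<le> T" using T e by simp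
  also have "\<kappa> * ln D - \<kappa> * ln e = \<bar>T\<bar> + 1"
    using D \<kappa> by (simp add: e_def ln_mult field_simps)
  finally show False by simp
qed

text \<open>Minimality localised: replace \<open>f\<close> by \<open>w\<close> on the interval and
  cancel the common energy outside.\<close>

lemma f_competitor:
  assumes \<rho>: "0 < \<rho>" "\<rho> < \<sigma>" and w: "L1_prim \<rho> \<sigma> w k" and ck: "continuous_on {\<rho>..\<sigma>} k"
    and ends: "w \<rho> = f \<rho>" "w \<sigma> = f \<sigma>"
  shows "integral {\<rho>..\<sigma>} f_dens \<le> integral {\<rho>..\<sigma>} (\<lambda>r. dens p r (w r) (k r))"
proof -
  let ?J = "{\<rho>..\<sigma>}"
  define h where "h r = (if r \<in> ?J then w r else f r)" for r
  define k' where "k' r = (if r \<in> ?J then k r else weak_deriv f r)" for r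
  have prim: "L1_prim a b h k'" if ab: "0 < a" "a < b" for a b
  proof -
    define A where "A = min a (\<rho> / 2)"
    define B where "B = max b (\<sigma> + 1)"
    have AB: "0 < A" "A \<le> \<rho>" "\<rho> \<le> \<sigma>" "\<sigma> \<le> B" "A \<le> a" "b \<le> B" using ab \<rho> by (auto simp: A_def B_def)
    have "L1_prim A \<rho> h k'"
      by (rule L1_prim_cong[OF f_prim[OF AB(1)]]) (use ends in \<open>auto simp: h_def k'_def\<close>)
    moreover have "L1_prim \<rho> \<sigma> h k'"
      by (rule L1_prim_cong[OF w]) (auto simp: h_def k'_def)
    moreover have "L1_prim \<sigma> B h k'"
      by (rule L1_prim_cong[OF f_prim[of \<sigma> B]]) (use ends \<rho> in \<open>auto simp: h_def k'_def\<close>)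
    ultimately have "L1_prim A B h k'"
      using AB L1_prim_join[OF L1_prim_join, of A \<rho> h k' \<sigma> B] by simp
    then show ?thesis using AB(5,6) by (rule L1_prim_subinterval)
  qed
  have mk': "k' \<in> borel_measurable half_line"
  proof -
    \<comment> \<open>\<open>k\<close> is known to be measurable only on the interval, so it is
      extended by 0 before it is combined with \<open>weak_deriv f\<close>.\<close>
    have "k \<in> borel_measurable (lebesgue_on ?J)"
      using ck by (rule continuous_imp_measurable_on_sets_lebesgue) simp
    then have "(\<lambda>r. if r \<in> ?J then k r else 0) \<in> borel_measurable lebesgue"
      by (subst borel_measurable_if) auto
    then have m: "(\<lambda>r. if r \<in> ?J then k r else 0) \<in> borel_measurable half_line"
      by (rule measurable_restrict_space1)
    have "(\<lambda>r. if r \<in> ?J then (if r \<in> ?J then k r else 0) else weak_deriv f r) \<in> borel_measurable half_line"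
      by (rule measurable_If[OF m f_deriv_measurable]) (auto simp: sets_restrict_space_iff)
    moreover have "k' = (\<lambda>r. if r \<in> ?J then (if r \<in> ?J then k r else 0) else weak_deriv f r)"
      by (auto simp: k'_def)
    ultimately show ?thesis by simp
  qed
  have mh: "h \<in> borel_measurable half_line"
    by (intro continuous_half_line_measurable continuous_on_pos_prim[OF prim])
  have iw: "(\<lambda>r. dens p r (w r) (k r)) integrable_on ?J"
    by (intro integrable_continuous_real continuous_on_dens \<rho> p ck L1_prim_continuous[OF w])
  have mJ: "?J \<in> sets half_line" using \<rho> by (auto simp: sets_restrict_space_iff)
  have split: "(\<integral>\<^sup>+r. F r \<partial>half_line) = (\<integral>\<^sup>+r. F r * indicator ?J r \<partial>half_line) + (\<integral>\<^sup>+r. F r * indicator (- ?J) r \<partial>half_line)"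
    if [measurable]: "F \<in> borel_measurable half_line" for F :: "real \<Rightarrow> ennreal"
  proof -
    have 1: "(\<lambda>r. F r * indicator ?J r) \<in> borel_measurable half_line"
      by (intro borel_measurable_times_ennreal borel_measurable_indicator mJ that)
    have "(indicator (- ?J) :: real \<Rightarrow> ennreal) \<in> borel_measurable half_line"
      by (intro borel_measurable_indicator') (auto simp: sets_restrict_space_iff)
    then have 2: "(\<lambda>r. F r * indicator (- ?J) r) \<in> borel_measurable half_line"
      by (intro borel_measurable_times_ennreal that)
    have "(\<integral>\<^sup>+r. F r \<partial>half_line) = (\<integral>\<^sup>+r. F r * indicator ?J r + F r * indicator (- ?J) r \<partial>half_line)"
      by (intro nn_integral_cong) (auto simp: indicator_def)
    also have "\<dots> = (\<integral>\<^sup>+r. F r * indicator ?J r \<partial>half_line) + (\<integral>\<^sup>+r. F r * indicator (- ?J) r \<partial>half_line)"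
      using 1 2 by (rule nn_integral_add)
    finally show ?thesis .
  qed
  define Out where "Out = (\<integral>\<^sup>+r. ennreal (f_dens r) * indicator (- ?J) r \<partial>half_line)"
  have "Out \<le> (\<integral>\<^sup>+r. ennreal (f_dens r) \<partial>half_line)"
    unfolding Out_def by (intro nn_integral_mono) (auto simp: indicator_def)
  then have Out: "Out < \<infinity>" using f_energy_finite by (rule order_le_less_trans)
  have Ef: "(\<integral>\<^sup>+r. ennreal (f_dens r) \<partial>half_line) = ennreal (integral ?J f_dens) + Out"
    unfolding Out_def using f_dens_measurable \<rho>
    by (subst split) (auto simp: nn_integral_half_line_eq_integral f_dens_integrable dens_nonneg)
  have "(\<integral>\<^sup>+r. ennreal (dens p r (h r) (k' r)) \<partial>half_line)
    = (\<integral>\<^sup>+r. ennreal (dens p r (h r) (k' r)) * indicator ?J r \<partial>half_line)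
      + (\<integral>\<^sup>+r. ennreal (dens p r (h r) (k' r)) * indicator (- ?J) r \<partial>half_line)"
    using dens_measurable[OF mh mk', of p] by (intro split) auto
  also have "(\<integral>\<^sup>+r. ennreal (dens p r (h r) (k' r)) * indicator ?J r \<partial>half_line)
    = (\<integral>\<^sup>+r. ennreal (dens p r (w r) (k r)) * indicator ?J r \<partial>half_line)"
    by (intro nn_integral_cong) (auto simp: h_def k'_def indicator_def)
  also have "\<dots> = ennreal (integral ?J (\<lambda>r. dens p r (w r) (k r)))"
    using \<rho> iw by (intro nn_integral_half_line_eq_integral dens_nonneg) auto
  also have "(\<integral>\<^sup>+r. ennreal (dens p r (h r) (k' r)) * indicator (- ?J) r \<partial>half_line) = Out"
    unfolding Out_def by (intro nn_integral_cong) (auto simp: h_def k'_def indicator_def)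
  finally have Eh: "(\<integral>\<^sup>+r. ennreal (dens p r (h r) (k' r)) \<partial>half_line)
    = ennreal (integral ?J (\<lambda>r. dens p r (w r) (k r))) + Out" .
  then have fin: "(\<integral>\<^sup>+r. ennreal (dens p r (h r) (k' r)) \<partial>half_line) < \<infinity>" using Out by simp
  note X = X_spaceI[OF p prim mk' fin]
  have "I_functional p f \<le> I_functional p h"
    using nmin X(1) unfolding nonneg_minimizer_def minimizer_def by blast
  then have "ennreal (integral ?J f_dens) + Out \<le> ennreal (integral ?J (\<lambda>r. dens p r (w r) (k r))) + Out"
    using Ef Eh X(2) by (simp add: I_functional_eq)
  \<comment> \<open>Cancellation in \<open>ennreal\<close> is legitimate because \<open>Out\<close>
    is finite.\<close>
  then have "ennreal (integral ?J f_dens) \<le> ennreal (integral ?J (\<lambda>r. dens p r (w r) (k r)))"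
    using Out by (auto simp: ennreal_add_left_cancel_le add.commute[of _ Out])
  moreover have "integral ?J (\<lambda>r. dens p r (w r) (k r)) \<ge> 0"
    using iw \<rho> by (intro integral_nonneg dens_nonneg) auto
  ultimately show ?thesis by (simp add: ennreal_le_iff)
qed

end

section \<open>Concavity\<close>

context nonneg_minimizer_profile begin

lemma defect_integral_pos:
  assumes \<rho>: "0 < \<rho>" "\<rho> < \<sigma>" and w: "continuous_on {\<rho>..\<sigma>} w"
    and x: "\<rho> < x" "x < \<sigma>" "(f x)\<^sup>2 \<noteq> (w x)\<^sup>2"
  shows "0 < integral {\<rho>..\<sigma>} (\<lambda>r. ((f r)\<^sup>2 - (w r)\<^sup>2)\<^sup>2 / 2 * r)"
proof -
  let ?h = "\<lambda>r. ((f r)\<^sup>2 - (w r)\<^sup>2)\<^sup>2 / 2 * r"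
  have c: "continuous_on {\<rho>..\<sigma>} ?h"
    using \<rho> by (intro continuous_intros f_cont_pos w) auto
  have nn: "0 \<le> ?h r" if "r \<in> {\<rho>..\<sigma>}" for r using that \<rho> by simp
  have "integral {\<rho>..\<sigma>} ?h \<noteq> 0"
    using integral_eq_0_iff[OF c \<rho>(2) nn] x \<rho> by force
  moreover have "integral {\<rho>..\<sigma>} ?h \<ge> 0"
    using c nn by (intro integral_nonneg integrable_continuous_real) auto
  ultimately show ?thesis by simp
qed

lemma no_excursion_above:
  assumes \<rho>: "0 < \<rho>" "\<rho> < \<sigma>"
    and w: "\<And>r. \<rho> \<le> r \<Longrightarrow> r \<le> \<sigma> \<Longrightarrow> w r > 0"
    and dw: "\<And>r. \<rho> \<le> r \<Longrightarrow> r \<le> \<sigma> \<Longrightarrow> (w has_real_derivative z r * w r) (at r)"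
    and dz: "\<And>r. \<rho> \<le> r \<Longrightarrow> r \<le> \<sigma> \<Longrightarrow> (z has_real_derivative z1 r) (at r)"
    and cz1: "continuous_on {\<rho>..\<sigma>} z1"
    and ends: "f \<rho> = w \<rho>" "f \<sigma> = w \<sigma>" and above: "\<And>r. \<rho> < r \<Longrightarrow> r < \<sigma> \<Longrightarrow> w r < f r"
    and N: "\<And>r. \<rho> \<le> r \<Longrightarrow> r \<le> \<sigma> \<Longrightarrow> 0 \<le> elop p r (w r) (z r) (z1 r)"
  shows False
proof -
  have cw: "continuous_on {\<rho>..\<sigma>} w"
    using DERIV_isCont[OF dw] by (simp add: continuous_at_imp_continuous_on)
  have cz: "continuous_on {\<rho>..\<sigma>} z"
    using DERIV_isCont[OF dz] by (simp add: continuous_at_imp_continuous_on)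
  have cp: "continuous_on {\<rho>..\<sigma>} (\<lambda>r. z r * w r)" using cw cz by (intro continuous_intros)
  have ge: "w r \<le> f r" if "\<rho> \<le> r" "r \<le> \<sigma>" for r
  proof (cases "r = \<rho> \<or> r = \<sigma>")
    case True then show ?thesis using ends by auto
  next
    case False then show ?thesis using above[of r] that by auto
  qed
  have "integral {\<rho>..\<sigma>} (\<lambda>r. dens p r (w r) (z r * w r)) + integral {\<rho>..\<sigma>} (\<lambda>r. ((f r)\<^sup>2 - (w r)\<^sup>2)\<^sup>2 / 2 * r)
    \<le> integral {\<rho>..\<sigma>} f_dens"
  proof (rule picone_lower_bound[OF p \<rho>(1) less_imp_le[OF \<rho>(2)] f_prim[OF \<rho>(1)] w dw dz cz1 f_dens_integrable[OF \<rho>(1)]])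
    show "0 \<le> elop p r (w r) (z r) (z1 r) * ((f r)\<^sup>2 - (w r)\<^sup>2)" if "\<rho> \<le> r" "r \<le> \<sigma>" for r
      using N[OF that] ge[OF that] w[OF that] by (intro mult_nonneg_nonneg) (auto intro: power_mono)
  qed (use ends in auto)
  moreover have "integral {\<rho>..\<sigma>} f_dens \<le> integral {\<rho>..\<sigma>} (\<lambda>r. dens p r (w r) (z r * w r))"
    by (rule f_competitor[OF \<rho> L1_prim_C1[OF has_field_derivative_at_within[OF dw] cp] cp])
       (use ends in auto)
  moreover have "0 < integral {\<rho>..\<sigma>} (\<lambda>r. ((f r)\<^sup>2 - (w r)\<^sup>2)\<^sup>2 / 2 * r)"
  proof (rule defect_integral_pos[OF \<rho> cw, of "(\<rho> + \<sigma>) / 2"])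
    have "0 < w ((\<rho> + \<sigma>) / 2)" "w ((\<rho> + \<sigma>) / 2) < f ((\<rho> + \<sigma>) / 2)"
      using \<rho> by (auto intro: w above)
    then show "(f ((\<rho> + \<sigma>) / 2))\<^sup>2 \<noteq> (w ((\<rho> + \<sigma>) / 2))\<^sup>2" by (simp add: power2_eq_iff)
  qed (use \<rho> in auto)
  ultimately show False by linarith
qed

lemma line_DERIV:
  fixes a c r :: real
  assumes "a * r + c > 0"
  shows "((\<lambda>r. a * r + c) has_real_derivative a / (a * r + c) * (a * r + c)) (at r)"
    and "((\<lambda>r. a / (a * r + c)) has_real_derivative - (a / (a * r + c))\<^sup>2) (at r)"
  using assms by (auto intro!: derivative_eq_intros simp: power2_eq_square)

text \<open>The sign of \<open>line_elop\<close> is required on all of \<open>[A, B]\<close> because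
  the ends of the excursion through \<open>x\<close> are not known in advance.\<close>

lemma no_point_above_line:
  assumes A: "0 < A" "A \<le> x" "x \<le> B" and pos: "\<And>r. A \<le> r \<Longrightarrow> r \<le> B \<Longrightarrow> a * r + c > 0"
    and ends: "f A \<le> a * A + c" "f B \<le> a * B + c" and above: "a * x + c < f x"
    and N: "\<And>r. A \<le> r \<Longrightarrow> r \<le> B \<Longrightarrow> 0 \<le> line_elop p a c r"
  shows False
proof -
  have "continuous_on {A..B} (\<lambda>r. f r - (a * r + c))"
    using A by (intro continuous_intros f_cont_pos) auto
  then obtain \<rho> \<sigma> where \<rho>\<sigma>: "A \<le> \<rho>" "\<rho> < x" "x < \<sigma>" "\<sigma> \<le> B" "f \<rho> - (a * \<rho> + c) = 0" "f \<sigma> - (a * \<sigma> + c) = 0"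
    "\<And>r. \<rho> < r \<Longrightarrow> r < \<sigma> \<Longrightarrow> f r - (a * r + c) > 0"
    by (rule positive_component[of A B _ x]) (use A ends above in auto)
  have lpos: "a * r + c > 0" if "\<rho> \<le> r" "r \<le> \<sigma>" for r using pos[of r] that \<rho>\<sigma> by auto
  show False
  proof (rule no_excursion_above[of \<rho> \<sigma> "\<lambda>r. a * r + c" "\<lambda>r. a / (a * r + c)" "\<lambda>r. - (a / (a * r + c))\<^sup>2"])
    show "((\<lambda>r. a * r + c) has_real_derivative a / (a * r + c) * (a * r + c)) (at r)"
      "((\<lambda>r. a / (a * r + c)) has_real_derivative - (a / (a * r + c))\<^sup>2) (at r)" if "\<rho> \<le> r" "r \<le> \<sigma>" for r
      using line_DERIV[OF lpos[OF that]] by blast+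
    show "continuous_on {\<rho>..\<sigma>} (\<lambda>r. - (a / (a * r + c))\<^sup>2)"
      using lpos by (intro continuous_intros) force
    show "0 \<le> elop p r (a * r + c) (a / (a * r + c)) (- (a / (a * r + c))\<^sup>2)" if "\<rho> \<le> r" "r \<le> \<sigma>" for r
    proof -
      have r: "r > 0" "A \<le> r" "r \<le> B" using that \<rho>\<sigma> A by auto
      show ?thesis
        unfolding elop_line[OF p r(1) lpos[OF that]] using N[OF r(2,3)] r p by (intro mult_nonneg_nonneg) auto
    qed
  qed (use \<rho>\<sigma> A lpos in auto)
qed

text \<open>At the left end the line may vanish (so that its logarithmic derivative is singular):
  the comparison is made on \<open>[\<delta>, \<sigma>]\<close>, where the boundary term has the right sign, and
  \<open>\<delta> \<rightarrow> \<rho>\<close>.\<close>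

lemma no_excursion_below_line:
  assumes \<rho>: "0 < \<rho>" "\<rho> < \<sigma>" and a: "a \<ge> 0"
    and pos: "\<And>r. \<rho> < r \<Longrightarrow> r \<le> \<sigma> \<Longrightarrow> a * r + c > 0"
    and ends: "f \<rho> = a * \<rho> + c" "f \<sigma> = a * \<sigma> + c"
    and below: "\<And>r. \<rho> < r \<Longrightarrow> r < \<sigma> \<Longrightarrow> f r < a * r + c"
    and N: "\<And>r. \<rho> < r \<Longrightarrow> r < \<sigma> \<Longrightarrow> line_elop p a c r \<le> 0"
  shows False
proof -
  let ?l = "\<lambda>r. a * r + c" and ?S = "\<lambda>r. ((f r)\<^sup>2 - (a * r + c)\<^sup>2)\<^sup>2 / 2 * r"
  have cl: "continuous_on {u..v} ?l" for u v by (intro continuous_intros)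
  have le: "f r \<le> ?l r" if "\<rho> < r" "r \<le> \<sigma>" for r
    using below[of r] that ends by (cases "r = \<sigma>") auto
  have i1: "(\<lambda>r. dens p r (?l r) a) integrable_on {\<rho>..\<sigma>}"
    using \<rho> p by (intro integrable_continuous_real continuous_on_dens cl continuous_on_const)
  have i2: "?S integrable_on {\<rho>..\<sigma>}"
    using \<rho> by (intro integrable_continuous_real continuous_intros f_cont_pos) auto
  have i3: "f_dens integrable_on {\<rho>..\<sigma>}" using f_dens_integrable \<rho> by simp
  \<comment> \<open>The slack of the comparison on \<open>[d, \<sigma>]\<close>. It is nonnegative
    for \<open>d > \<rho>\<close> and continuous up to \<open>\<rho>\<close>, where minimality and
    the positive remainder make it negative.\<close>
  define \<Phi> where "\<Phi> d = integral {d..\<sigma>} f_dens - integral {d..\<sigma>} (\<lambda>r. dens p r (?l r) a) - integral {d..\<sigma>} ?S" for d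
  have c\<Phi>: "continuous_on (closure {\<rho><..<\<sigma>}) \<Phi>"
    unfolding \<Phi>_def[abs_def] closure_greaterThanLessThan[OF \<rho>(2)]
    by (intro continuous_on_diff indefinite_integral_continuous_1' i1 i2 i3)
  have "0 \<le> \<Phi> \<rho>"
  proof (rule continuous_ge_on_closure[OF c\<Phi>])
    show "\<rho> \<in> closure {\<rho><..<\<sigma>}" using \<rho> by simp
    fix d assume d: "d \<in> {\<rho><..<\<sigma>}"
    then have lpos: "?l r > 0" if "d \<le> r" "r \<le> \<sigma>" for r using pos[of r] that by auto
    have d0: "0 < d" "d \<le> \<sigma>" using d \<rho> by auto
    have "integral {d..\<sigma>} (\<lambda>r. dens p r (?l r) (a / ?l r * ?l r)) + integral {d..\<sigma>} ?S \<le> integral {d..\<sigma>} f_dens"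
    proof (rule picone_lower_bound[OF p d0 f_prim[OF d0(1)] lpos])
      show "(?l has_real_derivative a / ?l r * ?l r) (at r)"
        "((\<lambda>r. a / ?l r) has_real_derivative - (a / ?l r)\<^sup>2) (at r)" if "d \<le> r" "r \<le> \<sigma>" for r
        using line_DERIV[OF lpos[OF that]] by blast+
      show "continuous_on {d..\<sigma>} (\<lambda>r. - (a / ?l r)\<^sup>2)"
        using lpos by (intro continuous_intros) force
      show "f_dens integrable_on {d..\<sigma>}" using f_dens_integrable d0 by simp
      have "(f d)\<^sup>2 \<le> (?l d)\<^sup>2" using le[of d] f_nonneg[of d] d d0 by (intro power_mono) auto
      then show "0 \<le> a / ?l d * ((?l d)\<^sup>2 - (f d)\<^sup>2)"
        using a lpos[of d] d0 by (intro mult_nonneg_nonneg) auto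
      show "0 \<le> elop p r (?l r) (a / ?l r) (- (a / ?l r)\<^sup>2) * ((f r)\<^sup>2 - (?l r)\<^sup>2)" if r: "d \<le> r" "r \<le> \<sigma>" for r
      proof (cases "r = \<sigma>")
        case True then show ?thesis using ends by simp
      next
        case False
        have r0: "r > 0" "\<rho> < r" using r d0 d by auto
        have "(f r)\<^sup>2 \<le> (?l r)\<^sup>2" using le[of r] f_nonneg[of r] r r0 by (intro power_mono) auto
        moreover have "elop p r (?l r) (a / ?l r) (- (a / ?l r)\<^sup>2) \<le> 0"
          unfolding elop_line[OF p r0(1) lpos[OF r]] using N[of r] False r r0 p
          by (intro mult_nonneg_nonpos) auto
        ultimately show ?thesis by (intro mult_nonpos_nonpos) auto
      qed
    qed (use ends lpos in auto)
    also have "integral {d..\<sigma>} (\<lambda>r. dens p r (?l r) (a / ?l r * ?l r)) = integral {d..\<sigma>} (\<lambda>r. dens p r (?l r) a)"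
      by (intro Henstock_Kurzweil_Integration.integral_cong) (use lpos in force)
    finally show "0 \<le> \<Phi> d" by (simp add: \<Phi>_def)
  qed
  moreover have "integral {\<rho>..\<sigma>} f_dens \<le> integral {\<rho>..\<sigma>} (\<lambda>r. dens p r (?l r) a)"
  proof (rule f_competitor[OF \<rho>])
    show "L1_prim \<rho> \<sigma> ?l (\<lambda>_. a)"
      by (rule L1_prim_C1) (auto intro!: derivative_eq_intros)
  qed (use ends in auto)
  moreover have "0 < integral {\<rho>..\<sigma>} ?S"
  proof (rule defect_integral_pos[OF \<rho> cl, of "(\<rho> + \<sigma>) / 2"])
    let ?m = "(\<rho> + \<sigma>) / 2"
    have m: "\<rho> < ?m" "?m < \<sigma>" "0 < ?m" using \<rho> by auto
    have "0 \<le> f ?m" "f ?m < ?l ?m" using below[OF m(1,2)] f_nonneg[OF m(3)] by auto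
    then have "(f ?m)\<^sup>2 < (?l ?m)\<^sup>2" by (intro power_strict_mono) auto
    then show "(f ?m)\<^sup>2 \<noteq> (?l ?m)\<^sup>2" by simp
  qed (use \<rho> in auto)
  ultimately show False unfolding \<Phi>_def by linarith
qed

section \<open>Upper bound, monotonicity, concavity and positivity of the minimizer\<close>

lemma f_small:
  assumes "e > 0" "b > 0"
  obtains A where "0 < A" "A < b" "f A < e"
proof -
  obtain d where d: "d > 0" "\<And>r. r \<ge> 0 \<Longrightarrow> \<bar>r\<bar> < d \<Longrightarrow> \<bar>f r\<bar> < e"
    using f_cont[unfolded continuous_on_iff dist_real_def, rule_format, of 0 e] assms by (auto simp: f_0)
  define A where "A = min d b / 2"
  have "0 < A" "A < b" "\<bar>A\<bar> < d" using d assms by (auto simp: A_def)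
  moreover have "f A < e" using d(2)[of A] \<open>0 < A\<close> \<open>\<bar>A\<bar> < d\<close> by auto
  ultimately show ?thesis using that by blast
qed

text \<open>Constants above 1 are supersolutions, since both parts of \<open>line_elop\<close> are
  then nonnegative.\<close>

lemma f_le_1:
  assumes x: "x > 0" shows "f x \<le> 1"
proof (rule ccontr)
  assume "\<not> f x \<le> 1"
  \<comment> \<open>The level lies strictly above 1, so that remaining above it forever keeps the
    potential bounded below and costs infinite energy.\<close>
  define c where "c = (1 + f x) / 2"
  have c: "1 < c" "c < f x" using \<open>\<not> f x \<le> 1\<close> by (auto simp: c_def)
  obtain A where A: "0 < A" "A < x" "f A < c" using f_small[of c x] c x by auto
  have "\<exists>B>x. f B \<le> c"
  proof (rule ccontr)
    assume *: "\<not> (\<exists>B>x. f B \<le> c)"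
    show False
    proof (rule f_energy_unbounded[of "x + 1" "(1 - c\<^sup>2)\<^sup>2"])
      have "1 < c\<^sup>2" using c by simp
      then show "0 < (1 - c\<^sup>2)\<^sup>2" by simp
      fix r assume r: "r \<ge> x + 1"
      then have "r > x" by simp
      then have "c < f r" using * by (meson not_le)
      then have "c\<^sup>2 \<le> (f r)\<^sup>2" using c by (intro power_mono) auto
      then have "(c\<^sup>2 - 1)\<^sup>2 \<le> ((f r)\<^sup>2 - 1)\<^sup>2" using \<open>1 < c\<^sup>2\<close> by (intro power_mono) auto
      then show "(1 - c\<^sup>2)\<^sup>2 \<le> (1 - (f r)\<^sup>2)\<^sup>2" by (simp add: power2_commute)
    qed (use x in auto)
  qed
  then obtain B where B: "x < B" "f B \<le> c" by blast
  show False
  proof (rule no_point_above_line[of A x B 0 c])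
    show "0 \<le> line_elop p 0 c r" if "A \<le> r" "r \<le> B" for r
    proof -
      have "line_K p 0 c r \<ge> 0" using c that A by (simp add: line_K_def)
      moreover have "2 / p * (1 - (0 * r + c)\<^sup>2) \<le> 0" using c p by (intro mult_nonneg_nonpos) auto
      ultimately show ?thesis unfolding line_elop_def by linarith
    qed
  qed (use A B c in auto)
qed

text \<open>No sign of \<open>line_elop\<close> is assumed here; this extends
  \<open>no_excursion_below_line\<close> to lines with \<open>c > 0\<close> that change their type
  inside the dip.\<close>

lemma no_dip_below_line:
  assumes \<rho>: "0 < \<rho>" "\<rho> < \<sigma>" and ac: "a \<ge> 0" "c > 0"
    and ends: "f \<rho> = a * \<rho> + c" "f \<sigma> = a * \<sigma> + c"
    and below: "\<And>r. \<rho> < r \<Longrightarrow> r < \<sigma> \<Longrightarrow> f r < a * r + c"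
  shows False
proof -
  have lpos: "a * r + c > 0" if "r > 0" for r using ac that by (simp add: add_nonneg_pos)
  have "\<exists>x. \<rho> < x \<and> x < \<sigma> \<and> line_elop p a c x > 0"
  proof (rule ccontr)
    assume neg: "\<not> ?thesis"
    show False
    proof (rule no_excursion_below_line[OF \<rho> ac(1) lpos ends below])
      show "line_elop p a c r \<le> 0" if "\<rho> < r" "r < \<sigma>" for r
        using neg that by (meson not_le)
    qed (use \<rho> in auto)
  qed
  then obtain x where x: "\<rho> < x" "x < \<sigma>" "line_elop p a c x > 0" by blast
  have x0: "x > 0" using x \<rho> by simp
  \<comment> \<open>Positivity of \<open>line_elop\<close> at \<open>x\<close> and
    \<open>f x\<close> lying below the line are strict, so both survive multiplication of the line
    by a factor close to 1; the contact points then lie strictly above the new line.\<close>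
  have "((\<lambda>\<mu>. line_elop p (\<mu> * a) (\<mu> * c) x) \<longlongrightarrow> line_elop p (1 * a) (1 * c) x) (at_left 1)"
    unfolding line_elop_def line_K_def line_gradsq_def using x0 lpos[OF x0] p
    by (auto intro!: tendsto_eq_intros add_nonneg_pos simp: add_nonneg_eq_0_iff sum_power2_eq_zero_iff)
  then have e1: "\<forall>\<^sub>F \<mu> in at_left 1. line_elop p (\<mu> * a) (\<mu> * c) x > 0"
    using x(3) by (intro order_tendstoD(1)) auto
  have "((\<lambda>\<mu>. \<mu> * a * x + \<mu> * c) \<longlongrightarrow> 1 * a * x + 1 * c) (at_left 1)"
    by (intro tendsto_intros)
  then have e2: "\<forall>\<^sub>F \<mu> in at_left 1. f x < \<mu> * a * x + \<mu> * c"
    using below[OF x(1,2)] by (intro order_tendstoD(1)) auto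
  have e3: "\<forall>\<^sub>F \<mu> in at_left (1::real). 0 < \<mu> \<and> \<mu> < 1"
    by (rule eventually_at_leftI[of 0]) auto
  have "\<exists>\<mu>. line_elop p (\<mu> * a) (\<mu> * c) x > 0 \<and> f x < \<mu> * a * x + \<mu> * c \<and> 0 < \<mu> \<and> \<mu> < 1"
    using eventually_happens[OF eventually_conj[OF e1 eventually_conj[OF e2 e3]]] by simp
  then obtain m where m: "line_elop p (m * a) (m * c) x > 0" "f x < m * a * x + m * c" "0 < m" "m < 1" by blast
  have mac: "m * a \<ge> 0" "m * c > 0" using m ac by auto
  have strict: "m * a * r + m * c < a * r + c" if "r > 0" for r
    using mult_strict_right_mono[OF m(4) lpos[OF that]] by (simp add: algebra_simps)
  have mpos: "m * a * r + m * c > 0" if "r > 0" for r using mac that by (simp add: add_nonneg_pos)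
  from line_elop_pos_half[OF mac p x0 m(1)] show False
  proof
    assume N: "\<forall>r. 0 < r \<and> r \<le> x \<longrightarrow> 0 < line_elop p (m * a) (m * c) r"
    obtain A where A: "0 < A" "A < \<rho>" "f A < m * c" using f_small[OF mac(2) \<rho>(1)] by blast
    show False
    proof (rule no_point_above_line[of A \<rho> x "m * a" "m * c"])
      show "f A \<le> m * a * A + m * c" using A mac by (simp add: add_increasing)
      show "m * a * \<rho> + m * c < f \<rho>" using strict[OF \<rho>(1)] ends by simp
      show "0 \<le> line_elop p (m * a) (m * c) r" if "A \<le> r" "r \<le> x" for r
        using N that A by (simp add: less_imp_le)
    qed (use A x m mpos in auto)
  next
    assume N: "0 < m * a \<and> (\<forall>r\<ge>x. 0 < line_elop p (m * a) (m * c) r)"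
    \<comment> \<open>From \<open>1 / (m * a)\<close> on the lowered line is at least 1, hence above
      \<open>f\<close>.\<close>
    define B where "B = max \<sigma> (1 / (m * a))"
    have "m * a * (1 / (m * a)) \<le> m * a * B" using N by (intro mult_left_mono) (auto simp: B_def)
    moreover have "m * a * (1 / (m * a)) = 1" using N by auto
    ultimately have B: "\<sigma> \<le> B" "1 \<le> m * a * B" by (simp add: B_def, linarith)
    show False
    proof (rule no_point_above_line[of x \<sigma> B "m * a" "m * c"])
      show "f B \<le> m * a * B + m * c" using f_le_1[of B] B \<rho> mac by auto
      show "m * a * \<sigma> + m * c < f \<sigma>" using strict[of \<sigma>] ends \<rho> by simp
      show "0 \<le> line_elop p (m * a) (m * c) r" if "x \<le> r" "r \<le> B" for r
        using N that by (simp add: less_imp_le)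
    qed (use x0 x m mpos B in auto)
  qed
qed

text \<open>If \<open>f\<close> decreased from \<open>x\<close> to \<open>y\<close>, it would cross
  an intermediate level \<open>c < 1\<close> downwards. Finite energy forces it to return to that
  level, which creates a dip below a constant.\<close>

lemma f_mono:
  assumes xy: "0 < x" "x \<le> y" shows "f x \<le> f y"
proof (rule ccontr)
  assume "\<not> f x \<le> f y"
  define c where "c = (f x + f y) / 2"
  have c: "f y < c" "c < f x" using \<open>\<not> f x \<le> f y\<close> by (auto simp: c_def)
  have c0: "0 < c" "c < 1" using f_nonneg[of y] f_le_1[of x] c xy by auto
  have "\<exists>B>y. f B \<ge> c"
  proof (rule ccontr)
    assume *: "\<not> (\<exists>B>y. f B \<ge> c)"
    show False
    proof (rule f_energy_unbounded[of "y + 1" "(1 - c\<^sup>2)\<^sup>2"])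
      have "c\<^sup>2 < 1" using c0 by (simp add: power_less_one_iff abs_square_less_1)
      then show "0 < (1 - c\<^sup>2)\<^sup>2" by simp
      fix r assume r: "r \<ge> y + 1"
      then have "r > y" by simp
      then have "f r < c" using * by (meson not_le)
      then have "(f r)\<^sup>2 \<le> c\<^sup>2" using f_nonneg[of r] r xy by (intro power_mono) auto
      then show "(1 - c\<^sup>2)\<^sup>2 \<le> (1 - (f r)\<^sup>2)\<^sup>2" using \<open>c\<^sup>2 < 1\<close> by (intro power_mono) auto
    qed (use xy in auto)
  qed
  then obtain B where B: "y < B" "f B \<ge> c" by blast
  have "continuous_on {x..B} (\<lambda>r. c - f r)"
    using xy by (intro continuous_intros f_cont_pos) auto
  then obtain \<rho> \<sigma> where "x \<le> \<rho>" "\<rho> < y" "y < \<sigma>" "\<sigma> \<le> B" "c - f \<rho> = 0" "c - f \<sigma> = 0"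
    "\<And>r. \<rho> < r \<Longrightarrow> r < \<sigma> \<Longrightarrow> c - f r > 0"
    by (rule positive_component[of x B _ y]) (use xy c B in auto)
  then show False
    using xy c0 by (intro no_dip_below_line[of \<rho> \<sigma> 0 c]) auto
qed

text \<open>By \<open>f_mono\<close> a chord has nonnegative slope, so the two line comparisons
  apply, according to the sign of its intercept \<open>c\<close>.\<close>

lemma f_chord_le:
  assumes a: "0 < a" "a < b" and x: "a \<le> x" "x \<le> b"
  shows "f a + (f b - f a) / (b - a) * (x - a) \<le> f x"
proof (rule ccontr)
  assume neg: "\<not> ?thesis"
  define s where "s = (f b - f a) / (b - a)"
  define c where "c = f a - s * a"
  have s0: "s \<ge> 0" using f_mono[of a b] a by (simp add: s_def)
  have lin: "s * r + c = f a + s * (r - a)" for r by (simp add: c_def algebra_simps)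
  have lb: "s * b + c = f b" unfolding lin using a by (simp add: s_def)
  have "continuous_on {a..b} (\<lambda>r. s * r + c - f r)"
    using a by (intro continuous_intros f_cont_pos) auto
  then obtain \<rho> \<sigma> where \<rho>\<sigma>: "a \<le> \<rho>" "\<rho> < x" "x < \<sigma>" "\<sigma> \<le> b" "s * \<rho> + c - f \<rho> = 0" "s * \<sigma> + c - f \<sigma> = 0"
    "\<And>r. \<rho> < r \<Longrightarrow> r < \<sigma> \<Longrightarrow> s * r + c - f r > 0"
    by (rule positive_component[of a b _ x]) (use a x neg lb in \<open>auto simp: lin s_def[symmetric]\<close>)
  have \<rho>: "0 < \<rho>" "\<rho> < \<sigma>" using \<rho>\<sigma> a by auto
  show False
  proof (cases "c > 0")
    case True
    show False by (rule no_dip_below_line[OF \<rho> s0 True]) (use \<rho>\<sigma> in force)+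
  next
    case False
    \<comment> \<open>Inside the dip the chord exceeds \<open>f \<ge> 0\<close>, and its slope
      carries positivity to \<open>\<sigma>\<close>. At \<open>\<rho>\<close> it may vanish:
      \<open>f > 0\<close> is a later consequence of concavity.\<close>
    have pos: "s * r + c > 0" if r: "\<rho> < r" "r \<le> \<sigma>" for r
    proof (cases "r < \<sigma>")
      case True then show ?thesis using \<rho>\<sigma>(7)[of r] f_nonneg[of r] r \<rho> by auto
    next
      case False
      have "f x < s * x + c" using \<rho>\<sigma>(7)[of x] \<rho>\<sigma>(2,3) by linarith
      then have "0 < s * x + c" using f_nonneg[of x] \<rho>\<sigma>(2) \<rho>(1) by linarith
      also have "\<dots> \<le> s * r + c" using s0 False \<rho>\<sigma> by (auto intro: mult_left_mono)
      finally show ?thesis .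
    qed
    have le1: "s * r + c \<le> 1" if "r \<le> \<sigma>" for r
    proof -
      have "s * r + c \<le> s * b + c" using s0 that \<rho>\<sigma> by (auto intro: mult_left_mono)
      then show ?thesis using lb f_le_1[of b] a by simp
    qed
    show False
    proof (rule no_excursion_below_line[OF \<rho> s0 pos])
      show "line_elop p s c r \<le> 0" if "\<rho> < r" "r < \<sigma>" for r
        using False that \<rho> by (intro line_elop_nonpos p s0 pos le1) auto
    qed (use \<rho>\<sigma> in force)+
  qed
qed

text \<open>A zero at \<open>x\<close> is also a zero at \<open>x / 2\<close> by monotonicity, and
  concavity then keeps \<open>f\<close> at 0 to the right, where the potential costs infinite
  energy.\<close>

lemma f_pos:
  assumes x: "x > 0" shows "f x > 0"
proof (rule ccontr)
  assume "\<not> f x > 0"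
  then have fx: "f x = 0" using f_nonneg[OF x] by simp
  show False
  proof (rule f_energy_unbounded[of "x + 1" 1])
    fix r assume r: "r \<ge> x + 1"
    have fx2: "f (x / 2) = 0" using f_mono[of "x / 2" x] f_nonneg[of "x / 2"] x fx by simp
    have "(f r - 0) / (r - x / 2) * (x - x / 2) \<le> 0"
      using f_chord_le[of "x / 2" r x] fx fx2 x r by simp
    moreover have "x - x / 2 > 0" "r - x / 2 > 0" using x r by auto
    ultimately have "f r \<le> 0" by (simp add: mult_le_0_iff divide_le_0_iff)
    then show "1 \<le> (1 - (f r)\<^sup>2)\<^sup>2" using f_nonneg[of r] r x by simp
  qed (use x in auto)
qed

end

section \<open>Absence of corners\<close>

text \<open>For fixed \<open>z\<close> the gradient part of \<open>elop\<close> is homogeneous of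
  degree \<open>p - 2\<close> in \<open>w\<close>; adding \<open>(1 - w^2) r\<close> isolates that
  part.\<close>

lemma elop_scale:
  assumes "l > 0" "w > 0" "r > 0"
  shows "elop p r (l * w) z z1 = l powr (p - 2) * (elop p r w z z1 + (1 - w\<^sup>2) * r) - (1 - (l * w)\<^sup>2) * r"
proof -
  define W where "W = gradsq r w z"
  have W: "W > 0" unfolding W_def gradsq_def using assms by (intro mult_pos_pos add_nonneg_pos) auto
  have G: "gradsq r (l * w) z = l powr 2 * W"
    using assms by (simp add: W_def gradsq_def power_mult_distrib)
  have sc: "(l powr 2 * W) powr a = l powr (2 * a) * W powr a" for a
    using powr_mult[of "l powr 2" W a] W by (simp only: powr_powr powr_ge_zero less_imp_le)
  have 1: "(l powr 2 * W) powr (p / 2 - 1) = l powr (p - 2) * W powr (p / 2 - 1)"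
    by (subst sc) (simp add: algebra_simps)
  have 2: "(l powr 2 * W) powr (p / 2 - 2) * l\<^sup>2 = l powr (p - 2) * W powr (p / 2 - 2)"
  proof -
    have "(l powr 2 * W) powr (p / 2 - 2) = l powr (p - 4) * W powr (p / 2 - 2)"
      by (subst sc) (simp add: algebra_simps)
    moreover have "l powr (p - 4) * l\<^sup>2 = l powr (p - 2)"
      using assms powr_add[of l "p - 4" 2] by simp
    ultimately show ?thesis by (simp add: mult_ac)
  qed
  define X where "X = z ^ 3 + z / r\<^sup>2 + z * z1 - 1 / r ^ 3"
  have "elop p r (l * w) z z1 = p / 2 * (l powr (p - 2) * W powr (p / 2 - 1) * (1 / r - r * z\<^sup>2 - z - r * z1)
      - (p / 2 - 1) * ((l powr 2 * W) powr (p / 2 - 2) * l\<^sup>2) * (2 * w\<^sup>2 * X) * (r * z)) - (1 - (l * w)\<^sup>2) * r"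
    unfolding elop_def G 1 X_def[symmetric] by (simp add: power_mult_distrib mult_ac)
  also have "\<dots> = l powr (p - 2) * (p / 2 * (W powr (p / 2 - 1) * (1 / r - r * z\<^sup>2 - z - r * z1)
      - (p / 2 - 1) * W powr (p / 2 - 2) * (2 * w\<^sup>2 * X) * (r * z))) - (1 - (l * w)\<^sup>2) * r"
    unfolding 2 by (simp add: algebra_simps)
  also have "p / 2 * (W powr (p / 2 - 1) * (1 / r - r * z\<^sup>2 - z - r * z1)
      - (p / 2 - 1) * W powr (p / 2 - 2) * (2 * w\<^sup>2 * X) * (r * z)) = elop p r w z z1 + (1 - w\<^sup>2) * r"
    unfolding elop_def X_def W_def by simp
  finally show ?thesis .
qed

context nonneg_minimizer_profile begin

text \<open>A corner would be touched from above by a log-parabola \<open>w\<close> with \<open>w' = z w\<close>,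
  \<open>z' = - M\<close>, which is a supersolution near the corner once \<open>M\<close> is large.\<close>

lemma no_corner:
  assumes x0: "x0 > 0" and lm: "l < m"
    and right: "\<And>x. x > x0 \<Longrightarrow> f x \<le> f x0 + l * (x - x0)"
    and left: "\<And>x. 0 < x \<Longrightarrow> x < x0 \<Longrightarrow> f x \<le> f x0 + m * (x - x0)"
  shows False
proof -
  define F where "F = f x0"
  \<comment> \<open>A slope strictly between the two: a smooth curve through the corner with this
    slope lies above \<open>f\<close> on both sides nearby.\<close>
  define b where "b = (l + m) / 2"
  have F: "F > 0" using f_pos[OF x0] by (simp add: F_def)
  define \<beta> where "\<beta> = b / F"
  define W0 where "W0 = gradsq x0 F \<beta>"
  have W0: "W0 > 0" unfolding W0_def gradsq_def using F x0 by (intro mult_pos_pos add_nonneg_pos) auto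
  \<comment> \<open>At \<open>x0\<close> the gradient part of \<open>elop\<close> is affine in
    \<open>M\<close>, with value \<open>C0 + M * C1\<close> and positive coefficient
    \<open>C1\<close>.\<close>
  define C0 where "C0 = p / 2 * (W0 powr (p / 2 - 1) * (1 / x0 - x0 * \<beta>\<^sup>2 - \<beta>)
      - (p / 2 - 1) * W0 powr (p / 2 - 2) * (2 * F\<^sup>2 * (\<beta> ^ 3 + \<beta> / x0\<^sup>2 - 1 / x0 ^ 3)) * (x0 * \<beta>))"
  define C1 where "C1 = p / 2 * (W0 powr (p / 2 - 1) * x0 + (p / 2 - 1) * W0 powr (p / 2 - 2) * (2 * F\<^sup>2) * (x0 * \<beta>\<^sup>2))"
  have C1: "C1 > 0" unfolding C1_def using p W0 F x0
    by (intro mult_pos_pos add_pos_nonneg mult_nonneg_nonneg) auto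
  \<comment> \<open>The margin \<open>2 * x0\<close> anticipates the scaling below: after a factor
    \<open>\<mu> powr (p - 2) > 1/2\<close>, a gradient part of at least \<open>2 r\<close> still
    dominates the potential term, which is at most \<open>r\<close>.\<close>
  define M where "M = (\<bar>C0\<bar> + 2 * x0 + 1) / C1"
  have M: "C0 + M * C1 > 2 * x0" using C1 by (simp add: M_def)
  define z where "z r = \<beta> - M * (r - x0)" for r
  define w where "w r = F * exp (\<beta> * (r - x0) - M * (r - x0)\<^sup>2 / 2)" for r
  have w_pos: "w r > 0" for r using F by (simp add: w_def)
  have dw: "(w has_real_derivative z r * w r) (at r)" for r
    unfolding w_def[abs_def] z_def by (auto intro!: derivative_eq_intros simp: field_simps)
  have dz: "(z has_real_derivative - M) (at r)" for r
    unfolding z_def[abs_def] by (auto intro!: derivative_eq_intros)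
  have w0: "w x0 = F" and z0: "z x0 = \<beta>" by (simp_all add: w_def z_def)
  define G where "G r = elop p r (w r) (z r) (- M) + (1 - (w r)\<^sup>2) * r" for r
  have "G x0 = C0 + M * C1"
    unfolding G_def elop_def w0 z0 W0_def[symmetric] C0_def C1_def
    by (simp add: algebra_simps power2_eq_square)
  then have G0: "G x0 - 2 * x0 > 0" using M by simp
  have "(w \<longlongrightarrow> w x0) (at x0)" "(z \<longlongrightarrow> z x0) (at x0)"
    using DERIV_isCont[OF dw] DERIV_isCont[OF dz] by (auto simp: isCont_def)
  moreover have "gradsq x0 (w x0) (z x0) \<noteq> 0" using W0 by (simp add: w0 z0 W0_def)
  ultimately have "((\<lambda>r. G r - 2 * r) \<longlongrightarrow> G x0 - 2 * x0) (at x0)"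
    unfolding G_def elop_def gradsq_def using x0
    by (intro tendsto_intros) auto
  then have e1: "\<forall>\<^sub>F r in at x0. G r - 2 * r > 0" using G0 by (rule order_tendstoD(1))
  have "((\<lambda>r. (w r - w x0) / (r - x0)) \<longlongrightarrow> z x0 * w x0) (at x0)"
    using dw[of x0] by (simp add: has_field_derivative_iff)
  moreover have "z x0 * w x0 = b" using F by (simp add: w0 z0 \<beta>_def)
  ultimately have e2: "\<forall>\<^sub>F r in at x0. l < (w r - w x0) / (r - x0)" and e3: "\<forall>\<^sub>F r in at x0. (w r - w x0) / (r - x0) < m"
    using lm by (auto intro: order_tendstoD simp: b_def)
  obtain d where d: "d > 0" "\<And>r. r \<noteq> x0 \<Longrightarrow> dist r x0 < d \<Longrightarrow> G r - 2 * r > 0 \<and> l < (w r - w x0) / (r - x0) \<and> (w r - w x0) / (r - x0) < m"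
    using eventually_conj[OF e1 eventually_conj[OF e2 e3]] unfolding eventually_at by blast
  define t where "t = min d x0 / 2"
  have t: "0 < t" "t < d" "t < x0" using d x0 by (auto simp: t_def)
  let ?A = "x0 - t" and ?B = "x0 + t"
  have Gpos: "G r \<ge> 2 * r" if "?A \<le> r" "r \<le> ?B" for r
  proof (cases "r = x0")
    case True then show ?thesis using G0 by simp
  next
    case False
    then have "dist r x0 < d" using that t by (auto simp: dist_real_def)
    then show ?thesis using d(2)[OF False] by simp
  qed
  have "(w ?A - w x0) / (?A - x0) < m" "l < (w ?B - w x0) / (?B - x0)"
    using d(2)[of ?A] d(2)[of ?B] t by (auto simp: dist_real_def)
  then have wA: "f ?A < w ?A" and wB: "f ?B < w ?B"
    using left[of ?A] right[of ?B] t by (auto simp: field_simps w0 F_def)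
  \<comment> \<open>A factor slightly below 1 puts \<open>f\<close> strictly above the curve at
    \<open>x0\<close> and keeps it below at both ends, so an excursion exists.\<close>
  have "((\<lambda>\<mu>. \<mu> * w x) \<longlongrightarrow> 1 * w x) (at_left 1)" for x by (intro tendsto_intros)
  then have "\<forall>\<^sub>F \<mu> in at_left 1. f ?A < \<mu> * w ?A" "\<forall>\<^sub>F \<mu> in at_left 1. f ?B < \<mu> * w ?B"
    using wA wB by (auto dest!: order_tendstoD(1))
  moreover have "((\<lambda>\<mu>::real. \<mu> powr (p - 2)) \<longlongrightarrow> 1 powr (p - 2)) (at_left 1)"
    by (intro tendsto_intros) simp
  then have "\<forall>\<^sub>F \<mu> in at_left (1::real). 1 / 2 < \<mu> powr (p - 2)"
    by (rule order_tendstoD(1)) simp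
  moreover have "\<forall>\<^sub>F \<mu> in at_left (1::real). 0 < \<mu> \<and> \<mu> < 1"
    by (rule eventually_at_leftI[of 0]) auto
  ultimately have "\<forall>\<^sub>F \<mu> in at_left 1. f ?A < \<mu> * w ?A \<and> f ?B < \<mu> * w ?B \<and> 1 / 2 < \<mu> powr (p - 2) \<and> 0 < \<mu> \<and> \<mu> < 1"
    by eventually_elim auto
  then obtain \<mu> where \<mu>: "f ?A < \<mu> * w ?A" "f ?B < \<mu> * w ?B" "1 / 2 < \<mu> powr (p - 2)" "0 < \<mu>" "\<mu> < 1"
    using eventually_happens by force
  have cw: "continuous_on S w" for S
    using DERIV_isCont[OF dw] by (simp add: continuous_at_imp_continuous_on)
  have "continuous_on {?A..?B} (\<lambda>r. f r - \<mu> * w r)"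
    using t by (intro continuous_intros f_cont_pos cw) auto
  then obtain \<rho> \<sigma> where \<rho>\<sigma>: "?A \<le> \<rho>" "\<rho> < x0" "x0 < \<sigma>" "\<sigma> \<le> ?B" "f \<rho> - \<mu> * w \<rho> = 0" "f \<sigma> - \<mu> * w \<sigma> = 0"
    "\<And>r. \<rho> < r \<Longrightarrow> r < \<sigma> \<Longrightarrow> f r - \<mu> * w r > 0"
    by (rule positive_component[of ?A ?B _ x0]) (use t \<mu> F in \<open>auto simp: w0 F_def\<close>)
  show False
  proof (rule no_excursion_above[of \<rho> \<sigma> "\<lambda>r. \<mu> * w r" z "\<lambda>r. - M"])
    show "0 \<le> elop p r (\<mu> * w r) (z r) (- M)" if r: "\<rho> \<le> r" "r \<le> \<sigma>" for r
    proof -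
      have r0: "r > 0" using r \<rho>\<sigma> t by linarith
      have "2 * r \<le> G r" using Gpos[of r] r \<rho>\<sigma> by linarith
      then have "1 / 2 * (2 * r) \<le> \<mu> powr (p - 2) * G r"
        using \<mu> r0 by (intro mult_mono) auto
      moreover have "0 \<le> (\<mu> * w r)\<^sup>2 * r" using r0 by simp
      ultimately show ?thesis
        unfolding elop_scale[OF \<mu>(4) w_pos r0] G_def[symmetric] by (simp add: algebra_simps)
    qed
    show "((\<lambda>r. \<mu> * w r) has_real_derivative z r * (\<mu> * w r)) (at r)" for r
      using DERIV_cmult[OF dw[of r], of \<mu>] by (simp add: mult_ac)
  qed (use \<rho>\<sigma> t \<mu> w_pos dz in auto)
qed

section \<open>Differentiability of the minimizer and monotonicity of its derivative\<close>

lemma f_slope_mono: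
  assumes "0 < x" "x < y" "y < v"
  shows "(f v - f x) / (v - x) \<le> (f y - f x) / (y - x)" "(f v - f y) / (v - y) \<le> (f v - f x) / (v - x)"
proof -
  define S where "S = (f v - f x) / (v - x)"
  have 1: "f x + S * (y - x) \<le> f y" using f_chord_le[of x v y] assms by (simp add: S_def)
  have 2: "S * (v - x) = f v - f x" using assms by (simp add: S_def)
  show "S \<le> (f y - f x) / (y - x)" using 1 assms by (simp add: pos_le_divide_eq)
  have "f v - f y \<le> S * (v - y)" using 1 2 by (simp add: algebra_simps)
  then show "(f v - f y) / (v - y) \<le> S" using assms by (simp add: pos_divide_le_eq)
qed

text \<open>Concavity makes difference quotients at \<open>x0\<close> decrease, so the supremum
  \<open>l\<close> of the right ones is at most the infimum \<open>m\<close> of the left ones, and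
  \<open>no_corner\<close> rules out \<open>l < m\<close>. The supporting line is recorded because
  it yields monotonicity of the derivative directly.\<close>

lemma f_has_derivative:
  assumes x0: "x0 > 0"
  obtains D where "(f has_real_derivative D) (at x0)" "\<And>r. r > 0 \<Longrightarrow> f r \<le> f x0 + D * (r - x0)"
proof -
  define q where "q x = (f x - f x0) / (x - x0)" for x
  have q': "q x = (f x0 - f x) / (x0 - x)" for x
    unfolding q_def by (metis minus_diff_eq minus_divide_divide)
  have anti: "q y \<le> q x" if h: "0 < x" "x \<le> y" "x \<noteq> x0" "y \<noteq> x0" for x y
  proof (cases "x = y")
    case False
    then consider "y < x0" | "x < x0" "x0 < y" | "x0 < x" using h by linarith
    then show ?thesis
    proof cases
      case 1 then show ?thesis using f_slope_mono(2)[of x y x0] h False by (simp add: q')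
    next
      case 2
      have "q y \<le> (f y - f x) / (y - x)" using f_slope_mono(2)[of x x0 y] h 2 by (simp add: q_def)
      also have "\<dots> \<le> q x" using f_slope_mono(1)[of x x0 y] h 2 by (simp add: q')
      finally show ?thesis .
    next
      case 3 then show ?thesis using f_slope_mono(1)[of x0 x y] h x0 False by (simp add: q_def)
    qed
  qed simp
  define Rs where "Rs = q ` {x0<..}"
  define Ls where "Ls = q ` {0<..<x0}"
  have RL: "s \<le> t" if "s \<in> Rs" "t \<in> Ls" for s t using that anti by (auto simp: Rs_def Ls_def)
  have ne: "q (x0 + 1) \<in> Rs" "q (x0 / 2) \<in> Ls" using x0 by (auto simp: Rs_def Ls_def)
  then have ne': "Rs \<noteq> {}" "Ls \<noteq> {}" by blast+
  have bd: "bdd_above Rs" "bdd_below Ls"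
    by (rule bdd_aboveI[OF RL[OF _ ne(2)]], assumption, rule bdd_belowI[OF RL[OF ne(1)]], assumption)
  define l where "l = Sup Rs"
  define m where "m = Inf Ls"
  have ql: "q x \<le> l" if "x > x0" for x
    unfolding l_def using that bd by (intro cSup_upper) (auto simp: Rs_def)
  have qm: "m \<le> q x" if "0 < x" "x < x0" for x
    unfolding m_def using that bd by (intro cInf_lower) (auto simp: Ls_def)
  have right: "f x \<le> f x0 + l * (x - x0)" if "x > x0" for x
    using ql[OF that] that by (simp add: q_def pos_divide_le_eq algebra_simps)
  have left: "f x \<le> f x0 + m * (x - x0)" if "0 < x" "x < x0" for x
    using qm[OF that] that by (simp add: q' pos_le_divide_eq algebra_simps)
  have "l \<le> m"
    unfolding l_def m_def using ne' RL by (intro cSup_least cInf_greatest) auto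
  moreover have "\<not> l < m" using no_corner[OF x0 _ right left] by blast
  ultimately have eq: "m = l" by simp
  have "(q \<longlongrightarrow> l) (at x0)"
  proof (rule tendstoI)
    fix e :: real assume e: "e > 0"
    obtain s where s: "s \<in> Rs" "l - e < s"
      using e ne' bd unfolding l_def by (metis diff_less_eq less_add_same_cancel1 less_cSup_iff)
    obtain t where t: "t \<in> Ls" "t < l + e"
      using e ne' bd eq unfolding m_def by (metis cInf_less_iff less_add_same_cancel1)
    obtain xs where xs: "xs > x0" "l - e < q xs" using s by (auto simp: Rs_def)
    obtain xt where xt: "0 < xt" "xt < x0" "q xt < l + e" using t by (auto simp: Ls_def)
    show "\<forall>\<^sub>F x in at x0. dist (q x) l < e"
      unfolding eventually_at
    proof (intro exI[of _ "min (xs - x0) (x0 - xt)"] conjI ballI impI)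
      fix x assume x: "x \<noteq> x0 \<and> dist x x0 < min (xs - x0) (x0 - xt)"
      then have b: "xt < x" "x < xs" by (auto simp: dist_real_def)
      show "dist (q x) l < e"
      proof (cases "x > x0")
        case True
        then have "q xs \<le> q x" using anti[of x xs] b x0 xs by auto
        then show ?thesis using ql[OF True] xs e by (simp add: dist_real_def)
      next
        case False
        then have "x < x0" "0 < x" using x b xt by auto
        moreover have "q x \<le> q xt" using anti[of xt x] b xt calculation by auto
        ultimately show ?thesis using qm[of x] xt e eq by (simp add: dist_real_def)
      qed
    qed (use xs xt in auto)
  qed
  then have "(f has_real_derivative l) (at x0)"
    by (simp add: has_field_derivative_iff q_def[abs_def])
  moreover have "f r \<le> f x0 + l * (r - x0)" if "r > 0" for r
    using left[of r] right[of r] that eq by (cases r x0 rule: linorder_cases) auto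
  ultimately show ?thesis using that by blast
qed

end

theorem corollary2p1:
  fixes p :: real and f :: "real \<Rightarrow> real"
  assumes "p > 2"
    and "nonneg_minimizer p f"
  shows "f differentiable_on {0<..} \<and> antimono_on {0<..} (deriv f)"
proof -
  interpret nonneg_minimizer_profile p f using assms by unfold_locales
  have d: "(f has_real_derivative deriv f x) (at x)" and s: "\<And>r. r > 0 \<Longrightarrow> f r \<le> f x + deriv f x * (r - x)"
    if "x > 0" for x
  proof -
    obtain D where D: "(f has_real_derivative D) (at x)" "\<And>r. r > 0 \<Longrightarrow> f r \<le> f x + D * (r - x)"
      using f_has_derivative[OF \<open>x > 0\<close>] by blast
    then have "deriv f x = D" by (intro DERIV_imp_deriv)
    with D show "(f has_real_derivative deriv f x) (at x)" "\<And>r. r > 0 \<Longrightarrow> f r \<le> f x + deriv f x * (r - x)" by auto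
  qed
  have "f differentiable_on {0<..}"
    using d by (auto simp: differentiable_on_def real_differentiable_def intro: has_field_derivative_at_within)
  moreover have "deriv f y \<le> deriv f x" if xy: "0 < x" "x \<le> y" for x y
  proof (cases "x = y")
    case False
    \<comment> \<open>The sum of two supporting-line inequalities: the line at \<open>x\<close>
      evaluated at \<open>y\<close>, and the line at \<open>y\<close> evaluated at
      \<open>x\<close>.\<close>
    have "0 \<le> (deriv f x - deriv f y) * (y - x)"
      using s[of x y] s[of y x] xy by (simp add: algebra_simps)
    then show ?thesis using False xy by (simp add: zero_le_mult_iff)
  qed simp
  ultimately show ?thesis by (auto simp: monotone_on_def)
qed

end
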